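(* Let $G$ be a profinite group, let $p$ be a prime and let $P$ be a $p$-Sylow subgroup of $G$. Suppose that $\mu(\mathcal N_G(g))>0$ for every $g\in P$. Then the following hold: (1) $N_G(P)$ is an open subgroup of $G$. (2) $P/O_p(G)$ is finite. (3) $O_p(G)C_G(g)$ is open in $G$ for every $g\in P$. (4) If $P$ is finite, then $C_G(P)$ is open in $G$.
   Context: For a profinite group $G$, $\mu$ is the normalized Haar measure of $G$, and $\langle X\rangle$ denotes the closed subgroup generated by $X\subseteq G$. For $x\in G$, $\mathcal N_G(x)=\{y\in G : \langle x,y\rangle \text{ is pronilpotent}\}$ (a closed subset of $G$). $O_p(G)$ is the largest closed normal pro-$p$ subgroup of $G$ (the intersection of all $p$-Sylow subgroups of $G$). *)

theory Defs
  imports "HOL-Analysis.Analysis" "HOL-Algebra.Generated_Groups" "HOL-Algebra.Group_Action"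
    "HOL-Computational_Algebra.Primes"
begin

locale topological_group = group G for G (structure) +
  fixes T :: "'a topology"
  assumes topspace_eq: "topspace T = carrier G"
    and continuous_mult: "continuous_map (prod_topology T T) T (\<lambda>(x, y). x \<otimes> y)"
    and continuous_inv: "continuous_map T T (\<lambda>x. inv x)"

locale profinite_group = topological_group +
  assumes compact: "compact_space T"
    and Hausdorff: "Hausdorff_space T"
    and totally_disconnected: "\<forall>x\<in>topspace T. connected_component_of_set T x = {x}"

definition closed_subgroup :: "('a, 'b) monoid_scheme \<Rightarrow> 'a topology \<Rightarrow> 'a set \<Rightarrow> bool" where
  "closed_subgroup G T H \<longleftrightarrow> subgroup H G \<and> closedin T H"

text \<open>The closed subgroup generated by a subset of the group.\<close>

definition closed_generate :: "('a, 'b) monoid_scheme \<Rightarrow> 'a topology \<Rightarrow> 'a set \<Rightarrow> 'a set" where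
  "closed_generate G T X = \<Inter>{H. closed_subgroup G T H \<and> X \<subseteq> H}"

text \<open>Indexing starts at 0, so the usual \<open>\<gamma>\<^sub>1(G) = G\<close> is the term at index 0.\<close>

primrec lower_central_series :: "('a, 'b) monoid_scheme \<Rightarrow> nat \<Rightarrow> 'a set" where
  "lower_central_series G 0 = carrier G"
| "lower_central_series G (Suc n) =
     generate G (\<Union>x\<in>lower_central_series G n. \<Union>y\<in>carrier G.
       {x \<otimes>\<^bsub>G\<^esub> y \<otimes>\<^bsub>G\<^esub> inv\<^bsub>G\<^esub> x \<otimes>\<^bsub>G\<^esub> inv\<^bsub>G\<^esub> y})"

definition nilpotent_group :: "('a, 'b) monoid_scheme \<Rightarrow> bool" where
  "nilpotent_group G \<longleftrightarrow> group G \<and> (\<exists>n. lower_central_series G n = {\<one>\<^bsub>G\<^esub>})"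

text \<open>Pronilpotent and pro-\<open>p\<close> groups are described through their continuous finite
  quotients; in a compact group every quotient by an open normal subgroup is finite.\<close>

definition pronilpotent_group :: "('a, 'b) monoid_scheme \<Rightarrow> 'a topology \<Rightarrow> bool" where
  "pronilpotent_group G T \<longleftrightarrow>
     profinite_group G T \<and> (\<forall>N. N \<lhd> G \<and> openin T N \<longrightarrow> nilpotent_group (G Mod N))"

definition pro_p_group :: "nat \<Rightarrow> ('a, 'b) monoid_scheme \<Rightarrow> 'a topology \<Rightarrow> bool" where
  "pro_p_group p G T \<longleftrightarrow>
     profinite_group G T \<and> (\<forall>N. N \<lhd> G \<and> openin T N \<longrightarrow> (\<exists>k. order (G Mod N) = p ^ k))"

definition closed_pro_p_subgroup ::
  "nat \<Rightarrow> ('a, 'b) monoid_scheme \<Rightarrow> 'a topology \<Rightarrow> 'a set \<Rightarrow> bool" where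
  "closed_pro_p_subgroup p G T H \<longleftrightarrow>
     closed_subgroup G T H \<and> pro_p_group p (G\<lparr>carrier := H\<rparr>) (subtopology T H)"

text \<open>The index of a closed subgroup \<open>P\<close> is the supernatural number that is the least common
  multiple of the indices of the open subgroups containing \<open>P\<close>. It is prime to \<open>p\<close> iff each
  of these (finite) indices is.\<close>

definition sylow_subgroup ::
  "nat \<Rightarrow> ('a, 'b) monoid_scheme \<Rightarrow> 'a topology \<Rightarrow> 'a set \<Rightarrow> bool" where
  "sylow_subgroup p G T P \<longleftrightarrow>
     closed_pro_p_subgroup p G T P \<and>
     (\<forall>U. subgroup U G \<and> openin T U \<and> P \<subseteq> U \<longrightarrow> coprime p (card (rcosets\<^bsub>G\<^esub> U)))"

text \<open>\<open>O\<^sub>p(G)\<close>: greatest with respect to inclusion.\<close>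

definition p_core :: "nat \<Rightarrow> ('a, 'b) monoid_scheme \<Rightarrow> 'a topology \<Rightarrow> 'a set" where
  "p_core p G T = (GREATEST N. N \<lhd> G \<and> closed_pro_p_subgroup p G T N)"

definition centralizer :: "('a, 'b) monoid_scheme \<Rightarrow> 'a set \<Rightarrow> 'a set" where
  "centralizer G X = {x \<in> carrier G. \<forall>y\<in>X. x \<otimes>\<^bsub>G\<^esub> y = y \<otimes>\<^bsub>G\<^esub> x}"

text \<open>\<open>M\<close> is the normalized Haar measure on the Borel sets: the left-invariant regular Borel
  measure of total mass 1.\<close>

definition normalized_haar_measure ::
  "('a, 'b) monoid_scheme \<Rightarrow> 'a topology \<Rightarrow> 'a measure \<Rightarrow> bool" where
  "normalized_haar_measure G T M \<longleftrightarrow>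
     space M = topspace T \<and>
     sets M = sigma_sets (topspace T) {U. openin T U} \<and>
     emeasure M (space M) = 1 \<and>
     (\<forall>g\<in>carrier G. \<forall>A\<in>sets M. emeasure M (g <#\<^bsub>G\<^esub> A) = emeasure M A) \<and>
     (\<forall>A\<in>sets M. emeasure M A = (INF U\<in>{U. openin T U \<and> A \<subseteq> U}. emeasure M U)) \<and>
     (\<forall>U. openin T U \<longrightarrow> emeasure M U = (SUP K\<in>{K. compactin T K \<and> K \<subseteq> U}. emeasure M K))"

definition nilpotentizer :: "('a, 'b) monoid_scheme \<Rightarrow> 'a topology \<Rightarrow> 'a \<Rightarrow> 'a set" where
  "nilpotentizer G T x =
     {y \<in> carrier G. pronilpotent_group (G\<lparr>carrier := closed_generate G T {x, y}\<rparr>)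
        (subtopology T (closed_generate G T {x, y}))}"

end

theory Submission
  imports Defs "HOL-Algebra.Sylow" "HOL-Algebra.Multiplicative_Group" "HOL-Algebra.Zassenhaus"
begin

text \<open>
  Call a subgroup of a finite group a \<open>p\<close>-subgroup if its order is a power of \<open>p\<close>. If \<open>g\<close> is a
  \<open>p\<close>-element of a finite group and \<open>\<langle>g, y\<rangle>\<close> is nilpotent, then \<open>y\<close> normalizes a \<open>p\<close>-subgroup
  containing \<open>g\<close>. By Casolo's formula the number of such \<open>y\<close> is the number of \<open>t\<close> with
  \<open>g \<in> t P t\<^sup>-\<^sup>1\<close>, where \<open>P\<close> is a Sylow \<open>p\<close>-subgroup. So in all finite quotients of \<open>G\<close> a
  proportion bounded below of the conjugates of \<open>P\<close> contains \<open>g\<close>. By Baire's theorem the bound is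
  uniform for \<open>g\<close> in an open coset in \<open>P\<close>, and double counting shows that
  \<open>|P : P \<inter> t P t\<^sup>-\<^sup>1|\<close> is bounded for a positive proportion of all \<open>t\<close>. Since these indices are
  submultiplicative, \<open>G\<close> is a finite union of translates of a closed set on which they are
  bounded, so they are bounded on some open set. Where the index is maximal it is locally
  constant, hence \<open>P \<inter> N \<subseteq> t P t\<^sup>-\<^sup>1\<close> for some open normal subgroup \<open>N\<close> and all \<open>t\<close> in a coset of
  \<open>N\<close>. It follows that \<open>P \<inter> N\<close> is normal in \<open>G\<close>, and \<open>P/O\<^sub>p(G)\<close> is finite. The remaining claims
  then follow by pigeonhole: the relevant subgroups have bounded index modulo every \<open>N\<close>.
\<close>

section \<open>Subgroups of prime power order\<close>

text \<open>All counting takes place in finite quotients. A set of measure \<open>e\<close> meets at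
  least the fraction \<open>e\<close> of the cosets of every open normal \<open>M\<close>, so
  positive measure becomes a bound that does not depend on \<open>M\<close>. A condition on one
  quotient is clopen, so a condition on all quotients defines a closed set, open to Baire's theorem
  and compactness. Casolo's formula is indispensable because nilpotency of the subgroup generated by
  \<open>g\<close> and \<open>y\<close> gives only some invariant \<open>p\<close>-subgroup, in no
  relation to \<open>P\<close>; the formula trades the number of such \<open>y\<close> for a number
  of conjugates of \<open>P\<close>. It is proved by Moebius inversion on posets of invariant
  \<open>p\<close>-subgroups. The many \<open>t\<close> with bounded index form a set that varies
  with \<open>M\<close>. Passing to quotients of two such elements squares the bound, but yields a
  closed set independent of \<open>M\<close>. Normality of \<open>P \<inter> N\<close> arises modulo
  each \<open>M\<close>: its image is fixed by a coset of \<open>N\<close>, hence by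
  \<open>N\<close>, and is a Sylow subgroup of the image of \<open>N\<close>. Being the only one, it
  is invariant under all of \<open>G\<close>.\<close>

lemma image_factorization:
  assumes "\<And>x y. x \<in> A \<Longrightarrow> y \<in> A \<Longrightarrow> g x = g y \<Longrightarrow> f x = f y"
  shows "\<exists>h. f ` A = h ` g ` A"
proof -
  have "f ` A = (\<lambda>b. f (SOME x. x \<in> A \<and> g x = b)) ` g ` A"
    unfolding image_image
  proof (rule image_cong[OF refl])
    fix x assume x: "x \<in> A"
    have "(SOME x'. x' \<in> A \<and> g x' = g x) \<in> A \<and> g (SOME x'. x' \<in> A \<and> g x' = g x) = g x"
      by (rule someI[of _ x]) (use x in simp)
    then show "f x = f (SOME x'. x' \<in> A \<and> g x' = g x)" using assms[OF x] by simp
  qed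
  then show ?thesis by blast
qed

lemma card_image_le_if:
  assumes "finite (g ` A)" "\<And>x y. x \<in> A \<Longrightarrow> y \<in> A \<Longrightarrow> g x = g y \<Longrightarrow> f x = f y"
  shows "card (f ` A) \<le> card (g ` A)"
proof -
  obtain h where "f ` A = h ` g ` A" using image_factorization[of A g f] assms(2) by blast
  then show ?thesis using card_image_le[OF assms(1)] by simp
qed

text \<open>Orbits have \<open>p\<close>-power size by the orbit-stabilizer theorem, so only the
  one-element orbits count modulo \<open>p\<close>. The action enters as a plain function that obeys
  the action laws on \<open>E\<close>; \<open>restrict\<close> is applied inside the proof because
  the elements of \<open>BijGroup\<close> are extensional.\<close>

lemma (in group) p_group_fixed_points:
  fixes f :: "'a \<Rightarrow> 'e \<Rightarrow> 'e"
  assumes A: "subgroup A G" and cardA: "card A = p ^ k" and p: "prime p" and finE: "finite E"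
    and closed: "\<And>a x. a \<in> A \<Longrightarrow> x \<in> E \<Longrightarrow> f a x \<in> E"
    and f_one: "\<And>x. x \<in> E \<Longrightarrow> f \<one> x = x"
    and f_mult: "\<And>a b x. a \<in> A \<Longrightarrow> b \<in> A \<Longrightarrow> x \<in> E \<Longrightarrow> f (a \<otimes> b) x = f a (f b x)"
  shows "card E mod p = card {x \<in> E. \<forall>a\<in>A. f a x = x} mod p"
proof -
  let ?A = "G\<lparr>carrier := A\<rparr>" and ?f = "\<lambda>a. restrict (f a) E"
  let ?Fix = "{x \<in> E. \<forall>a\<in>A. f a x = x}"
  interpret A: group ?A
    using A by (rule subgroup.subgroup_is_group) (rule is_group)
  have bij: "bij_betw (f a) E E" if "a \<in> A" for a
  proof (rule bij_betw_byWitness[where f' = "f (inv a)"])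
    have inv: "inv a \<in> A" and "a \<in> carrier G"
      using A that subgroup.mem_carrier by (auto intro: subgroup.m_inv_closed)
    then show "\<forall>x\<in>E. f (inv a) (f a x) = x" "\<forall>x\<in>E. f a (f (inv a) x) = x"
      using that f_mult[symmetric] f_one by simp_all
    show "f a ` E \<subseteq> E" "f (inv a) ` E \<subseteq> E"
      using that inv closed by auto
  qed
  have Bij: "?f a \<in> Bij E" if "a \<in> A" for a
    using bij[OF that] by (auto simp: Bij_def cong: bij_betw_cong)
  have "?f \<in> hom ?A (BijGroup E)"
  proof (rule homI)
    show "?f a \<in> carrier (BijGroup E)" if "a \<in> carrier ?A" for a
      using Bij that by (simp add: BijGroup_def)
    show "?f (a \<otimes>\<^bsub>?A\<^esub> b) = ?f a \<otimes>\<^bsub>BijGroup E\<^esub> ?f b"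
      if "a \<in> carrier ?A" "b \<in> carrier ?A" for a b
      using that Bij closed by (auto simp: BijGroup_def compose_def fun_eq_iff f_mult)
  qed
  then interpret act: group_action ?A E ?f
    by (simp add: group_action_def group_hom_def group_hom_axioms_def group_BijGroup A.group_axioms)
  have fin_orbits: "finite (orbits ?A E ?f)"
    using finE by (simp add: orbits_def)
  have orb_sub: "orbit ?A ?f x \<subseteq> E" if "x \<in> E" for x
    using that closed by (auto simp: orbit_def)
  have orb_dvd: "card (orbit ?A ?f x) dvd p ^ k" if "x \<in> E" for x
  proof -
    have "card (orbit ?A ?f x) * card (stabilizer ?A ?f x) = p ^ k"
      using act.orbit_stabilizer_theorem[OF that] cardA by (simp add: order_def)
    from this[symmetric] show ?thesis by (rule dvdI)
  qed
  have x_orb: "x \<in> orbit ?A ?f x" if "x \<in> E" for x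
    using act.orbit_refl that by simp
  have orb_single: "card (orbit ?A ?f x) = 1 \<longleftrightarrow> orbit ?A ?f x = {x}" if "x \<in> E" for x
    using x_orb[OF that] by (auto simp: card_1_singleton_iff)
  have orb_fix: "orbit ?A ?f x = {x} \<longleftrightarrow> x \<in> ?Fix" if "x \<in> E" for x
    using that x_orb[OF that] by (auto simp: orbit_def)
  have orb_p: "p dvd card (orbit ?A ?f x)" if x: "x \<in> E" "x \<notin> ?Fix" for x
  proof -
    obtain j where j: "card (orbit ?A ?f x) = p ^ j"
      using orb_dvd[OF x(1)] divides_primepow_nat[OF p] by blast
    moreover have "j \<noteq> 0"
    proof
      assume "j = 0"
      then have "card (orbit ?A ?f x) = 1" using j by simp
      then have "x \<in> ?Fix" by (simp only: orb_single[OF x(1)] orb_fix[OF x(1)])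
      then show False using x(2) by (rule notE[rotated])
    qed
    ultimately show ?thesis by simp
  qed
  let ?S = "(\<lambda>x. {x}) ` ?Fix" and ?O = "orbits ?A E ?f"
  have S: "?S \<subseteq> ?O"
  proof
    fix s assume "s \<in> ?S"
    then obtain x where x: "x \<in> ?Fix" "s = {x}" by blast
    then have "orbit ?A ?f x = {x}" using orb_fix by auto
    with x show "s \<in> ?O" unfolding orbits_def by blast
  qed
  have rest: "p dvd card s" if s: "s \<in> ?O - ?S" for s
  proof -
    obtain x where x: "x \<in> E" "s = orbit ?A ?f x"
      using s by (auto simp: orbits_def)
    then have "x \<notin> ?Fix" using s orb_fix[OF x(1)] by auto
    with orb_p x show ?thesis by blast
  qed
  have "card E = (\<Sum>s\<in>?O. card s)"
    using act.disjoint_sum[OF finE, of "\<lambda>_. 1::nat"] by simp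
  also have "\<dots> = (\<Sum>s\<in>?O - ?S. card s) + (\<Sum>s\<in>?S. card s)"
    using sum.subset_diff[OF S fin_orbits] .
  also have "(\<Sum>s\<in>?S. card s) = card ?Fix"
    by (subst sum.reindex) (auto simp: inj_on_def)
  finally have "card E = (\<Sum>s\<in>?O - ?S. card s) + card ?Fix" .
  moreover have "p dvd (\<Sum>s\<in>?O - ?S. card s)"
    by (rule dvd_sum) (use rest in blast)
  ultimately show ?thesis by (simp add: mod_add_left_eq[symmetric, of "sum _ _"] dvd_eq_mod_eq_0)
qed

text \<open>An infinite set has cardinality 0, which is no power of a prime, so for prime
  \<open>p\<close> these subgroups are finite.\<close>

definition p_subgroup :: "nat \<Rightarrow> ('a, 'b) monoid_scheme \<Rightarrow> 'a set \<Rightarrow> bool" where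
  "p_subgroup p G A \<longleftrightarrow> subgroup A G \<and> (\<exists>k. card A = p ^ k)"

definition conjugate :: "('a, 'b) monoid_scheme \<Rightarrow> 'a \<Rightarrow> 'a set \<Rightarrow> 'a set" where
  "conjugate G g A = (\<lambda>a. g \<otimes>\<^bsub>G\<^esub> a \<otimes>\<^bsub>G\<^esub> inv\<^bsub>G\<^esub> g) ` A"

text \<open>Taken relative to \<open>K\<close>, because the induction behind Casolo's formula
  descends to subgroups \<open>K\<close> while the ambient group stays fixed.\<close>

definition normalizer_in :: "('a, 'b) monoid_scheme \<Rightarrow> 'a set \<Rightarrow> 'a set \<Rightarrow> 'a set" where
  "normalizer_in G K A = {g \<in> K. conjugate G g A = A}"

section \<open>Conjugation and left cosets inside a finite subgroup\<close>

context group
begin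

lemma inv_mult_cancel:
  assumes "g \<in> carrier G" "z \<in> carrier G"
  shows "inv g \<otimes> (g \<otimes> z) = z" "g \<otimes> (inv g \<otimes> z) = z"
  using assms by (simp_all add: m_assoc[symmetric])

lemma conjugate_closed: "g \<in> carrier G \<Longrightarrow> A \<subseteq> carrier G \<Longrightarrow> conjugate G g A \<subseteq> carrier G"
  by (auto simp: conjugate_def)

lemma conjugate_conjugate:
  assumes "g \<in> carrier G" "h \<in> carrier G" "A \<subseteq> carrier G"
  shows "conjugate G g (conjugate G h A) = conjugate G (g \<otimes> h) A"
proof -
  have "g \<otimes> (h \<otimes> a \<otimes> inv h) \<otimes> inv g = g \<otimes> h \<otimes> a \<otimes> inv (g \<otimes> h)" if "a \<in> A" for a
    using assms that by (auto simp: m_assoc inv_mult_group subset_iff)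
  then show ?thesis
    by (simp add: conjugate_def image_image cong: image_cong)
qed

lemma conjugate_one: "A \<subseteq> carrier G \<Longrightarrow> conjugate G \<one> A = A"
  by (force simp: conjugate_def)

lemma conjugate_inv_cancel:
  assumes "g \<in> carrier G" "A \<subseteq> carrier G"
  shows "conjugate G (inv g) (conjugate G g A) = A" "conjugate G g (conjugate G (inv g) A) = A"
  using assms by (simp_all add: conjugate_conjugate conjugate_one)

lemma conjugate_mono: "A \<subseteq> B \<Longrightarrow> conjugate G g A \<subseteq> conjugate G g B"
  by (auto simp: conjugate_def)

lemma mem_conjugate_iff:
  assumes "g \<in> carrier G" "x \<in> carrier G" "A \<subseteq> carrier G"
  shows "x \<in> conjugate G g A \<longleftrightarrow> inv g \<otimes> x \<otimes> g \<in> A"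
proof
  assume "x \<in> conjugate G g A"
  then obtain a where "a \<in> A" "x = g \<otimes> a \<otimes> inv g"
    by (auto simp: conjugate_def)
  then show "inv g \<otimes> x \<otimes> g \<in> A"
    using assms by (auto simp: m_assoc subset_iff inv_mult_cancel)
next
  assume "inv g \<otimes> x \<otimes> g \<in> A"
  moreover have "x = g \<otimes> (inv g \<otimes> x \<otimes> g) \<otimes> inv g"
    using assms by (simp add: m_assoc inv_mult_cancel)
  ultimately show "x \<in> conjugate G g A"
    by (auto simp: conjugate_def)
qed

lemma conjugate_Int:
  assumes "g \<in> carrier G" "A \<subseteq> carrier G" "B \<subseteq> carrier G"
  shows "conjugate G g (A \<inter> B) = conjugate G g A \<inter> conjugate G g B"
  unfolding conjugate_def
  by (rule inj_on_image_Int[where C = "carrier G"]) (use assms in \<open>auto simp: inj_on_def\<close>)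

lemma inj_on_conjugation: "g \<in> carrier G \<Longrightarrow> A \<subseteq> carrier G \<Longrightarrow> inj_on (\<lambda>a. g \<otimes> a \<otimes> inv g) A"
  by (auto simp: inj_on_def subset_iff)

lemma card_conjugate: "g \<in> carrier G \<Longrightarrow> A \<subseteq> carrier G \<Longrightarrow> card (conjugate G g A) = card A"
  unfolding conjugate_def by (rule card_image) (rule inj_on_conjugation)

lemma conjugate_subgroup:
  assumes g: "g \<in> carrier G" and A: "subgroup A G"
  shows "subgroup (conjugate G g A) G"
proof (rule subgroupI)
  have A': "A \<subseteq> carrier G" using A by (rule subgroup.subset)
  show "conjugate G g A \<subseteq> carrier G" using g A' by (rule conjugate_closed)
  show "conjugate G g A \<noteq> {}" using A subgroup.one_closed by (force simp: conjugate_def)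
  show "inv x \<in> conjugate G g A" if "x \<in> conjugate G g A" for x
  proof -
    obtain a where a: "a \<in> A" "x = g \<otimes> a \<otimes> inv g"
      using \<open>x \<in> _\<close> by (auto simp: conjugate_def)
    then have "inv x = g \<otimes> inv a \<otimes> inv g"
      using g A' by (auto simp: inv_mult_group m_assoc subset_iff)
    then show ?thesis using a A by (auto simp: conjugate_def subgroup.m_inv_closed)
  qed
  show "x \<otimes> y \<in> conjugate G g A" if xy: "x \<in> conjugate G g A" "y \<in> conjugate G g A" for x y
  proof -
    obtain a b where a: "a \<in> A" "x = g \<otimes> a \<otimes> inv g" and b: "b \<in> A" "y = g \<otimes> b \<otimes> inv g"
      using xy unfolding conjugate_def by blast
    then have "x \<otimes> y = g \<otimes> (a \<otimes> b) \<otimes> inv g"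
      using g A' by (auto simp: m_assoc subset_iff inv_mult_cancel)
    then show ?thesis using a b A by (auto simp: conjugate_def subgroup.m_closed)
  qed
qed

lemma conjugate_self:
  assumes "subgroup A G" "a \<in> A"
  shows "conjugate G a A = A"
proof -
  have sub: "conjugate G b A \<subseteq> A" if "b \<in> A" for b
    using assms(1) that by (auto simp: conjugate_def subgroup.m_closed subgroup.m_inv_closed)
  have A: "A \<subseteq> carrier G" "a \<in> carrier G"
    using assms by (auto dest: subgroup.subset)
  have "conjugate G (inv a) A \<subseteq> A"
    using sub subgroup.m_inv_closed[OF assms] .
  then have "conjugate G a (conjugate G (inv a) A) \<subseteq> conjugate G a A"
    by (rule conjugate_mono)
  then show ?thesis
    using sub[OF assms(2)] conjugate_inv_cancel(2)[OF A(2,1)] by simp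
qed

lemma normal_conjugate_eq:
  assumes N: "N \<lhd> G" and g: "g \<in> carrier G"
  shows "conjugate G g N = N"
proof -
  interpret N: normal N G by (rule N)
  have sub: "conjugate G h N \<subseteq> N" if "h \<in> carrier G" for h
    using N.inv_op_closed2[OF that] by (auto simp: conjugate_def)
  then show ?thesis
    using sub[OF g] conjugate_mono[OF sub[OF inv_closed[OF g]], of g]
      conjugate_inv_cancel(2)[OF g N.subset] by simp
qed

lemma subgroup_normalizer_in:
  assumes K: "subgroup K G" and A: "A \<subseteq> carrier G"
  shows "subgroup (normalizer_in G K A) G"
proof (rule subgroupI)
  have K': "K \<subseteq> carrier G" using K by (rule subgroup.subset)
  show "normalizer_in G K A \<subseteq> carrier G" using K' by (auto simp: normalizer_in_def)
  show "normalizer_in G K A \<noteq> {}"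
    using conjugate_one[OF A] K subgroup.one_closed by (auto simp: normalizer_in_def)
  show "inv x \<in> normalizer_in G K A" if "x \<in> normalizer_in G K A" for x
    using that A K' conjugate_inv_cancel(1)[of x A] K
    by (auto simp: normalizer_in_def subgroup.m_inv_closed subset_iff)
  show "x \<otimes> y \<in> normalizer_in G K A" if "x \<in> normalizer_in G K A" "y \<in> normalizer_in G K A" for x y
    using that A K' conjugate_conjugate[of x y A] K
    by (auto simp: normalizer_in_def subgroup.m_closed subset_iff)
qed

lemma subset_normalizer_in: "subgroup A G \<Longrightarrow> A \<subseteq> K \<Longrightarrow> A \<subseteq> normalizer_in G K A"
  using conjugate_self by (auto simp: normalizer_in_def)

lemma p_subgroup_conjugate: "p_subgroup p G A \<Longrightarrow> g \<in> carrier G \<Longrightarrow> p_subgroup p G (conjugate G g A)"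
  unfolding p_subgroup_def by (simp add: card_conjugate conjugate_subgroup subgroup.subset)

lemma p_subgroup_subset:
  assumes "p_subgroup p G A" "subgroup B G" "B \<subseteq> A" "prime p" "finite A"
  shows "p_subgroup p G B"
proof -
  have "group (G\<lparr>carrier := A\<rparr>)" "subgroup B (G\<lparr>carrier := A\<rparr>)"
    using assms by (auto simp: p_subgroup_def subgroup.subgroup_is_group subgroup_incl)
  then have "card (rcosets\<^bsub>G\<lparr>carrier := A\<rparr>\<^esub> B) * card B = card A"
    using group.lagrange[of "G\<lparr>carrier := A\<rparr>" B] by (simp add: order_def)
  then have dvd: "card B dvd card A"
    by (metis dvd_triv_right)
  obtain k where "card A = p ^ k"
    using assms(1) by (auto simp: p_subgroup_def)
  then show ?thesis
    using dvd assms(2,4) divides_primepow_nat[of p "card B" k] by (auto simp: p_subgroup_def)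
qed

lemma
  assumes K: "subgroup K G" and H: "subgroup H G" "H \<subseteq> K" and fin: "finite K"
  shows card_l_cosets: "card ((\<lambda>g. g <# H) ` K) * card H = card K"
    and l_coset_eq_iff: "\<And>g h. g \<in> K \<Longrightarrow> h \<in> K \<Longrightarrow> g <# H = h <# H \<longleftrightarrow> inv h \<otimes> g \<in> H"
proof -
  have K': "K \<subseteq> carrier G" using K by (rule subgroup.subset)
  have H': "H \<subseteq> carrier G" using H K' by blast
  have memb: "x \<in> g <# H \<longleftrightarrow> inv g \<otimes> x \<in> H" if "g \<in> K" "x \<in> carrier G" for g x
  proof -
    have g: "g \<in> carrier G" using K' that by blast
    have "x = g \<otimes> (inv g \<otimes> x)" using g that by (simp add: inv_mult_cancel)
    moreover have "inv g \<otimes> (g \<otimes> h) = h" if "h \<in> H" for h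
      using g that H' by (simp add: inv_mult_cancel subset_iff)
    ultimately show ?thesis by (auto simp: l_coset_def)
  qed
  have sub: "g <# H \<subseteq> K" if "g \<in> K" for g
    using that H K by (auto simp: l_coset_def subgroup.m_closed subset_iff)
  have eq: "g <# H = h <# H" if "g \<in> K" "h \<in> K" "x \<in> g <# H" "x \<in> h <# H" for g h x
  proof -
    have *: "g <# H \<subseteq> h <# H" if "g \<in> K" "h \<in> K" "x \<in> g <# H" "x \<in> h <# H" for g h
    proof
      fix y assume y: "y \<in> g <# H"
      have c: "g \<in> carrier G" "h \<in> carrier G" "x \<in> carrier G" "y \<in> carrier G"
        using that y sub K' by blast+
      have "inv h \<otimes> x \<in> H" "inv g \<otimes> x \<in> H" "inv g \<otimes> y \<in> H"
        using that y c memb by blast+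
      then have "(inv h \<otimes> x) \<otimes> inv (inv g \<otimes> x) \<otimes> (inv g \<otimes> y) \<in> H"
        using H by (simp add: subgroup.m_closed subgroup.m_inv_closed)
      also have "(inv h \<otimes> x) \<otimes> inv (inv g \<otimes> x) \<otimes> (inv g \<otimes> y) = inv h \<otimes> y"
        using c by (simp add: inv_mult_group m_assoc) (simp add: m_assoc[symmetric])
      finally show "y \<in> h <# H" using memb that c by blast
    qed
    show ?thesis using *[of g h] *[of h g] that by blast
  qed
  have self: "g \<in> g <# H" if "g \<in> K" for g
    using memb[OF that, of g] that K' H by (simp add: subset_iff subgroup.one_closed)
  show "g <# H = h <# H \<longleftrightarrow> inv h \<otimes> g \<in> H" if "g \<in> K" "h \<in> K" for g h
  proof -
    have "g \<in> h <# H \<longleftrightarrow> inv h \<otimes> g \<in> H"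
      using memb[of h g] that K' by blast
    moreover have "g <# H = h <# H \<longleftrightarrow> g \<in> h <# H"
      using self[of g] eq[of g h g] that by blast
    ultimately show ?thesis by blast
  qed
  have "card (g <# H) = card H" if "g \<in> K" for g
  proof -
    have "g <# H = (\<lambda>h. g \<otimes> h) ` H" by (auto simp: l_coset_def)
    moreover have "inj_on (\<lambda>h. g \<otimes> h) H"
      using that K' H' by (auto simp: inj_on_def subset_iff)
    ultimately show ?thesis by (simp add: card_image)
  qed
  moreover have U: "\<Union>((\<lambda>g. g <# H) ` K) = K"
    using sub self by blast
  ultimately have "card H * card ((\<lambda>g. g <# H) ` K) = card (\<Union>((\<lambda>g. g <# H) ` K))"
  proof (intro card_partition)
    show "C \<inter> D = {}" if CD: "C \<in> (\<lambda>g. g <# H) ` K" "D \<in> (\<lambda>g. g <# H) ` K" "C \<noteq> D" for C D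
    proof -
      obtain g h where gh: "g \<in> K" "h \<in> K" "C = g <# H" "D = h <# H" using CD by blast
      then show ?thesis using CD(3) eq[OF gh(1,2)] by blast
    qed
  qed (use fin in auto)
  then show "card ((\<lambda>g. g <# H) ` K) * card H = card K"
    using U by (simp add: mult.commute)
qed

text \<open>\<open>A\<close> acts on the left cosets of \<open>H\<close> by left multiplication and
  fixes \<open>g <# H\<close> exactly when it lies in the conjugate of \<open>H\<close> by
  \<open>g\<close>. The containment of \<open>p\<close>-subgroups in Sylow subgroups and the growth
  of normalizers are both read off from this congruence.\<close>

lemma card_fixed_l_cosets:
  assumes K: "subgroup K G" and H: "subgroup H G" "H \<subseteq> K" and fin: "finite K"
    and A: "p_subgroup p G A" "A \<subseteq> K" and p: "prime p"
  shows "card ((\<lambda>g. g <# H) ` K) mod p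
    = card ((\<lambda>g. g <# H) ` {g \<in> K. A \<subseteq> conjugate G g H}) mod p"
proof -
  let ?E = "(\<lambda>g. g <# H) ` K"
  have K': "K \<subseteq> carrier G" and H': "H \<subseteq> carrier G" and A': "A \<subseteq> carrier G"
    using K H A by (auto simp: p_subgroup_def dest!: subgroup.subset)
  obtain k where k: "card A = p ^ k" and subA: "subgroup A G" using A by (auto simp: p_subgroup_def)
  have act: "a <# (g <# H) = (a \<otimes> g) <# H" if "a \<in> A" "g \<in> K" for a g
    using that K' A' H' lcos_m_assoc by blast
  have "card ?E mod p = card {C \<in> ?E. \<forall>a\<in>A. a <# C = C} mod p"
  proof (rule p_group_fixed_points[OF subA k p])
    show "finite ?E" using fin by simp
    show "a <# C \<in> ?E" if "a \<in> A" "C \<in> ?E" for a C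
    proof -
      obtain g where g: "g \<in> K" "C = g <# H" using \<open>C \<in> ?E\<close> by blast
      have "a \<otimes> g \<in> K" using g \<open>a \<in> A\<close> A(2) by (auto intro: subgroup.m_closed[OF K])
      then show ?thesis using g act[OF \<open>a \<in> A\<close> g(1)] by simp
    qed
    show "\<one> <# C = C" if "C \<in> ?E" for C
    proof -
      have "C \<subseteq> carrier G" using that K' H' l_coset_subset_G by blast
      then show ?thesis by (rule lcos_mult_one)
    qed
    show "(a \<otimes> b) <# C = a <# (b <# C)" if "a \<in> A" "b \<in> A" "C \<in> ?E" for a b C
    proof -
      have c: "a \<in> carrier G" "b \<in> carrier G" "C \<subseteq> carrier G"
        using that K' A' H' l_coset_subset_G by blast+
      then show ?thesis using lcos_m_assoc[of C a b] by simp
    qed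
  qed
  also have "{C \<in> ?E. \<forall>a\<in>A. a <# C = C} = (\<lambda>g. g <# H) ` {g \<in> K. A \<subseteq> conjugate G g H}"
  proof -
    have "(\<forall>a\<in>A. a <# (g <# H) = g <# H) \<longleftrightarrow> A \<subseteq> conjugate G g H" if g: "g \<in> K" for g
    proof -
      have "a <# (g <# H) = g <# H \<longleftrightarrow> a \<in> conjugate G g H" if a: "a \<in> A" for a
      proof -
        have c: "g \<in> carrier G" "a \<in> carrier G" using g a A' K' by auto
        have "a \<otimes> g \<in> K" using a g A K by (auto simp: subgroup.m_closed)
        then have "(a \<otimes> g) <# H = g <# H \<longleftrightarrow> inv g \<otimes> (a \<otimes> g) \<in> H"
          using l_coset_eq_iff[OF K H fin] g by blast
        then show ?thesis
          using act[OF a g] mem_conjugate_iff[of g a H] c H' by (simp add: m_assoc)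
      qed
      then show ?thesis by blast
    qed
    then show ?thesis by blast
  qed
  finally show ?thesis .
qed

end

text \<open>For a finite \<open>K\<close> these are the Sylow \<open>p\<close>-subgroups, in the
  order-theoretic form that the weights on posets of \<open>p\<close>-subgroups call for.\<close>

definition maximal_p_subgroup :: "nat \<Rightarrow> ('a, 'b) monoid_scheme \<Rightarrow> 'a set \<Rightarrow> 'a set \<Rightarrow> bool" where
  "maximal_p_subgroup p G K R \<longleftrightarrow>
     p_subgroup p G R \<and> R \<subseteq> K \<and> (\<forall>A. p_subgroup p G A \<longrightarrow> A \<subseteq> K \<longrightarrow> R \<subseteq> A \<longrightarrow> A = R)"

section \<open>Sylow theory relative to a subgroup\<close>

context group
begin

text \<open>Let \<open>H\<close> act on its cosets in \<open>B\<close>. Their number is a positive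
  power of \<open>p\<close>, so \<open>p\<close> divides the number of fixed ones, which are the
  cosets of \<open>H\<close> in its normalizer. If the normalizer were \<open>H\<close>, this number
  would be 1.\<close>

lemma p_subgroup_normalizer_grows:
  assumes H: "p_subgroup p G H" and B: "p_subgroup p G B" and HB: "H \<subset> B"
    and fin: "finite B" and p: "prime p"
  shows "H \<subset> normalizer_in G B H"
proof -
  have sH: "subgroup H G" and sB: "subgroup B G" using H B by (auto simp: p_subgroup_def)
  have B': "B \<subseteq> carrier G" using sB by (rule subgroup.subset)
  have H': "H \<subseteq> carrier G" using sH by (rule subgroup.subset)
  obtain j where j: "card B = p ^ j" using B by (auto simp: p_subgroup_def)
  let ?E = "(\<lambda>g. g <#\<^bsub>G\<^esub> H) ` B"
  have card: "card ?E * card H = card B"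
    using sB sH HB fin by (intro card_l_cosets) auto
  obtain i where i: "card ?E = p ^ i"
    using card j divides_primepow_nat[OF p, of "card ?E" j] by (metis dvd_triv_left)
  have "card H < card B" using fin HB by (rule psubset_card_mono)
  then have "i \<noteq> 0" using card i by (cases i) auto
  then have "card ?E mod p = 0" using i by simp
  moreover have "card ?E mod p = card ((\<lambda>g. g <#\<^bsub>G\<^esub> H) ` {g \<in> B. H \<subseteq> conjugate G g H}) mod p"
    using sB sH HB fin H p by (intro card_fixed_l_cosets) auto
  ultimately have zero: "card ((\<lambda>g. g <#\<^bsub>G\<^esub> H) ` {g \<in> B. H \<subseteq> conjugate G g H}) mod p = 0"
    by simp
  have conj: "H \<subseteq> conjugate G g H \<longleftrightarrow> conjugate G g H = H" if "g \<in> B" for g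
  proof -
    have g: "g \<in> carrier G" using that B' by blast
    have "finite H" using fin HB finite_subset by blast
    then have "finite (conjugate G g H)" by (simp add: conjugate_def)
    then show ?thesis using card_conjugate[OF g H'] card_subset_eq by (metis order_refl)
  qed
  then have eq: "{g \<in> B. H \<subseteq> conjugate G g H} = normalizer_in G B H"
    unfolding normalizer_in_def by blast
  have sub: "H \<subseteq> normalizer_in G B H" using subset_normalizer_in[OF sH] HB by blast
  have "normalizer_in G B H \<noteq> H"
  proof
    assume N: "normalizer_in G B H = H"
    have "g <#\<^bsub>G\<^esub> H = H" if "g \<in> H" for g
    proof -
      have "g <#\<^bsub>G\<^esub> H = \<one> <# H"
        using l_coset_eq_iff[OF sB sH _ fin, of g \<one>] that HB B' sB by (auto simp: subset_iff subgroup.one_closed)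
      then show ?thesis using lcos_mult_one[OF H'] by simp
    qed
    then have "(\<lambda>g. g <#\<^bsub>G\<^esub> H) ` H = {H}" using subgroup.one_closed[OF sH] by force
    then have "1 mod p = 0" using zero eq N by simp
    then show False using prime_gt_1_nat[OF p] by simp
  qed
  then show ?thesis using sub by blast
qed

lemma conjugate_subset_subgroup:
  assumes "subgroup K G" "g \<in> K" "A \<subseteq> K"
  shows "conjugate G g A \<subseteq> K"
  using assms by (auto simp: conjugate_def subset_iff subgroup.m_closed subgroup.m_inv_closed)

text \<open>The number of cosets of \<open>Q\<close> is not divisible by \<open>p\<close>, so the
  congruence for fixed cosets leaves at least one that \<open>A\<close> fixes.\<close>

lemma p_subgroup_subset_conjugate:
  assumes K: "subgroup K G" "finite K" and p: "prime p"
    and Q: "p_subgroup p G Q" "Q \<subseteq> K" "\<not> p dvd card ((\<lambda>g. g <#\<^bsub>G\<^esub> Q) ` K)"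
    and A: "p_subgroup p G A" "A \<subseteq> K"
  shows "\<exists>g\<in>K. A \<subseteq> conjugate G g Q"
proof (rule ccontr)
  assume "\<not> ?thesis"
  then have "{g \<in> K. A \<subseteq> conjugate G g Q} = {}" by blast
  moreover have "card ((\<lambda>g. g <#\<^bsub>G\<^esub> Q) ` K) mod p = card ((\<lambda>g. g <# Q) ` {g \<in> K. A \<subseteq> conjugate G g Q}) mod p"
    using K Q A p by (intro card_fixed_l_cosets) (auto simp: p_subgroup_def)
  ultimately show False using Q(3) by (simp only: image_empty card.empty) auto
qed

lemma maximal_if_index_coprime:
  assumes K: "subgroup K G" "finite K" and p: "prime p"
    and Q: "p_subgroup p G Q" "Q \<subseteq> K" "\<not> p dvd card ((\<lambda>g. g <#\<^bsub>G\<^esub> Q) ` K)"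
  shows "maximal_p_subgroup p G K Q"
  unfolding maximal_p_subgroup_def
proof (intro conjI allI impI)
  fix A assume A: "p_subgroup p G A" "A \<subseteq> K" "Q \<subseteq> A"
  obtain g where g: "g \<in> K" "A \<subseteq> conjugate G g Q"
    using p_subgroup_subset_conjugate[OF K p Q A(1,2)] by blast
  have "finite Q" "finite A" using K(2) Q(2) A(2) finite_subset by blast+
  have "card A \<le> card (conjugate G g Q)"
    using g \<open>finite Q\<close> by (intro card_mono) (auto simp: conjugate_def)
  also have "\<dots> = card Q"
    using g K(1) Q(2) subgroup.subset[OF K(1)] by (intro card_conjugate) auto
  finally show "A = Q" using A(3) \<open>finite A\<close> by (metis card_seteq)
qed (use Q in auto)

lemma ex_Sylow_in:
  assumes K: "subgroup K G" "finite K" and p: "prime p"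
  obtains Q where "p_subgroup p G Q" "Q \<subseteq> K" "\<not> p dvd card ((\<lambda>g. g <#\<^bsub>G\<^esub> Q) ` K)"
proof -
  let ?K = "G\<lparr>carrier := K\<rparr>"
  have grp: "group ?K" using K(1) by (rule subgroup.subgroup_is_group) (rule is_group)
  have pos: "card K \<noteq> 0" using K subgroup.one_closed[OF K(1)] by auto
  have np: "\<not> is_unit p" using p by auto
  obtain m where m: "card K = p ^ multiplicity p (card K) * m" "\<not> p dvd m"
    using multiplicity_decompose'[OF pos np] by metis
  have "\<exists>Q. subgroup Q ?K \<and> card Q = p ^ multiplicity p (card K)"
    using sylow_thm[OF p grp, of "multiplicity p (card K)" m] m(1) K(2) by (simp add: order_def)
  then obtain Q where Q: "subgroup Q ?K" "card Q = p ^ multiplicity p (card K)" by blast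
  have sQ: "subgroup Q G" "Q \<subseteq> K"
    using Q(1) incl_subgroup[OF K(1)] subgroup.subset[OF Q(1)] by auto
  have "card ((\<lambda>g. g <#\<^bsub>G\<^esub> Q) ` K) * card Q = card K"
    using K sQ by (intro card_l_cosets)
  then have "card ((\<lambda>g. g <#\<^bsub>G\<^esub> Q) ` K) * p ^ multiplicity p (card K) = m * p ^ multiplicity p (card K)"
    using m(1) Q(2) by (simp add: mult.commute)
  then have "card ((\<lambda>g. g <#\<^bsub>G\<^esub> Q) ` K) = m" using prime_gt_0_nat[OF p] by simp
  then show ?thesis using that[of Q] sQ Q(2) m(2) by (auto simp: p_subgroup_def)
qed

lemma maximal_p_subgroup_conjugate:
  assumes K: "subgroup K G" and R: "maximal_p_subgroup p G K R" and g: "g \<in> K"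
  shows "maximal_p_subgroup p G K (conjugate G g R)"
  unfolding maximal_p_subgroup_def
proof (intro conjI allI impI)
  have gc: "g \<in> carrier G" "inv g \<in> K" and K': "K \<subseteq> carrier G" and Rc: "R \<subseteq> carrier G"
    using g K R subgroup.subset[OF K] subgroup.m_inv_closed[OF K] by (auto simp: maximal_p_subgroup_def)
  show "p_subgroup p G (conjugate G g R)" "conjugate G g R \<subseteq> K"
    using R g gc K by (auto simp: maximal_p_subgroup_def p_subgroup_conjugate conjugate_subset_subgroup)
  fix A assume A: "p_subgroup p G A" "A \<subseteq> K" "conjugate G g R \<subseteq> A"
  have Ac: "A \<subseteq> carrier G" using A(2) K' by blast
  have "R \<subseteq> conjugate G (inv g) A"
    using conjugate_mono[OF A(3), of "inv g"] conjugate_inv_cancel(1)[OF gc(1) Rc] by simp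
  moreover have "p_subgroup p G (conjugate G (inv g) A)" "conjugate G (inv g) A \<subseteq> K"
    using A gc K by (auto simp: p_subgroup_conjugate conjugate_subset_subgroup)
  ultimately have "conjugate G (inv g) A = R"
    using R by (auto simp: maximal_p_subgroup_def)
  then show "A = conjugate G g R" using conjugate_inv_cancel(2)[OF gc(1) Ac] by simp
qed

text \<open>By Sylow's theorem there is a \<open>Q\<close> of index prime to \<open>p\<close>, and
  some conjugate of it contains \<open>R\<close>. By maximality the two are equal, so what holds for
  \<open>Q\<close> passes to \<open>R\<close>.\<close>

lemma p_subgroup_subset_conjugate_maximal:
  assumes K: "subgroup K G" "finite K" and p: "prime p"
    and R: "maximal_p_subgroup p G K R" and A: "p_subgroup p G A" "A \<subseteq> K"
  shows "\<exists>g\<in>K. A \<subseteq> conjugate G g R"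
proof -
  have K': "K \<subseteq> carrier G" using K(1) by (rule subgroup.subset)
  obtain Q where Q: "p_subgroup p G Q" "Q \<subseteq> K" "\<not> p dvd card ((\<lambda>g. g <#\<^bsub>G\<^esub> Q) ` K)"
    using ex_Sylow_in[OF K p] by blast
  have Qc: "Q \<subseteq> carrier G" using Q(2) K' by blast
  have R': "p_subgroup p G R" "R \<subseteq> K" using R by (auto simp: maximal_p_subgroup_def)
  obtain k where k: "k \<in> K" "R \<subseteq> conjugate G k Q"
    using p_subgroup_subset_conjugate[OF K p Q R'] by blast
  have kc: "k \<in> carrier G" using k(1) K' by blast
  have "conjugate G k Q = R"
    using R k Q kc K(1) by (auto simp: maximal_p_subgroup_def p_subgroup_conjugate conjugate_subset_subgroup)
  then have QR: "Q = conjugate G (inv k) R"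
    using conjugate_inv_cancel(1)[OF kc Qc] by simp
  obtain g where g: "g \<in> K" "A \<subseteq> conjugate G g Q"
    using p_subgroup_subset_conjugate[OF K p Q A] by blast
  have gc: "g \<in> carrier G" using g(1) K' by blast
  have "A \<subseteq> conjugate G (g \<otimes> inv k) R"
    using g(2) QR conjugate_conjugate[of g "inv k" R] gc kc R'(2) K' by auto
  moreover have "g \<otimes> inv k \<in> K"
    using g(1) k(1) K(1) by (auto intro!: subgroup.m_closed subgroup.m_inv_closed)
  ultimately show ?thesis by blast
qed

lemma ex_maximal_p_subgroup:
  assumes K: "subgroup K G" "finite K" and p: "prime p"
  shows "\<exists>R. maximal_p_subgroup p G K R"
  using ex_Sylow_in[OF K p] maximal_if_index_coprime[OF K p] by metis

text \<open>Each \<open>B\<close> in the sum is a conjugate of \<open>R\<close>, and the elements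
  that carry \<open>R\<close> to \<open>B\<close> form a coset of the normalizer of
  \<open>B\<close>. The sum sorts the \<open>t\<close> on the right by the conjugate that they
  produce.\<close>

lemma sum_card_normalizer_maximal:
  assumes K: "subgroup K G" "finite K" and p: "prime p"
    and R: "maximal_p_subgroup p G K R"
  shows "(\<Sum>B | maximal_p_subgroup p G K B \<and> H \<subseteq> B. card (normalizer_in G K B))
    = card {t \<in> K. H \<subseteq> conjugate G t R}"
proof -
  let ?S = "{B. maximal_p_subgroup p G K B \<and> H \<subseteq> B}"
  have K': "K \<subseteq> carrier G" using K(1) by (rule subgroup.subset)
  have R': "p_subgroup p G R" "R \<subseteq> K" "R \<subseteq> carrier G"
    using R K' by (auto simp: maximal_p_subgroup_def)
  have "?S \<subseteq> Pow K" by (auto simp: maximal_p_subgroup_def)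
  then have finS: "finite ?S" using K(2) finite_subset by auto
  have fiber: "card {t \<in> K. conjugate G t R = B} = card (normalizer_in G K B)" if B: "B \<in> ?S" for B
  proof -
    have B': "maximal_p_subgroup p G K B" using B by blast
    obtain g where g: "g \<in> K" "B \<subseteq> conjugate G g R"
      using p_subgroup_subset_conjugate_maximal[OF K p R, of B] B' by (auto simp: maximal_p_subgroup_def)
    have gc: "g \<in> carrier G" using g K' by blast
    have gB: "conjugate G g R = B"
      using B' g maximal_p_subgroup_conjugate[OF K(1) R g(1)] by (auto simp: maximal_p_subgroup_def)
    then have Bg: "conjugate G (inv g) B = R"
      using conjugate_inv_cancel(1)[OF gc R'(3)] by simp
    have Bc: "B \<subseteq> carrier G" using B' K' by (auto simp: maximal_p_subgroup_def)
    have "bij_betw (\<lambda>n. n \<otimes> g) (normalizer_in G K B) {t \<in> K. conjugate G t R = B}"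
    proof (rule bij_betw_byWitness[where f' = "\<lambda>t. t \<otimes> inv g"])
      show "\<forall>n\<in>normalizer_in G K B. n \<otimes> g \<otimes> inv g = n"
        using K' gc by (auto simp: normalizer_in_def m_assoc subset_iff)
      show "\<forall>t\<in>{t \<in> K. conjugate G t R = B}. t \<otimes> inv g \<otimes> g = t"
        using K' gc by (auto simp: m_assoc subset_iff)
      show "(\<lambda>n. n \<otimes> g) ` normalizer_in G K B \<subseteq> {t \<in> K. conjugate G t R = B}"
      proof clarify
        fix n assume n: "n \<in> normalizer_in G K B"
        then have "n \<in> K" "conjugate G n B = B" by (auto simp: normalizer_in_def)
        then show "n \<otimes> g \<in> K \<and> conjugate G (n \<otimes> g) R = B"
          using g(1) gB gc K(1) K' R'(3) conjugate_conjugate[of n g R] by (auto intro: subgroup.m_closed)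
      qed
      show "(\<lambda>t. t \<otimes> inv g) ` {t \<in> K. conjugate G t R = B} \<subseteq> normalizer_in G K B"
      proof clarify
        fix t assume t: "t \<in> K" "B = conjugate G t R"
        then have "conjugate G (t \<otimes> inv g) B = B"
          using Bg gc K' Bc conjugate_conjugate[of t "inv g" B] by auto
        then show "t \<otimes> inv g \<in> normalizer_in G K (conjugate G t R)"
          using t g(1) K(1) by (auto simp: normalizer_in_def intro!: subgroup.m_closed subgroup.m_inv_closed)
      qed
    qed
    then show ?thesis by (rule bij_betw_same_card[symmetric])
  qed
  have "{t \<in> K. H \<subseteq> conjugate G t R} = (\<Union>B\<in>?S. {t \<in> K. conjugate G t R = B})"
    using maximal_p_subgroup_conjugate[OF K(1) R] by auto
  then have "card {t \<in> K. H \<subseteq> conjugate G t R} = (\<Sum>B\<in>?S. card {t \<in> K. conjugate G t R = B})"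
    using finS K(2) by (simp only:) (subst card_UN_disjoint, auto)
  also have "\<dots> = (\<Sum>B\<in>?S. card (normalizer_in G K B))"
    using fiber by (intro sum.cong) auto
  finally show ?thesis by simp
qed

end

section \<open>Casolo's formula for subnormalizers\<close>

text \<open>
  On a finite poset, the unique weight whose sum over every upper set \<open>{B. A \<subseteq> B}\<close> is 1. Its
  value at \<open>A\<close> is minus the reduced Euler characteristic of the elements strictly above \<open>A\<close>.
\<close>

definition is_upward_weight :: "'a set set \<Rightarrow> ('a set \<Rightarrow> int) \<Rightarrow> bool" where
  "is_upward_weight F h \<longleftrightarrow> (\<forall>A\<in>F. (\<Sum>B | B \<in> F \<and> A \<subseteq> B. h B) = 1)"

definition upward_weight :: "'a set set \<Rightarrow> 'a set \<Rightarrow> int" where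
  "upward_weight F = (SOME h. is_upward_weight F h)"

text \<open>A minimal \<open>M\<close> lies in the upper set of no other element, so its value can
  be chosen last, as 1 minus the sum \<open>s\<close> over the elements strictly above it.\<close>

lemma ex_upward_weight: "finite F \<Longrightarrow> \<exists>h. is_upward_weight F h"
proof (induction "card F" arbitrary: F)
  case 0
  then show ?case by (simp add: is_upward_weight_def)
next
  case (Suc n)
  then have "F \<noteq> {}" by auto
  then obtain M where M: "M \<in> F" "\<And>A. A \<in> F \<Longrightarrow> A \<subseteq> M \<Longrightarrow> A = M"
    using finite_has_minimal[OF Suc.prems] by metis
  have "n = card (F - {M})" using Suc.hyps(2) M(1) Suc.prems by simp
  then obtain h where h: "is_upward_weight (F - {M}) h"
    using Suc.hyps(1) Suc.prems by blast
  define s where "s = (\<Sum>B | B \<in> F - {M} \<and> M \<subseteq> B. h B)"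
  have "is_upward_weight F (h(M := 1 - s))"
    unfolding is_upward_weight_def
  proof
    fix A assume A: "A \<in> F"
    show "(\<Sum>B | B \<in> F \<and> A \<subseteq> B. (h(M := 1 - s)) B) = 1"
    proof (cases "A = M")
      case True
      have "{B. B \<in> F \<and> A \<subseteq> B} = insert M {B. B \<in> F - {M} \<and> M \<subseteq> B}"
        using True M(1) by blast
      then have "(\<Sum>B | B \<in> F \<and> A \<subseteq> B. (h(M := 1 - s)) B)
          = (1 - s) + (\<Sum>B | B \<in> F - {M} \<and> M \<subseteq> B. (h(M := 1 - s)) B)"
        using Suc.prems by simp
      also have "(\<Sum>B | B \<in> F - {M} \<and> M \<subseteq> B. (h(M := 1 - s)) B) = s"
        unfolding s_def by (intro sum.cong) auto
      finally show ?thesis by simp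
    next
      case False
      have "{B. B \<in> F \<and> A \<subseteq> B} = {B. B \<in> F - {M} \<and> A \<subseteq> B}"
        using False M(2) A by blast
      then have "(\<Sum>B | B \<in> F \<and> A \<subseteq> B. (h(M := 1 - s)) B) = (\<Sum>B | B \<in> F - {M} \<and> A \<subseteq> B. h B)"
        by (intro sum.cong) auto
      also have "\<dots> = 1"
        using h False A by (auto simp: is_upward_weight_def)
      finally show ?thesis .
    qed
  qed
  then show ?case by blast
qed

lemma upward_weight: "finite F \<Longrightarrow> is_upward_weight F (upward_weight F)"
  unfolding upward_weight_def by (rule someI_ex[of "is_upward_weight F"]) (rule ex_upward_weight)

text \<open>The equation at \<open>A\<close> determines the value at \<open>A\<close> from the
  values strictly above, so the induction runs on the number of elements strictly above
  \<open>A\<close>.\<close>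

lemma upward_weight_unique:
  assumes F: "finite F" and h: "is_upward_weight F h" and h': "is_upward_weight F h'" and A: "A \<in> F"
  shows "h A = h' A"
  using A
proof (induction "card {B \<in> F. A \<subset> B}" arbitrary: A rule: less_induct)
  case less
  have *: "(\<Sum>B | B \<in> F \<and> A \<subseteq> B. k B) = k A + (\<Sum>B\<in>{B \<in> F. A \<subset> B}. k B)" for k :: "'a set \<Rightarrow> int"
  proof -
    have "{B. B \<in> F \<and> A \<subseteq> B} = insert A {B \<in> F. A \<subset> B}" using less.prems by blast
    then show ?thesis using F by simp
  qed
  have "h B = h' B" if B: "B \<in> {B \<in> F. A \<subset> B}" for B
  proof -
    have "{C \<in> F. B \<subset> C} \<subset> {B \<in> F. A \<subset> B}" using B by blast
    then have "card {C \<in> F. B \<subset> C} < card {B \<in> F. A \<subset> B}"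
      using F by (intro psubset_card_mono) auto
    then show ?thesis using less.hyps B by blast
  qed
  then have "(\<Sum>B\<in>{B \<in> F. A \<subset> B}. h B) = (\<Sum>B\<in>{B \<in> F. A \<subset> B}. h' B)"
    by (intro sum.cong) auto
  moreover have "(\<Sum>B | B \<in> F \<and> A \<subseteq> B. h B) = 1" "(\<Sum>B | B \<in> F \<and> A \<subseteq> B. h' B) = 1"
    using h h' less.prems by (auto simp: is_upward_weight_def)
  ultimately show ?case using *[of h] *[of h'] by simp
qed

definition invariant_p_subgroups ::
  "nat \<Rightarrow> ('a, 'b) monoid_scheme \<Rightarrow> 'a set \<Rightarrow> 'a \<Rightarrow> 'a set set" where
  "invariant_p_subgroups p G K y = {B. p_subgroup p G B \<and> B \<subseteq> K \<and> conjugate G y B = B}"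

text \<open>The share of \<open>B\<close> in Casolo's count. It does not mention \<open>H\<close>:
  the same numbers, summed over the \<open>B\<close> above \<open>H\<close>, give the order of the
  subnormalizer of every \<open>p\<close>-subgroup \<open>H\<close>.\<close>

definition subnormalizer_weight ::
  "nat \<Rightarrow> ('a, 'b) monoid_scheme \<Rightarrow> 'a set \<Rightarrow> 'a set \<Rightarrow> int" where
  "subnormalizer_weight p G K B =
     (\<Sum>y\<in>normalizer_in G K B. upward_weight (invariant_p_subgroups p G K y) B)"

text \<open>For a \<open>p\<close>-subgroup \<open>H\<close> of a finite \<open>K\<close>, these are
  the \<open>y\<close> in \<open>K\<close> for which \<open>H\<close> is subnormal in the subgroup
  generated by \<open>H\<close> and \<open>y\<close>.\<close>

definition subnormalizer :: "nat \<Rightarrow> ('a, 'b) monoid_scheme \<Rightarrow> 'a set \<Rightarrow> 'a set \<Rightarrow> 'a set" where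
  "subnormalizer p G K H = {y \<in> K. \<exists>A. p_subgroup p G A \<and> H \<subseteq> A \<and> A \<subseteq> K \<and> conjugate G y A = A}"

lemma finite_invariant_p_subgroups: "finite K \<Longrightarrow> finite (invariant_p_subgroups p G K y)"
  by (rule finite_subset[of _ "Pow K"]) (auto simp: invariant_p_subgroups_def)

context group
begin

text \<open>
  The map \<open>B \<mapsto> B \<inter> N\<close> is right adjoint to the inclusion of the subgroups of \<open>N = N\<^sub>K(H)\<close> into those
  of \<open>K\<close>, so pushing the weight forward along it gives the weight of the smaller poset; only \<open>H\<close>
  is mapped to \<open>H\<close>, since normalizers grow in \<open>p\<close>-groups.
\<close>

lemma upward_weight_normalizer:
  assumes K: "subgroup K G" "finite K" and p: "prime p"
    and H: "p_subgroup p G H" "H \<subseteq> K" and y: "y \<in> normalizer_in G K H"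
  shows "upward_weight (invariant_p_subgroups p G K y) H
    = upward_weight (invariant_p_subgroups p G (normalizer_in G K H) y) H"
proof -
  let ?N = "normalizer_in G K H"
  let ?F = "invariant_p_subgroups p G K y" and ?F' = "invariant_p_subgroups p G ?N y"
  let ?FH = "{B \<in> ?F'. H \<subseteq> B}"
  have K': "K \<subseteq> carrier G" using K(1) by (rule subgroup.subset)
  have Hc: "H \<subseteq> carrier G" "subgroup H G" using H K' by (auto simp: p_subgroup_def)
  have NK: "?N \<subseteq> K" by (auto simp: normalizer_in_def)
  have sN: "subgroup ?N G" using K(1) Hc(1) by (rule subgroup_normalizer_in)
  have yN: "conjugate G y ?N = ?N" using sN y by (rule conjugate_self)
  have yc: "y \<in> carrier G" using y NK K' by blast
  have finN: "finite ?N" using NK K(2) finite_subset by blast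
  have HN: "H \<subseteq> ?N" using subset_normalizer_in[OF Hc(2)] H(2) by blast
  have yH: "conjugate G y H = H" using y by (simp add: normalizer_in_def)
  have finF: "finite ?F" "finite ?F'" using K(2) finN by (auto intro: finite_invariant_p_subgroups)
  have inter: "B \<inter> ?N \<in> ?F'" if "B \<in> ?F" for B
  proof -
    have B: "p_subgroup p G B" "B \<subseteq> K" "conjugate G y B = B"
      using that by (auto simp: invariant_p_subgroups_def)
    have "finite B" using B(2) K(2) finite_subset by blast
    moreover have "subgroup (B \<inter> ?N) G"
      using B(1) sN by (auto simp: p_subgroup_def intro: subgroups_Inter_pair)
    ultimately have "p_subgroup p G (B \<inter> ?N)"
      using p_subgroup_subset[OF B(1) _ _ p] by blast
    moreover have "conjugate G y (B \<inter> ?N) = B \<inter> ?N"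
      using conjugate_Int[OF yc, of B ?N] B NK K' yN by auto
    ultimately show ?thesis by (auto simp: invariant_p_subgroups_def)
  qed
  define h where "h = upward_weight ?F"
  have h: "is_upward_weight ?F h" unfolding h_def using finF(1) by (rule upward_weight)
  \<comment> \<open>The pushforward of \<open>h\<close> along the intersection with
    \<open>?N\<close>. The condition that \<open>B\<close> contains \<open>H\<close> confines its
    support to sets above \<open>H\<close>.\<close>
  define h' where "h' A = (\<Sum>B | B \<in> ?F \<and> H \<subseteq> B \<and> B \<inter> ?N = A. h B)" for A
  have w': "is_upward_weight ?FH h'"
    unfolding is_upward_weight_def
  proof
    fix A assume A: "A \<in> ?FH"
    have AF: "A \<in> ?F" "A \<subseteq> ?N" using A NK by (auto simp: invariant_p_subgroups_def)
    let ?S = "{B. B \<in> ?F \<and> A \<subseteq> B}"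
    have img: "(\<lambda>B. B \<inter> ?N) ` ?S \<subseteq> {B \<in> ?FH. A \<subseteq> B}"
      using inter A AF(2) by auto
    have "(\<Sum>B | B \<in> ?FH \<and> A \<subseteq> B. h' B) = (\<Sum>C\<in>{B \<in> ?FH. A \<subseteq> B}. \<Sum>B | B \<in> ?S \<and> B \<inter> ?N = C. h B)"
    proof (rule sum.cong)
      fix C assume "C \<in> {B \<in> ?FH. A \<subseteq> B}"
      then have "{B. B \<in> ?F \<and> H \<subseteq> B \<and> B \<inter> ?N = C} = {B. B \<in> ?S \<and> B \<inter> ?N = C}"
        by blast
      then show "h' C = (\<Sum>B | B \<in> ?S \<and> B \<inter> ?N = C. h B)" by (simp add: h'_def)
    qed simp
    also have "\<dots> = (\<Sum>B\<in>?S. h B)"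
      using finF img by (intro sum.group) auto
    also have "\<dots> = 1" using h AF(1) by (auto simp: is_upward_weight_def)
    finally show "(\<Sum>B | B \<in> ?FH \<and> A \<subseteq> B. h' B) = 1" .
  qed
  \<comment> \<open>Upper sets of elements of \<open>?FH\<close> are the same in \<open>?FH\<close>
    as in \<open>?F'\<close>, so the weight restricts.\<close>
  have w: "is_upward_weight ?FH (upward_weight ?F')"
    unfolding is_upward_weight_def
  proof
    fix A assume A: "A \<in> ?FH"
    then have "{B. B \<in> ?FH \<and> A \<subseteq> B} = {B. B \<in> ?F' \<and> A \<subseteq> B}" by blast
    then show "(\<Sum>B | B \<in> ?FH \<and> A \<subseteq> B. upward_weight ?F' B) = 1"
      using upward_weight[OF finF(2)] A by (auto simp: is_upward_weight_def)
  qed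
  have "H \<in> ?FH" using H(1) HN yH by (auto simp: invariant_p_subgroups_def)
  then have "h' H = upward_weight ?F' H"
    using upward_weight_unique[OF _ w' w] finF(2) by simp
  moreover have "{B. B \<in> ?F \<and> H \<subseteq> B \<and> B \<inter> ?N = H} = {H}"
  proof -
    have "B = H" if B: "B \<in> ?F" "H \<subseteq> B" "B \<inter> ?N = H" for B
    proof (rule ccontr)
      assume "B \<noteq> H"
      then have HB: "H \<subset> B" using B(2) by blast
      have pB: "p_subgroup p G B" "B \<subseteq> K" using B(1) by (auto simp: invariant_p_subgroups_def)
      have "finite B" using pB(2) K(2) by (rule finite_subset)
      from H(1) pB(1) HB this p have "H \<subset> normalizer_in G B H"
        by (rule p_subgroup_normalizer_grows)
      also have "normalizer_in G B H = B \<inter> ?N"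
        using \<open>B \<subseteq> K\<close> by (auto simp: normalizer_in_def)
      finally show False using B(3) by blast
    qed
    moreover have "H \<in> ?F" using H yH by (auto simp: invariant_p_subgroups_def)
    ultimately show ?thesis using HN by blast
  qed
  ultimately show ?thesis by (simp add: h'_def h_def)
qed

text \<open>Exchange the sums over \<open>B\<close> and \<open>y\<close>. For a fixed
  \<open>y\<close> the invariant \<open>p\<close>-subgroups above \<open>H\<close> are closed under
  intersection; if there are any, they form the upper set of their least member and have total
  weight 1. So the inner sum is the indicator of the subnormalizer.\<close>

lemma card_subnormalizer:
  assumes K: "subgroup K G" "finite K" and p: "prime p" and H: "p_subgroup p G H"
  shows "int (card (subnormalizer p G K H))
    = (\<Sum>B | p_subgroup p G B \<and> B \<subseteq> K \<and> H \<subseteq> B. subnormalizer_weight p G K B)"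
proof -
  let ?S = "{B. p_subgroup p G B \<and> B \<subseteq> K \<and> H \<subseteq> B}"
  let ?F = "invariant_p_subgroups p G K"
  have K': "K \<subseteq> carrier G" using K(1) by (rule subgroup.subset)
  have finS: "finite ?S" by (rule finite_subset[of _ "Pow K"]) (use K(2) in auto)
  have inner: "(\<Sum>B | B \<in> ?F y \<and> H \<subseteq> B. upward_weight (?F y) B) = (if y \<in> subnormalizer p G K H then 1 else 0)"
    if y: "y \<in> K" for y
  proof (cases "y \<in> subnormalizer p G K H")
    case True
    let ?C = "{B \<in> ?F y. H \<subseteq> B}"
    have yc: "y \<in> carrier G" using y K' by blast
    have finC: "finite ?C" by (rule finite_subset[OF _ finite_invariant_p_subgroups[OF K(2)]]) auto
    obtain A where A: "A \<in> ?C" using True by (auto simp: subnormalizer_def invariant_p_subgroups_def)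
    have int2: "B \<inter> B' \<in> ?C" if "B \<in> ?C" "B' \<in> ?C" for B B'
    proof -
      have B: "p_subgroup p G B" "B \<subseteq> K" "conjugate G y B = B" "H \<subseteq> B"
        "p_subgroup p G B'" "B' \<subseteq> K" "conjugate G y B' = B'" "H \<subseteq> B'"
        using that by (auto simp: invariant_p_subgroups_def)
      have "finite B" using B(2) K(2) finite_subset by blast
      moreover have "subgroup (B \<inter> B') G"
        using B by (auto simp: p_subgroup_def intro: subgroups_Inter_pair)
      ultimately have "p_subgroup p G (B \<inter> B')"
        using p_subgroup_subset[OF B(1) _ _ p] by blast
      moreover have "conjugate G y (B \<inter> B') = B \<inter> B'"
        using conjugate_Int[OF yc, of B B'] B(2,3,6,7) K' by (simp add: subset_trans[OF _ K'])
      ultimately show ?thesis using B by (auto simp: invariant_p_subgroups_def)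
    qed
    from A have "?C \<noteq> {}" by blast
    from finite_has_minimal[OF finC this]
    obtain M where M: "M \<in> ?C" "\<forall>B\<in>?C. B \<subseteq> M \<longrightarrow> M = B"
      by (rule bexE)
    have "M \<subseteq> B" if "B \<in> ?C" for B
      using M(2) int2[OF M(1) that] by auto
    then have "{B. B \<in> ?F y \<and> H \<subseteq> B} = {B. B \<in> ?F y \<and> M \<subseteq> B}"
      using M(1) by blast
    then show ?thesis
      using upward_weight[OF finite_invariant_p_subgroups[OF K(2)], of p G y] M(1) True
      by (simp add: is_upward_weight_def)
  next
    case False
    then have "{B. B \<in> ?F y \<and> H \<subseteq> B} = {}"
      using y by (auto simp: subnormalizer_def invariant_p_subgroups_def)
    then show ?thesis using False by (simp only: sum.empty if_False)
  qed
  have "(\<Sum>B\<in>?S. subnormalizer_weight p G K B)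
      = (\<Sum>B\<in>?S. \<Sum>y\<in>K. if conjugate G y B = B then upward_weight (?F y) B else 0)"
    unfolding subnormalizer_weight_def normalizer_in_def by (simp only: sum.inter_filter[OF K(2)])
  also have "\<dots> = (\<Sum>y\<in>K. \<Sum>B\<in>?S. if conjugate G y B = B then upward_weight (?F y) B else 0)"
    by (rule sum.swap)
  also have "\<dots> = (\<Sum>y\<in>K. \<Sum>B | B \<in> ?F y \<and> H \<subseteq> B. upward_weight (?F y) B)"
  proof (rule sum.cong)
    fix y assume "y \<in> K"
    have "{B. B \<in> ?F y \<and> H \<subseteq> B} = {B \<in> ?S. conjugate G y B = B}"
      by (auto simp: invariant_p_subgroups_def)
    then show "(\<Sum>B\<in>?S. if conjugate G y B = B then upward_weight (?F y) B else 0)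
        = (\<Sum>B | B \<in> ?F y \<and> H \<subseteq> B. upward_weight (?F y) B)"
      by (simp only: sum.inter_filter[OF finS])
  qed simp
  also have "\<dots> = (\<Sum>y\<in>K. if y \<in> subnormalizer p G K H then 1 else 0)"
    using inner by (intro sum.cong) auto
  also have "\<dots> = int (card (subnormalizer p G K H))"
  proof -
    have "{y \<in> K. y \<in> subnormalizer p G K H} = subnormalizer p G K H"
      by (auto simp: subnormalizer_def)
    then show ?thesis using K(2) by (simp add: sum.inter_filter[symmetric])
  qed
  finally show ?thesis by simp
qed

text \<open>Only \<open>B\<close> itself lies above a maximal \<open>B\<close>, so every weight in
  the sum is 1.\<close>

lemma subnormalizer_weight_maximal:
  assumes K: "subgroup K G" "finite K" and B: "maximal_p_subgroup p G K B"
  shows "subnormalizer_weight p G K B = int (card (normalizer_in G K B))"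
proof -
  have "upward_weight (invariant_p_subgroups p G K y) B = 1" if y: "y \<in> normalizer_in G K B" for y
  proof -
    let ?F = "invariant_p_subgroups p G K y"
    have "B \<in> ?F" using B y by (auto simp: invariant_p_subgroups_def maximal_p_subgroup_def normalizer_in_def)
    moreover have "{C. C \<in> ?F \<and> B \<subseteq> C} = {B}"
      using B y by (auto simp: invariant_p_subgroups_def maximal_p_subgroup_def normalizer_in_def)
    ultimately show ?thesis
      using upward_weight[OF finite_invariant_p_subgroups[OF K(2)], of p G y]
      by (auto simp: is_upward_weight_def)
  qed
  then show ?thesis by (simp add: subnormalizer_weight_def)
qed

text \<open>The index set \<open>S\<close> is left open because it is taken to be all
  \<open>p\<close>-subgroups above \<open>H\<close> in Casolo's formula, but has \<open>H\<close>
  itself removed in the proof that non-maximal weights vanish.\<close>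

lemma sum_subnormalizer_weight:
  assumes K: "subgroup K G" "finite K" and p: "prime p" and R: "maximal_p_subgroup p G K R"
    and S: "\<And>B. maximal_p_subgroup p G K B \<Longrightarrow> H \<subseteq> B \<Longrightarrow> B \<in> S"
      "\<And>B. B \<in> S \<Longrightarrow> p_subgroup p G B \<and> B \<subseteq> K \<and> H \<subseteq> B"
    and zero: "\<And>B. B \<in> S \<Longrightarrow> \<not> maximal_p_subgroup p G K B \<Longrightarrow> subnormalizer_weight p G K B = 0"
  shows "(\<Sum>B\<in>S. subnormalizer_weight p G K B) = int (card {t \<in> K. H \<subseteq> conjugate G t R})"
proof -
  let ?M = "{B. maximal_p_subgroup p G K B \<and> H \<subseteq> B}"
  have "finite S" by (rule finite_subset[of _ "Pow K"]) (use K(2) S(2) in auto)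
  then have "(\<Sum>B\<in>S. subnormalizer_weight p G K B) = (\<Sum>B\<in>?M. subnormalizer_weight p G K B)"
  proof (rule sum.mono_neutral_right)
    show "\<forall>B\<in>S - ?M. subnormalizer_weight p G K B = 0" using S(2) zero by blast
  qed (use S(1) in auto)
  also have "\<dots> = (\<Sum>B\<in>?M. int (card (normalizer_in G K B)))"
    using subnormalizer_weight_maximal[OF K] by (intro sum.cong) auto
  also have "\<dots> = int (card {t \<in> K. H \<subseteq> conjugate G t R})"
    using sum_card_normalizer_maximal[OF K p R, of H] by (simp only: of_nat_sum[symmetric])
  finally show ?thesis .
qed

text \<open>
  Passing to the normalizer \<open>N\<close> of \<open>H\<close> preserves the weight of \<open>H\<close>. Every element of \<open>N\<close> normalizes
  \<open>H\<close> and every Sylow subgroup contains \<open>H\<close>, so the total weight above \<open>H\<close> and its part from the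
  maximal \<open>p\<close>-subgroups are both \<open>|N|\<close>, which leaves nothing for \<open>H\<close>.
\<close>

lemma subnormalizer_weight_non_maximal:
  assumes fin: "finite (carrier G)" and p: "prime p"
    and K: "subgroup K G" and H: "p_subgroup p G H" "H \<subseteq> K" "\<not> maximal_p_subgroup p G K H"
  shows "subnormalizer_weight p G K H = 0"
  using K H
\<comment> \<open>The measure refers to \<open>G\<close> and not to \<open>K\<close>: the induction
  hypothesis is applied to a larger \<open>H\<close> and at the same time to \<open>?N\<close> in
  place of \<open>K\<close>.\<close>
proof (induction "card (carrier G) - card H" arbitrary: K H rule: less_induct)
  case less
  let ?N = "normalizer_in G K H"
  note K = less.prems(1) and H = less.prems(2-4)
  have Kc: "K \<subseteq> carrier G" using K by (rule subgroup.subset)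
  then have finK: "finite K" using fin by (rule finite_subset)
  have Hc: "subgroup H G" "H \<subseteq> carrier G" using H Kc by (auto simp: p_subgroup_def)
  have sN: "subgroup ?N G" using K Hc(2) by (rule subgroup_normalizer_in)
  have NK: "?N \<subseteq> K" by (auto simp: normalizer_in_def)
  then have finN: "finite ?N" using finK by (rule finite_subset)
  have HN: "H \<subseteq> ?N" using subset_normalizer_in[OF Hc(1)] H(2) by blast
  have NN: "normalizer_in G ?N H = ?N" by (auto simp: normalizer_in_def)
  have "subnormalizer_weight p G K H = subnormalizer_weight p G ?N H"
    unfolding subnormalizer_weight_def NN
    using upward_weight_normalizer[OF K finK p H(1,2)] by (intro sum.cong) auto
  moreover have "subnormalizer_weight p G ?N H = 0"
  proof -
    let ?S = "{B. p_subgroup p G B \<and> B \<subseteq> ?N \<and> H \<subseteq> B}"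
    \<comment> \<open>Non-maximality survives the passage to \<open>?N\<close>: a larger
      \<open>p\<close>-subgroup \<open>A\<close> meets \<open>?N\<close> in the normalizer of
      \<open>H\<close> in \<open>A\<close>, which exceeds \<open>H\<close>.\<close>
    obtain A where A: "p_subgroup p G A" "A \<subseteq> K" "H \<subset> A"
      using H by (auto simp: maximal_p_subgroup_def)
    have "finite A" using A(2) finK by (rule finite_subset)
    with H(1) A(1,3) have "H \<subset> normalizer_in G A H"
      using p by (rule p_subgroup_normalizer_grows)
    moreover have "p_subgroup p G (normalizer_in G A H)"
    proof (rule p_subgroup_subset[OF A(1) _ _ p \<open>finite A\<close>])
      show "subgroup (normalizer_in G A H) G"
        using A(1) Hc by (auto simp: p_subgroup_def intro: subgroup_normalizer_in)
    qed (auto simp: normalizer_in_def)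
    moreover have "normalizer_in G A H \<subseteq> ?N" using A(2) by (auto simp: normalizer_in_def)
    ultimately have notmax: "\<not> maximal_p_subgroup p G ?N H"
      by (auto simp: maximal_p_subgroup_def)
    obtain R where R: "maximal_p_subgroup p G ?N R"
      using ex_maximal_p_subgroup[OF sN finN p] by blast
    have finS: "finite ?S" by (rule finite_subset[of _ "Pow ?N"]) (use finN in auto)
    have "int (card (subnormalizer p G ?N H)) = (\<Sum>B\<in>?S. subnormalizer_weight p G ?N B)"
      using sN finN p H(1) by (rule card_subnormalizer)
    also have "\<dots> = subnormalizer_weight p G ?N H + (\<Sum>B\<in>?S - {H}. subnormalizer_weight p G ?N B)"
      using finS H(1) HN by (intro sum.remove) auto
    also have "(\<Sum>B\<in>?S - {H}. subnormalizer_weight p G ?N B) = int (card {t \<in> ?N. H \<subseteq> conjugate G t R})"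
    proof (rule sum_subnormalizer_weight[OF sN finN p R])
      show "B \<in> ?S - {H}" if "maximal_p_subgroup p G ?N B" "H \<subseteq> B" for B
        using that notmax by (auto simp: maximal_p_subgroup_def)
      show "subnormalizer_weight p G ?N B = 0"
        if B: "B \<in> ?S - {H}" "\<not> maximal_p_subgroup p G ?N B" for B
      proof -
        have BN: "B \<subseteq> ?N" and "H \<subset> B" using B(1) by auto
        have "B \<subseteq> carrier G" using BN NK Kc by blast
        then have "card B \<le> card (carrier G)" using fin by (intro card_mono)
        moreover have "card H < card B"
          using \<open>H \<subset> B\<close> finite_subset[OF BN finN] by (intro psubset_card_mono)
        ultimately have "card (carrier G) - card B < card (carrier G) - card H" by simp
        then show ?thesis using less.hyps[of B ?N] sN B by blast
      qed
    qed blast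
    also have "{t \<in> ?N. H \<subseteq> conjugate G t R} = ?N"
    proof -
      obtain g where g: "g \<in> ?N" "H \<subseteq> conjugate G g R"
        using p_subgroup_subset_conjugate_maximal[OF sN finN p R H(1) HN] by blast
      have Rc: "R \<subseteq> carrier G" using R NK Kc by (auto simp: maximal_p_subgroup_def)
      have Nc: "?N \<subseteq> carrier G" using NK Kc by blast
      have "H \<subseteq> conjugate G t R" if t: "t \<in> ?N" for t
      proof -
        have c: "t \<in> carrier G" "g \<in> carrier G" using t g Nc by auto
        have "t \<otimes> inv g \<in> ?N"
          using t g(1) sN by (auto intro!: subgroup.m_closed[OF sN] subgroup.m_inv_closed[OF sN])
        then have "H = conjugate G (t \<otimes> inv g) H" by (simp add: normalizer_in_def)
        also have "\<dots> \<subseteq> conjugate G (t \<otimes> inv g) (conjugate G g R)"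
          using g(2) by (rule conjugate_mono)
        also have "\<dots> = conjugate G t R"
          using c Rc by (simp add: conjugate_conjugate m_assoc)
        finally show ?thesis .
      qed
      then show ?thesis by blast
    qed
    also have "subnormalizer p G ?N H = ?N"
      using H(1) HN by (auto simp: subnormalizer_def normalizer_in_def)
    finally show ?thesis by simp
  qed
  ultimately show ?case by simp
qed

text \<open>Casolo's formula for the order of the subnormalizer of a \<open>p\<close>-subgroup.\<close>

theorem card_subnormalizer_eq:
  assumes fin: "finite (carrier G)" and p: "prime p"
    and R: "maximal_p_subgroup p G (carrier G) R" and H: "p_subgroup p G H"
  shows "card (subnormalizer p G (carrier G) H) = card {t \<in> carrier G. H \<subseteq> conjugate G t R}"
proof -
  let ?S = "{B. p_subgroup p G B \<and> B \<subseteq> carrier G \<and> H \<subseteq> B}"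
  have "int (card (subnormalizer p G (carrier G) H)) = (\<Sum>B\<in>?S. subnormalizer_weight p G (carrier G) B)"
    using subgroup_self fin p H by (rule card_subnormalizer)
  also have "\<dots> = int (card {t \<in> carrier G. H \<subseteq> conjugate G t R})"
  proof (rule sum_subnormalizer_weight[OF subgroup_self fin p R])
    show "subnormalizer_weight p G (carrier G) B = 0"
      if "B \<in> ?S" "\<not> maximal_p_subgroup p G (carrier G) B" for B
      using subnormalizer_weight_non_maximal[OF fin p subgroup_self] that by blast
  qed (auto simp: maximal_p_subgroup_def)
  finally show ?thesis by simp
qed

end

section \<open>Finite nilpotent groups\<close>

context group
begin

text \<open>On \<open>S\<close> the map \<open>\<phi>\<close> factors through \<open>\<psi>\<close>,
  and this is the order formula for the induced map between the images. Leaving that map implicit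
  lets the lemma compare any two quotients of one group.\<close>

lemma card_hom_image_mult:
  assumes S: "subgroup S G" and \<phi>: "group_hom G A \<phi>" and \<psi>: "group_hom G B \<psi>"
    and ker: "\<And>g. g \<in> S \<Longrightarrow> \<psi> g = \<one>\<^bsub>B\<^esub> \<Longrightarrow> \<phi> g = \<one>\<^bsub>A\<^esub>" and fin: "finite (\<psi> ` S)"
  shows "card (\<phi> ` S) * card (\<psi> ` {g \<in> S. \<phi> g = \<one>\<^bsub>A\<^esub>}) = card (\<psi> ` S)"
proof -
  interpret \<phi>: group_hom G A \<phi> by (rule \<phi>)
  interpret \<psi>: group_hom G B \<psi> by (rule \<psi>)
  have Sc: "S \<subseteq> carrier G" using S by (rule subgroup.subset)
  define N where "N = {g \<in> S. \<phi> g = \<one>\<^bsub>A\<^esub>}"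
  have same: "\<phi> g = \<phi> h" if "g \<in> S" "h \<in> S" "\<psi> g = \<psi> h" for g h
  proof -
    have c: "g \<in> carrier G" "h \<in> carrier G" using that Sc by auto
    have "inv h \<otimes> g \<in> S" using that S by (auto intro: subgroup.m_closed subgroup.m_inv_closed)
    moreover have "\<psi> (inv h \<otimes> g) = \<one>\<^bsub>B\<^esub>" using c that(3) by simp
    ultimately have "\<phi> (inv h \<otimes> g) = \<one>\<^bsub>A\<^esub>" using ker by blast
    then have "\<phi> h \<otimes>\<^bsub>A\<^esub> \<phi> (inv h \<otimes> g) = \<phi> h" using c by simp
    moreover have "\<phi> (h \<otimes> (inv h \<otimes> g)) = \<phi> h \<otimes>\<^bsub>A\<^esub> \<phi> (inv h \<otimes> g)"
      using c by (intro \<phi>.hom_mult) auto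
    ultimately show ?thesis using c by (simp add: inv_mult_cancel)
  qed
  have fiber: "card {b \<in> \<psi> ` S. \<exists>g\<in>S. \<psi> g = b \<and> \<phi> g = a} = card (\<psi> ` N)" if a: "a \<in> \<phi> ` S" for a
  proof -
    obtain h where h: "h \<in> S" "a = \<phi> h" using a by blast
    have hc: "h \<in> carrier G" using h Sc by blast
    have "{b \<in> \<psi> ` S. \<exists>g\<in>S. \<psi> g = b \<and> \<phi> g = a} = (\<lambda>b. \<psi> h \<otimes>\<^bsub>B\<^esub> b) ` \<psi> ` N"
    proof (intro Set.set_eqI iffI)
      fix b assume "b \<in> {b \<in> \<psi> ` S. \<exists>g\<in>S. \<psi> g = b \<and> \<phi> g = a}"
      then obtain g where g: "g \<in> S" "\<psi> g = b" "\<phi> g = \<phi> h" using h by blast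
      have gc: "g \<in> carrier G" using g Sc by blast
      have "inv h \<otimes> g \<in> S" using g h S by (auto intro: subgroup.m_closed subgroup.m_inv_closed)
      moreover have "\<phi> (inv h \<otimes> g) = \<one>\<^bsub>A\<^esub>" using gc hc g by simp
      ultimately have "inv h \<otimes> g \<in> N" by (simp add: N_def)
      moreover have "b = \<psi> h \<otimes>\<^bsub>B\<^esub> \<psi> (inv h \<otimes> g)"
        using gc hc g by (simp add: \<psi>.hom_mult[symmetric] inv_mult_cancel del: \<psi>.hom_mult)
      ultimately show "b \<in> (\<lambda>b. \<psi> h \<otimes>\<^bsub>B\<^esub> b) ` \<psi> ` N" by blast
    next
      fix b assume "b \<in> (\<lambda>b. \<psi> h \<otimes>\<^bsub>B\<^esub> b) ` \<psi> ` N"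
      then obtain n where n: "n \<in> S" "\<phi> n = \<one>\<^bsub>A\<^esub>" "b = \<psi> h \<otimes>\<^bsub>B\<^esub> \<psi> n" by (auto simp: N_def)
      have nc: "n \<in> carrier G" using n Sc by blast
      have "h \<otimes> n \<in> S" using h n S by (auto intro: subgroup.m_closed)
      moreover have "\<psi> (h \<otimes> n) = b" "\<phi> (h \<otimes> n) = a" using n h nc hc by simp_all
      ultimately show "b \<in> {b \<in> \<psi> ` S. \<exists>g\<in>S. \<psi> g = b \<and> \<phi> g = a}" by blast
    qed
    moreover have "inj_on (\<lambda>b. \<psi> h \<otimes>\<^bsub>B\<^esub> b) (\<psi> ` N)"
      using hc Sc by (auto simp: inj_on_def N_def subset_iff)
    ultimately show ?thesis by (simp add: card_image)
  qed
  have finA: "finite (\<phi> ` S)"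
  proof -
    obtain h where "\<phi> ` S = h ` \<psi> ` S" using image_factorization[of S \<psi> \<phi>] same by blast
    then show ?thesis using fin by simp
  qed
  have "\<psi> ` S = (\<Union>a\<in>\<phi> ` S. {b \<in> \<psi> ` S. \<exists>g\<in>S. \<psi> g = b \<and> \<phi> g = a})" by auto
  then have "card (\<psi> ` S) = card (\<Union>a\<in>\<phi> ` S. {b \<in> \<psi> ` S. \<exists>g\<in>S. \<psi> g = b \<and> \<phi> g = a})" by simp
  also have "\<dots> = (\<Sum>a\<in>\<phi> ` S. card {b \<in> \<psi> ` S. \<exists>g\<in>S. \<psi> g = b \<and> \<phi> g = a})"
  proof (rule card_UN_disjoint[OF finA])
    show "\<forall>a\<in>\<phi> ` S. finite {b \<in> \<psi> ` S. \<exists>g\<in>S. \<psi> g = b \<and> \<phi> g = a}" using fin by simp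
    show "\<forall>a\<in>\<phi> ` S. \<forall>a'\<in>\<phi> ` S. a \<noteq> a' \<longrightarrow>
      {b \<in> \<psi> ` S. \<exists>g\<in>S. \<psi> g = b \<and> \<phi> g = a} \<inter> {b \<in> \<psi> ` S. \<exists>g\<in>S. \<psi> g = b \<and> \<phi> g = a'} = {}"
    proof (intro ballI impI equals0I)
      fix a a' b assume "a \<noteq> a'"
        and b: "b \<in> {b \<in> \<psi> ` S. \<exists>g\<in>S. \<psi> g = b \<and> \<phi> g = a} \<inter> {b \<in> \<psi> ` S. \<exists>g\<in>S. \<psi> g = b \<and> \<phi> g = a'}"
      from b obtain g where g: "g \<in> S" "\<psi> g = b" "\<phi> g = a" by auto
      from b obtain g' where g': "g' \<in> S" "\<psi> g' = b" "\<phi> g' = a'" by auto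
      show False using same[OF g(1) g'(1)] g g' \<open>a \<noteq> a'\<close> by simp
    qed
  qed
  also have "\<dots> = card (\<phi> ` S) * card (\<psi> ` N)" using fiber by simp
  finally show ?thesis by (simp add: N_def)
qed

lemma p_subgroup_image:
  assumes A: "p_subgroup p G A" and \<phi>: "group_hom G F \<phi>" and p: "prime p" and fin: "finite A"
  shows "p_subgroup p F (\<phi> ` A)"
proof -
  interpret \<phi>: group_hom G F \<phi> by (rule \<phi>)
  have sA: "subgroup A G" using A by (simp add: p_subgroup_def)
  have "group_hom G G (\<lambda>x. x)" by unfold_locales (auto simp: hom_def)
  then have "card (\<phi> ` A) * card ((\<lambda>x. x) ` {g \<in> A. \<phi> g = \<one>\<^bsub>F\<^esub>}) = card ((\<lambda>x. x) ` A)"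
    by (rule card_hom_image_mult[OF sA \<phi>]) (use fin in auto)
  then have "card (\<phi> ` A) * card {g \<in> A. \<phi> g = \<one>\<^bsub>F\<^esub>} = card A" by simp
  then have "card (\<phi> ` A) dvd card A" by (metis dvd_triv_left)
  moreover obtain k where "card A = p ^ k" using A by (auto simp: p_subgroup_def)
  ultimately show ?thesis
    using \<phi>.subgroup_img_is_subgroup[OF sA] divides_primepow_nat[OF p] by (auto simp: p_subgroup_def)
qed

lemma p_subgroup_generate:
  assumes "finite (carrier G)" "prime p" "x \<in> carrier G" "x [^] (p ^ k) = \<one>"
  shows "p_subgroup p G (generate G {x})"
proof -
  have "ord x dvd p ^ k" using assms pow_eq_id by blast
  then have "\<exists>j. card (generate G {x}) = p ^ j"
    using generate_pow_card[OF assms(3)] divides_primepow_nat[OF assms(2)] by auto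
  then show ?thesis using generate_is_subgroup assms(3) by (auto simp: p_subgroup_def)
qed

text \<open>As \<open>c\<close> is the commutator of \<open>x\<close> and \<open>y\<close> and
  commutes with both, the commutators of \<open>x [^] k\<close> with \<open>y\<close> and of
  \<open>x\<close> with \<open>y [^] k\<close> are both \<open>c [^] k\<close>. Hence the order of
  \<open>c\<close> divides both \<open>m\<close> and \<open>n\<close>.\<close>

lemma commute_if_central_commutator:
  fixes m n :: nat
  assumes c: "x \<in> carrier G" "y \<in> carrier G" "c \<in> carrier G"
    and eq: "x \<otimes> y = c \<otimes> y \<otimes> x" and cx: "c \<otimes> x = x \<otimes> c" and cy: "c \<otimes> y = y \<otimes> c"
    and m: "x [^] m = \<one>" and n: "y [^] n = \<one>" and cop: "coprime m n"
  shows "c = \<one>"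
proof -
  have "x [^] k \<otimes> y = c [^] k \<otimes> y \<otimes> x [^] k" for k :: nat
  proof (induction k)
    case (Suc k)
    have "x [^] Suc k \<otimes> y = x [^] k \<otimes> (c \<otimes> y \<otimes> x)" using c eq by (simp add: m_assoc)
    also have "\<dots> = (x [^] k \<otimes> c) \<otimes> y \<otimes> x" using c by (simp add: m_assoc)
    also have "x [^] k \<otimes> c = c \<otimes> x [^] k" using group_commutes_pow[of x c k] cx c by simp
    also have "c \<otimes> x [^] k \<otimes> y \<otimes> x = c \<otimes> (x [^] k \<otimes> y) \<otimes> x" using c by (simp add: m_assoc)
    also have "\<dots> = (c \<otimes> c [^] k) \<otimes> y \<otimes> (x [^] k \<otimes> x)" using c Suc by (simp add: m_assoc)
    also have "c \<otimes> c [^] k = c [^] Suc k" using c nat_pow_Suc2 by simp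
    finally show ?case by simp
  qed (use c in simp)
  from this[of m] have "c [^] m \<otimes> y = y" using m c by simp
  then have "c [^] m \<otimes> (y \<otimes> inv y) = \<one>" using c by (simp add: m_assoc[symmetric] del: r_inv)
  then have "c [^] m = \<one>" using c by simp
  moreover have "x \<otimes> y [^] k = c [^] k \<otimes> y [^] k \<otimes> x" for k :: nat
  proof (induction k)
    case (Suc k)
    have "x \<otimes> y [^] Suc k = (x \<otimes> y [^] k) \<otimes> y" using c by (simp add: m_assoc)
    also have "\<dots> = c [^] k \<otimes> y [^] k \<otimes> (x \<otimes> y)" using c Suc by (simp add: m_assoc)
    also have "\<dots> = c [^] k \<otimes> (y [^] k \<otimes> c) \<otimes> y \<otimes> x" using c eq by (simp add: m_assoc)
    also have "y [^] k \<otimes> c = c \<otimes> y [^] k" using group_commutes_pow[of y c k] cy c by simp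
    also have "c [^] k \<otimes> (c \<otimes> y [^] k) \<otimes> y \<otimes> x = c [^] Suc k \<otimes> y [^] Suc k \<otimes> x"
      using c by (simp add: m_assoc)
    finally show ?case .
  qed (use c in simp)
  from this[of n] have "c [^] n \<otimes> x = x" using n c by simp
  then have "c [^] n \<otimes> (x \<otimes> inv x) = \<one>" using c by (simp add: m_assoc[symmetric] del: r_inv)
  then have "c [^] n = \<one>" using c by simp
  ultimately have "ord c dvd m" "ord c dvd n" using pow_eq_id[OF c(3)] by simp_all
  then have "ord c = 1" using cop coprime_common_divisor_nat by blast
  then show ?thesis using ord_eq_1[OF c(3)] by simp
qed

section \<open>The lower central series and elements of coprime order\<close>

lemma
  shows subgroup_lower_central_series: "subgroup (lower_central_series G n) G"
    and commutator_in_lower_central_series: "\<And>x y. x \<in> lower_central_series G n \<Longrightarrow> y \<in> carrier G \<Longrightarrow>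
      x \<otimes> y \<otimes> inv x \<otimes> inv y \<in> lower_central_series G (Suc n)"
    and lower_central_series_decreasing: "lower_central_series G (Suc n) \<subseteq> lower_central_series G n"
proof -
  let ?D = "\<lambda>S. \<Union>x\<in>S. \<Union>y\<in>carrier G. {x \<otimes> y \<otimes> inv x \<otimes> inv y}"
  have sub: "subgroup (lower_central_series G n) G" for n
  proof (induction n)
    case 0 then show ?case by (simp add: subgroup_self)
  next
    case (Suc n)
    have "?D (lower_central_series G n) \<subseteq> carrier G" using subgroup.subset[OF Suc] by auto
    then show ?case by (simp add: generate_is_subgroup)
  qed
  then show "subgroup (lower_central_series G n) G" .
  show "x \<otimes> y \<otimes> inv x \<otimes> inv y \<in> lower_central_series G (Suc n)"
    if "x \<in> lower_central_series G n" "y \<in> carrier G" for x y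
    using that by (auto intro!: generate.incl)
  show "lower_central_series G (Suc n) \<subseteq> lower_central_series G n"
  proof (induction n)
    case 0 then show ?case using subgroup.subset[OF sub[of "Suc 0"]] by simp
  next
    case (Suc n)
    then have "?D (lower_central_series G (Suc n)) \<subseteq> ?D (lower_central_series G n)" by blast
    from mono_generate[OF this] show ?case by simp
  qed
qed

text \<open>The conjugate of \<open>x\<close> by \<open>y\<close> is \<open>x\<close> times the
  commutator of \<open>inv x\<close> with \<open>y\<close>.\<close>

lemma lower_central_series_normal: "lower_central_series G n \<lhd> G"
proof (rule normal_invI[OF subgroup_lower_central_series])
  fix y x assume y: "y \<in> carrier G" and x: "x \<in> lower_central_series G n"
  have xc: "x \<in> carrier G" using x subgroup.subset[OF subgroup_lower_central_series] by blast
  have "inv x \<in> lower_central_series G n"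
    using x subgroup.m_inv_closed[OF subgroup_lower_central_series] by blast
  from commutator_in_lower_central_series[OF this y]
  have "inv x \<otimes> y \<otimes> x \<otimes> inv y \<in> lower_central_series G n"
    using lower_central_series_decreasing xc by auto
  with x have "x \<otimes> (inv x \<otimes> y \<otimes> x \<otimes> inv y) \<in> lower_central_series G n"
    using subgroup.m_closed[OF subgroup_lower_central_series] by blast
  then show "y \<otimes> x \<otimes> inv y \<in> lower_central_series G n"
    using xc y by (simp add: m_assoc inv_mult_cancel)
qed

end

lemma (in normal) group_hom_Mod: "group_hom G (G Mod H) (\<lambda>g. H #> g)"
  using r_coset_hom_Mod factorgroup_is_group
  by (intro group_hom.intro group_hom_axioms.intro) (auto intro: is_group)

text \<open>Modulo \<open>H\<close> the commutator \<open>c\<close> is central, so coprimality of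
  the exponents makes it trivial there. With the next term of the lower central series as
  \<open>H\<close>, this pushes \<open>c\<close> down by one step.\<close>

lemma (in normal) commutator_mem_if_central_mod:
  fixes m n :: nat
  assumes x: "x \<in> carrier G" and y: "y \<in> carrier G" and c: "c \<in> carrier G"
    and xy: "x \<otimes> y = c \<otimes> y \<otimes> x"
    and central: "\<And>z. z \<in> carrier G \<Longrightarrow> c \<otimes> z \<otimes> inv c \<otimes> inv z \<in> H"
    and m: "x [^] m = \<one>" and n: "y [^] n = \<one>" and cop: "coprime m n"
  shows "c \<in> H"
proof -
  let ?\<pi> = "\<lambda>g. H #> g"
  interpret \<pi>: group_hom G "G Mod H" ?\<pi> by (rule group_hom_Mod)
  note mult = \<pi>.hom_mult[simplified] and closed = \<pi>.hom_closed
  have comm: "?\<pi> c \<otimes>\<^bsub>G Mod H\<^esub> ?\<pi> z = ?\<pi> z \<otimes>\<^bsub>G Mod H\<^esub> ?\<pi> c" if z: "z \<in> carrier G" for z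
  proof -
    let ?k = "c \<otimes> z \<otimes> inv c \<otimes> inv z"
    have "?\<pi> ?k = \<one>\<^bsub>G Mod H\<^esub>"
      using rcos_const[OF is_group central[OF z]] by simp
    moreover have "?\<pi> (?k \<otimes> (z \<otimes> c)) = ?\<pi> ?k \<otimes>\<^bsub>G Mod H\<^esub> ?\<pi> (z \<otimes> c)"
      using c z by (intro \<pi>.hom_mult) auto
    moreover have "?k \<otimes> (z \<otimes> c) = c \<otimes> z"
      using c z by (simp add: m_assoc inv_mult_cancel)
    moreover have "\<one>\<^bsub>G Mod H\<^esub> \<otimes>\<^bsub>G Mod H\<^esub> ?\<pi> (z \<otimes> c) = ?\<pi> (z \<otimes> c)"
      using c z by (intro \<pi>.H.l_one closed) auto
    ultimately have "?\<pi> (c \<otimes> z) = ?\<pi> (z \<otimes> c)" by metis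
    then show ?thesis using \<pi>.hom_mult[OF c z] \<pi>.hom_mult[OF z c] by metis
  qed
  have "?\<pi> c = \<one>\<^bsub>G Mod H\<^esub>"
  proof (rule \<pi>.H.commute_if_central_commutator[of "?\<pi> x" "?\<pi> y" _ m n])
    have "?\<pi> (c \<otimes> y \<otimes> x) = ?\<pi> c \<otimes>\<^bsub>G Mod H\<^esub> ?\<pi> y \<otimes>\<^bsub>G Mod H\<^esub> ?\<pi> x"
      using \<pi>.hom_mult[OF c y] \<pi>.hom_mult[OF m_closed[OF c y] x] by metis
    then show "?\<pi> x \<otimes>\<^bsub>G Mod H\<^esub> ?\<pi> y = ?\<pi> c \<otimes>\<^bsub>G Mod H\<^esub> ?\<pi> y \<otimes>\<^bsub>G Mod H\<^esub> ?\<pi> x"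
      using \<pi>.hom_mult[OF x y] xy by metis
    show "?\<pi> x [^]\<^bsub>G Mod H\<^esub> m = \<one>\<^bsub>G Mod H\<^esub>" "?\<pi> y [^]\<^bsub>G Mod H\<^esub> n = \<one>\<^bsub>G Mod H\<^esub>"
      using FactGroup_pow[OF x, of m] FactGroup_pow[OF y, of n] m n \<pi>.hom_one by simp_all
  qed (use x y c cop comm closed in blast)+
  then show ?thesis
    using rcos_self[OF c subgroup_axioms] by simp
qed

text \<open>The commutator of \<open>x\<close> and \<open>y\<close> descends through the whole lower
  central series, which ends in the trivial group.\<close>

lemma nilpotent_coprime_commute:
  fixes G (structure) and m n :: nat
  assumes nil: "nilpotent_group G" and x: "x \<in> carrier G" and y: "y \<in> carrier G"
    and m: "x [^] m = \<one>" and n: "y [^] n = \<one>" and cop: "coprime m n"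
  shows "x \<otimes> y = y \<otimes> x"
proof -
  interpret group G using nil by (simp add: nilpotent_group_def)
  define c where "c = x \<otimes> y \<otimes> inv x \<otimes> inv y"
  have c: "c \<in> carrier G" using x y by (simp add: c_def)
  have xy: "x \<otimes> y = c \<otimes> y \<otimes> x"
    using x y by (simp add: c_def m_assoc inv_mult_cancel)
  have "c \<in> lower_central_series G k" for k
  proof (induction k)
    case (Suc k)
    show ?case
      using normal.commutator_mem_if_central_mod[OF lower_central_series_normal x y c xy _ m n cop]
        commutator_in_lower_central_series[OF Suc] by blast
  qed (use c in simp)
  then have "c = \<one>" using nil by (auto simp: nilpotent_group_def)
  then show ?thesis using xy x y by simp
qed

text \<open>Suppose the normalizer of \<open>R\<close> is proper. Just before the lower central
  series enters it, some term contains an \<open>x\<close> outside that still normalizes it, because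
  its commutators with \<open>x\<close> lie in it. So the conjugate of \<open>R\<close> by
  \<open>x\<close> is a \<open>p\<close>-subgroup of the normalizer, where \<open>R\<close> is the
  only Sylow subgroup; the two coincide and \<open>x\<close> normalizes \<open>R\<close> after
  all.\<close>

lemma nilpotent_maximal_p_subgroup_normal:
  fixes G (structure)
  assumes nil: "nilpotent_group G" and fin: "finite (carrier G)" and p: "prime p"
    and R: "maximal_p_subgroup p G (carrier G) R" and g: "g \<in> carrier G"
  shows "conjugate G g R = R"
proof -
  interpret group G using nil by (simp add: nilpotent_group_def)
  let ?N = "normalizer_in G (carrier G) R"
  have R': "p_subgroup p G R" "subgroup R G" "R \<subseteq> carrier G"
    using R by (auto simp: maximal_p_subgroup_def p_subgroup_def)
  have sN: "subgroup ?N G" using subgroup_self R'(3) by (rule subgroup_normalizer_in)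
  have Nc: "?N \<subseteq> carrier G" by (auto simp: normalizer_in_def)
  have finN: "finite ?N" using Nc fin by (rule finite_subset)
  have RN: "R \<subseteq> ?N" using R'(2,3) by (rule subset_normalizer_in)
  have RmaxN: "maximal_p_subgroup p G ?N R"
    using R RN Nc by (auto simp: maximal_p_subgroup_def)
  have "carrier G \<subseteq> ?N"
  proof (rule ccontr)
    assume notsub: "\<not> carrier G \<subseteq> ?N"
    obtain n where "lower_central_series G n = {\<one>}" using nil by (auto simp: nilpotent_group_def)
    then have "lower_central_series G n \<subseteq> ?N" using subgroup.one_closed[OF sN] by simp
    moreover have "\<not> lower_central_series G 0 \<subseteq> ?N" using notsub by simp
    ultimately have "\<exists>k<n. (\<forall>i\<le>k. \<not> lower_central_series G i \<subseteq> ?N) \<and> lower_central_series G (Suc k) \<subseteq> ?N"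
      by (rule ex_least_nat_less)
    then obtain k where k: "\<not> lower_central_series G k \<subseteq> ?N" "lower_central_series G (Suc k) \<subseteq> ?N"
      by blast
    then obtain x where x: "x \<in> lower_central_series G k" "x \<notin> ?N" by blast
    have xc: "x \<in> carrier G" by (rule subgroup.mem_carrier[OF subgroup_lower_central_series x(1)])
    have "x \<otimes> h \<otimes> inv x \<in> ?N" if h: "h \<in> ?N" for h
    proof -
      have hc: "h \<in> carrier G" using h Nc by blast
      have "x \<otimes> h \<otimes> inv x \<otimes> inv h \<in> ?N"
        using commutator_in_lower_central_series[OF x(1) hc] k(2) by blast
      from subgroup.m_closed[OF sN this h] show ?thesis using xc hc by (simp add: m_assoc)
    qed
    then have "conjugate G x ?N \<subseteq> ?N" unfolding conjugate_def by (rule image_subsetI)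
    then have xR: "conjugate G x R \<subseteq> ?N" using conjugate_mono[OF RN, of x] by blast
    obtain h where h: "h \<in> ?N" "conjugate G x R \<subseteq> conjugate G h R"
      using p_subgroup_subset_conjugate_maximal[OF sN finN p RmaxN p_subgroup_conjugate[OF R'(1) xc] xR]
      by blast
    then have "conjugate G x R \<subseteq> R" by (simp add: normalizer_in_def)
    moreover have "card (conjugate G x R) = card R" using xc R'(3) by (rule card_conjugate)
    ultimately have "conjugate G x R = R"
      using finite_subset[OF R'(3) fin] by (intro card_subset_eq)
    then show False using x(2) xc by (simp add: normalizer_in_def)
  qed
  then show ?thesis using g by (auto simp: normalizer_in_def)
qed

text \<open>The Bezout identity \<open>p ^ a * s = m * t + 1\<close> splits \<open>y\<close> into
  \<open>y [^] (p ^ a * s)\<close>, killed by \<open>m\<close>, and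
  \<open>inv (y [^] (m * t))\<close>, killed by \<open>p ^ a\<close>.\<close>

lemma (in group) p_part_decomposition:
  assumes fin: "finite (carrier G)" and p: "prime p" and y: "y \<in> carrier G"
  obtains u z :: 'a and k m :: nat where "u \<in> carrier G" "z \<in> carrier G" "y = u \<otimes> z"
    "u [^] (p ^ k) = \<one>" "z [^] m = \<one>" "coprime p m"
proof -
  have "order G \<noteq> 0" using fin order_gt_0_iff_finite by simp
  moreover have "\<not> is_unit p" using p by auto
  ultimately obtain m where m: "order G = p ^ multiplicity p (order G) * m" "\<not> p dvd m"
    using multiplicity_decompose'[of "order G" p] by blast
  define a where "a = multiplicity p (order G)"
  have cop: "coprime p m" using p m(2) by (rule prime_imp_coprime)
  have "p ^ a \<noteq> 0" using prime_gt_0_nat[OF p] by simp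
  then obtain s t where st: "p ^ a * s = m * t + gcd (p ^ a) m" using bezout_nat by blast
  have "gcd (p ^ a) m = 1" using cop by (simp add: coprime_iff_gcd_eq_1[symmetric])
  with st have st: "p ^ a * s = m * t + 1" by simp
  define u z where "u = inv (y [^] (m * t))" and "z = y [^] (p ^ a * s)"
  have ord: "y [^] (p ^ a * m) = \<one>" using pow_order_eq_1[OF y] m(1) by (simp add: a_def)
  have 1: "y [^] (p ^ a * m * j) = \<one>" for j :: nat
    using nat_pow_pow[OF y, of "p ^ a * m" j] ord by simp
  have uz: "u \<otimes> z = y"
  proof -
    have "z = y [^] (m * t) \<otimes> y" unfolding z_def st using y by simp
    then show ?thesis using y by (simp add: u_def inv_mult_cancel)
  qed
  have u: "u [^] (p ^ a) = \<one>"
  proof -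
    have "(y [^] (m * t)) [^] (p ^ a) = y [^] (m * t * p ^ a)" by (rule nat_pow_pow[OF y])
    also have "m * t * p ^ a = p ^ a * m * t" by simp
    finally show ?thesis using 1[of t] y by (simp only: u_def nat_pow_inv nat_pow_closed inv_one)
  qed
  have z: "z [^] m = \<one>"
  proof -
    have "z [^] m = y [^] (p ^ a * s * m)" unfolding z_def by (rule nat_pow_pow[OF y])
    also have "p ^ a * s * m = p ^ a * m * s" by simp
    finally show ?thesis using 1[of s] by (simp only:)
  qed
  have "u \<in> carrier G" "z \<in> carrier G" using y by (simp_all add: u_def z_def)
  then show ?thesis by (rule that[OF _ _ uz[symmetric] u z cop])
qed

text \<open>Two separate uses of nilpotency. Normality of the Sylow subgroup puts \<open>y\<close>
  into the subnormalizer that Casolo's formula counts. Commuting of elements of coprime order yields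
  the factorization of \<open>y\<close> on which the openness of \<open>O_p(G)C_G(g)\<close>
  rests.\<close>

lemma nilpotent_p_element:
  fixes G (structure)
  assumes nil: "nilpotent_group G" and fin: "finite (carrier G)" and p: "prime p"
    and x: "x \<in> carrier G" "x [^] (p ^ i) = \<one>" and y: "y \<in> carrier G"
  shows "\<exists>A. p_subgroup p G A \<and> x \<in> A \<and> conjugate G y A = A"
    and "\<exists>u z k. u \<in> carrier G \<and> z \<in> carrier G \<and> y = u \<otimes> z \<and> u [^] (p ^ k) = \<one>
      \<and> z \<otimes> x = x \<otimes> z"
proof -
  interpret group G using nil by (simp add: nilpotent_group_def)
  obtain R where R: "maximal_p_subgroup p G (carrier G) R"
    using ex_maximal_p_subgroup[OF subgroup_self fin p] by blast
  have "p_subgroup p G (generate G {x})" using fin p x by (rule p_subgroup_generate)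
  moreover have "generate G {x} \<subseteq> carrier G" using generate_incl x(1) by simp
  ultimately obtain g where "g \<in> carrier G" "generate G {x} \<subseteq> conjugate G g R"
    using p_subgroup_subset_conjugate_maximal[OF subgroup_self fin p R] by blast
  then have "x \<in> R"
    using nilpotent_maximal_p_subgroup_normal[OF nil fin p R] generate.incl[of x "{x}" G] by auto
  then show "\<exists>A. p_subgroup p G A \<and> x \<in> A \<and> conjugate G y A = A"
    using R nilpotent_maximal_p_subgroup_normal[OF nil fin p R y] by (auto simp: maximal_p_subgroup_def)
  obtain u z :: 'a and k m :: nat where uz: "u \<in> carrier G" "z \<in> carrier G" "y = u \<otimes> z"
    "u [^] (p ^ k) = \<one>" "z [^] m = \<one>" "coprime p m"
    using p_part_decomposition[OF fin p y] by metis
  have "coprime m (p ^ i)" using uz(6) by (simp add: coprime_commute)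
  then have "z \<otimes> x = x \<otimes> z"
    using nilpotent_coprime_commute[OF nil uz(2) x(1) uz(5) x(2)] by simp
  then show "\<exists>u z k. u \<in> carrier G \<and> z \<in> carrier G \<and> y = u \<otimes> z \<and> u [^] (p ^ k) = \<one>
      \<and> z \<otimes> x = x \<otimes> z"
    using uz by blast
qed

section \<open>Open normal subgroups of profinite groups\<close>

text \<open>The tube lemma gives around each such \<open>y\<close> an open set that works for all of
  \<open>C\<close> at once.\<close>

lemma openin_forall_compact:
  assumes C: "compactin X C" and W: "openin (prod_topology X Y) W"
  shows "openin Y {y \<in> topspace Y. \<forall>c\<in>C. (c, y) \<in> W}"
proof (subst openin_subopen, intro ballI)
  fix y assume y: "y \<in> {y \<in> topspace Y. \<forall>c\<in>C. (c, y) \<in> W}"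
  then obtain U V where "openin X U" "openin Y V" "C \<subseteq> U" "y \<in> V" "U \<times> V \<subseteq> W"
    using tube_lemma_left[OF W C, of y] by blast
  then show "\<exists>V. openin Y V \<and> y \<in> V \<and> V \<subseteq> {y \<in> topspace Y. \<forall>c\<in>C. (c, y) \<in> W}"
    using openin_subset by (intro exI[of _ V]) blast
qed

section \<open>Translations and open subgroups in a topological group\<close>

context topological_group
begin

lemma continuous_map_mult:
  assumes "continuous_map X T f" "continuous_map X T g"
  shows "continuous_map X T (\<lambda>x. f x \<otimes> g x)"
proof -
  have "continuous_map X T ((\<lambda>(x, y). x \<otimes> y) \<circ> (\<lambda>x. (f x, g x)))"
    using continuous_map_pairedI[OF assms] continuous_mult by (rule continuous_map_compose)
  then show ?thesis by (simp add: o_def)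
qed

lemma continuous_map_inverse:
  assumes "continuous_map X T f"
  shows "continuous_map X T (\<lambda>x. inv (f x))"
  using continuous_map_compose[OF assms continuous_inv] by (simp add: o_def)

lemma continuous_map_group_const: "a \<in> carrier G \<Longrightarrow> continuous_map X T (\<lambda>_. a)"
  by (simp add: topspace_eq)

lemma continuous_map_ident: "continuous_map T T (\<lambda>x. x)"
  by simp

lemmas continuous_group_intros =
  continuous_map_mult continuous_map_inverse continuous_map_group_const continuous_map_ident

lemma openin_carrier: "openin T U \<Longrightarrow> U \<subseteq> carrier G"
  using openin_subset topspace_eq by metis

lemma closedin_carrier: "closedin T U \<Longrightarrow> U \<subseteq> carrier G"
  using closedin_subset topspace_eq by metis

lemma openin_preimage: "continuous_map T T f \<Longrightarrow> openin T U \<Longrightarrow> openin T {x \<in> carrier G. f x \<in> U}"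
  using openin_continuous_map_preimage[of T T f U] by (simp add: topspace_eq)

lemma closedin_preimage: "continuous_map T T f \<Longrightarrow> closedin T U \<Longrightarrow> closedin T {x \<in> carrier G. f x \<in> U}"
  using closedin_continuous_map_preimage[of T T f U] by (simp add: topspace_eq)

lemma
  assumes g: "g \<in> carrier G" and U: "U \<subseteq> carrier G"
  shows l_coset_preimage: "g <#\<^bsub>G\<^esub> U = {x \<in> carrier G. inv g \<otimes> x \<in> U}"
    and r_coset_preimage: "U #> g = {x \<in> carrier G. x \<otimes> inv g \<in> U}"
    and conjugate_preimage: "conjugate G g U = {x \<in> carrier G. inv g \<otimes> x \<otimes> g \<in> U}"
proof -
  have "x \<in> g <#\<^bsub>G\<^esub> U" if "x \<in> carrier G" "inv g \<otimes> x \<in> U" for x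
  proof -
    have "x = g \<otimes> (inv g \<otimes> x)" using g that by (simp add: inv_mult_cancel)
    then show ?thesis using that by (auto simp: l_coset_def)
  qed
  then show "g <#\<^bsub>G\<^esub> U = {x \<in> carrier G. inv g \<otimes> x \<in> U}"
    using g U by (auto simp: l_coset_def inv_mult_cancel subset_iff)
  have "x \<in> U #> g" if "x \<in> carrier G" "x \<otimes> inv g \<in> U" for x
  proof -
    have "x = (x \<otimes> inv g) \<otimes> g" using g that by (simp add: m_assoc)
    then show ?thesis using that by (auto simp: r_coset_def)
  qed
  then show "U #> g = {x \<in> carrier G. x \<otimes> inv g \<in> U}"
    using g U by (auto simp: r_coset_def m_assoc subset_iff)
  show "conjugate G g U = {x \<in> carrier G. inv g \<otimes> x \<otimes> g \<in> U}"
    using conjugate_closed[OF g U] mem_conjugate_iff[OF g _ U] by auto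
qed

lemma
  assumes g: "g \<in> carrier G"
  shows openin_l_coset: "openin T U \<Longrightarrow> openin T (g <#\<^bsub>G\<^esub> U)"
    and openin_r_coset: "openin T U \<Longrightarrow> openin T (U #> g)"
    and closedin_r_coset: "closedin T U \<Longrightarrow> closedin T (U #> g)"
    and closedin_conjugate: "closedin T U \<Longrightarrow> closedin T (conjugate G g U)"
proof -
  have c: "continuous_map T T (\<lambda>x. inv g \<otimes> x)" "continuous_map T T (\<lambda>x. x \<otimes> inv g)"
    "continuous_map T T (\<lambda>x. inv g \<otimes> x \<otimes> g)"
    using g by (intro continuous_group_intros; simp)+
  show "openin T U \<Longrightarrow> openin T (g <#\<^bsub>G\<^esub> U)" "openin T U \<Longrightarrow> openin T (U #> g)"
    using openin_preimage c g
    by (simp_all add: l_coset_preimage r_coset_preimage openin_carrier)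
  show "closedin T U \<Longrightarrow> closedin T (U #> g)" "closedin T U \<Longrightarrow> closedin T (conjugate G g U)"
    using closedin_preimage c g
    by (simp_all add: r_coset_preimage conjugate_preimage closedin_carrier)
qed

lemma openin_subgroup_if_contains_open:
  assumes H: "subgroup H G" and U: "openin T U" "U \<subseteq> H" "\<one> \<in> U"
  shows "openin T H"
proof -
  have Hc: "H \<subseteq> carrier G" using H by (rule subgroup.subset)
  have "H = (\<Union>h\<in>H. h <#\<^bsub>G\<^esub> U)"
  proof
    show "H \<subseteq> (\<Union>h\<in>H. h <#\<^bsub>G\<^esub> U)"
      using U(3) Hc by (force simp: l_coset_def)
    show "(\<Union>h\<in>H. h <#\<^bsub>G\<^esub> U) \<subseteq> H"
      using U(2) subgroup.m_closed[OF H] by (auto simp: l_coset_def)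
  qed
  moreover have "openin T (\<Union>h\<in>H. h <#\<^bsub>G\<^esub> U)"
    using Hc U(1) by (intro openin_Union) (auto intro: openin_l_coset)
  ultimately show ?thesis by simp
qed

lemma closedin_open_subgroup:
  assumes H: "subgroup H G" "openin T H"
  shows "closedin T H"
proof -
  have Hc: "H \<subseteq> carrier G" using H(1) by (rule subgroup.subset)
  have "openin T (\<Union>g\<in>carrier G - H. g <#\<^bsub>G\<^esub> H)"
    using H(2) by (intro openin_Union) (auto intro: openin_l_coset)
  moreover have "(\<Union>g\<in>carrier G - H. g <#\<^bsub>G\<^esub> H) = topspace T - H"
  proof -
    have "g \<otimes> h \<in> carrier G - H" if "g \<in> carrier G - H" "h \<in> H" for g h
    proof -
      have c: "g \<in> carrier G" "h \<in> carrier G" using that Hc by auto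
      have "g \<in> H" if gh: "g \<otimes> h \<in> H"
      proof -
        have "(g \<otimes> h) \<otimes> inv h \<in> H"
          by (rule subgroup.m_closed[OF H(1) gh subgroup.m_inv_closed[OF H(1) \<open>h \<in> H\<close>]])
        then show ?thesis using c by (simp add: m_assoc)
      qed
      then show ?thesis using that(1) c by auto
    qed
    moreover have "g \<in> g <#\<^bsub>G\<^esub> H" if "g \<in> carrier G" for g
      using that subgroup.one_closed[OF H(1)] by (force simp: l_coset_def)
    ultimately show ?thesis by (auto simp: topspace_eq l_coset_def)
  qed
  ultimately show ?thesis using Hc by (simp add: closedin_def topspace_eq)
qed

end

definition open_normal :: "('a, 'b) monoid_scheme \<Rightarrow> 'a topology \<Rightarrow> 'a set \<Rightarrow> bool" where
  "open_normal G T N \<longleftrightarrow> N \<lhd> G \<and> openin T N"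

section \<open>Open normal subgroups as a neighbourhood base of the identity\<close>

context profinite_group
begin

text \<open>In a compact Hausdorff space components and quasi-components coincide, so the identity
  can be separated from the compact complement of \<open>U\<close> by a clopen set.\<close>

lemma ex_clopen_subset:
  assumes "openin T U" "\<one> \<in> U"
  obtains V where "closedin T V" "openin T V" "\<one> \<in> V" "V \<subseteq> U"
proof -
  have one: "\<one> \<in> topspace T" by (simp add: topspace_eq)
  have "connected_component_of_set T \<one> = {\<one>}" using totally_disconnected one by blast
  then have "{\<one>} \<in> connected_components_of T"
    using one by (auto simp: connected_components_of_def)
  moreover have "compactin T {\<one>}" using one by simp
  ultimately have q: "{\<one>} \<in> quasi_components_of T"
    using compact_quasi_eq_connected_components_of[OF compact_imp_locally_compact_space[OF compact] Hausdorff]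
    by blast
  have "compactin T (topspace T - U)"
    using compact assms(1) by (intro closedin_compact_space) auto
  then have "separated_between T {\<one>} (topspace T - U)"
    using separated_between_quasi_component_compact[OF q] assms(2) by (simp add: disjnt_iff)
  then obtain V where V: "closedin T V" "openin T V" "\<one> \<in> V" "topspace T - U \<subseteq> topspace T - V"
    by (auto simp: separated_between)
  moreover have "V \<subseteq> U" using V(2,4) openin_subset by blast
  ultimately show ?thesis using that by blast
qed

text \<open>The stabilizer \<open>H\<close> of a clopen neighbourhood \<open>V\<close> under right
  multiplication is a subgroup inside \<open>V\<close>, and it is open because \<open>V\<close> is
  compact and open. The intersection \<open>N\<close> of the conjugates of \<open>H\<close> is open
  by compactness of the whole group.\<close>

lemma ex_open_normal:
  assumes U: "openin T U" "\<one> \<in> U"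
  obtains N where "open_normal G T N" "N \<subseteq> U"
proof -
  obtain V where V: "closedin T V" "openin T V" "\<one> \<in> V" "V \<subseteq> U"
    using ex_clopen_subset[OF U] by blast
  have Vc: "V \<subseteq> carrier G" using V(2) by (rule openin_carrier)
  have compV: "compactin T V" using compact V(1) by (rule closedin_compact_space)
  define H where "H = {g \<in> carrier G. (\<forall>v\<in>V. v \<otimes> g \<in> V) \<and> (\<forall>v\<in>V. v \<otimes> inv g \<in> V)}"
  have cont: "continuous_map (prod_topology T T) T (\<lambda>z. fst z \<otimes> snd z)"
    "continuous_map (prod_topology T T) T (\<lambda>z. fst z \<otimes> inv (snd z))"
    "continuous_map (prod_topology T T) T (\<lambda>z. fst z \<otimes> snd z \<otimes> inv (fst z))"
    by (intro continuous_group_intros continuous_map_fst continuous_map_snd)+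
  have "openin T ({g \<in> topspace T. \<forall>v\<in>V. (v, g) \<in> {z \<in> topspace (prod_topology T T). fst z \<otimes> snd z \<in> V}}
      \<inter> {g \<in> topspace T. \<forall>v\<in>V. (v, g) \<in> {z \<in> topspace (prod_topology T T). fst z \<otimes> inv (snd z) \<in> V}})"
    by (intro openin_Int openin_forall_compact[OF compV]
        openin_continuous_map_preimage[OF cont(1) V(2)] openin_continuous_map_preimage[OF cont(2) V(2)])
  also have "\<dots> = H" using Vc by (auto simp: H_def topspace_eq)
  finally have openH: "openin T H" .
  have HV: "H \<subseteq> V"
  proof
    fix g assume "g \<in> H"
    then have "\<one> \<otimes> g \<in> V" "g \<in> carrier G" using V(3) by (auto simp: H_def)
    then show "g \<in> V" by simp
  qed
  have subH: "subgroup H G"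
  proof (rule subgroupI)
    show "H \<subseteq> carrier G" by (auto simp: H_def)
    have "\<one> \<in> H" using Vc by (auto simp: H_def subset_iff)
    then show "H \<noteq> {}" by blast
    show "inv g \<in> H" if "g \<in> H" for g
      using that by (simp add: H_def)
    show "g \<otimes> h \<in> H" if gh: "g \<in> H" "h \<in> H" for g h
    proof -
      have c: "g \<in> carrier G" "h \<in> carrier G" using gh by (auto simp: H_def)
      have "v \<otimes> (g \<otimes> h) \<in> V" if "v \<in> V" for v
      proof -
        have "v \<otimes> g \<otimes> h \<in> V" using gh that by (auto simp: H_def)
        then show ?thesis using that c Vc by (auto simp: m_assoc)
      qed
      moreover have "v \<otimes> inv (g \<otimes> h) \<in> V" if "v \<in> V" for v
      proof -
        have "v \<otimes> inv h \<otimes> inv g \<in> V" using gh that by (auto simp: H_def)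
        then show ?thesis using that c Vc by (auto simp: m_assoc inv_mult_group)
      qed
      ultimately show ?thesis using c by (simp add: H_def)
    qed
  qed
  define N where "N = {g \<in> carrier G. \<forall>x\<in>carrier G. x \<otimes> g \<otimes> inv x \<in> H}"
  have "openin T {g \<in> topspace T. \<forall>x\<in>topspace T. (x, g) \<in> {z \<in> topspace (prod_topology T T). fst z \<otimes> snd z \<otimes> inv (fst z) \<in> H}}"
    using compact unfolding compact_space_def
    by (rule openin_forall_compact[OF _ openin_continuous_map_preimage[OF cont(3) openH]])
  also have "\<dots> = N" by (auto simp: N_def topspace_eq)
  finally have openN: "openin T N" .
  have NH: "N \<subseteq> H"
  proof
    fix g assume g: "g \<in> N"
    then have "\<one> \<otimes> g \<otimes> inv \<one> \<in> H" unfolding N_def by blast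
    then show "g \<in> H" using g by (simp add: N_def)
  qed
  have "N \<lhd> G"
  proof (rule normal_invI)
    show "subgroup N G"
    proof (rule subgroupI)
      show "N \<subseteq> carrier G" by (auto simp: N_def)
      show "N \<noteq> {}" using subgroup.one_closed[OF subH] by (auto simp: N_def intro!: exI[of _ \<one>])
      show "inv g \<in> N" if g: "g \<in> N" for g
      proof -
        have gc: "g \<in> carrier G" using g by (simp add: N_def)
        have "x \<otimes> inv g \<otimes> inv x \<in> H" if x: "x \<in> carrier G" for x
        proof -
          have "x \<otimes> g \<otimes> inv x \<in> H" using g x by (simp add: N_def)
          from subgroup.m_inv_closed[OF subH this] show ?thesis
            using gc x by (simp add: inv_mult_group m_assoc)
        qed
        then show ?thesis using gc by (simp add: N_def)
      qed
      show "g \<otimes> h \<in> N" if gh: "g \<in> N" "h \<in> N" for g h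
      proof -
        have c: "g \<in> carrier G" "h \<in> carrier G" using gh by (auto simp: N_def)
        have "x \<otimes> (g \<otimes> h) \<otimes> inv x \<in> H" if x: "x \<in> carrier G" for x
        proof -
          have "x \<otimes> g \<otimes> inv x \<in> H" "x \<otimes> h \<otimes> inv x \<in> H" using gh x by (auto simp: N_def)
          from subgroup.m_closed[OF subH this] show ?thesis
            using c x by (simp add: m_assoc inv_mult_cancel)
        qed
        then show ?thesis using c by (simp add: N_def)
      qed
    qed
    show "y \<otimes> g \<otimes> inv y \<in> N" if y: "y \<in> carrier G" and g: "g \<in> N" for y g
    proof -
      have gc: "g \<in> carrier G" using g by (simp add: N_def)
      have "x \<otimes> (y \<otimes> g \<otimes> inv y) \<otimes> inv x \<in> H" if x: "x \<in> carrier G" for x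
      proof -
        have "(x \<otimes> y) \<otimes> g \<otimes> inv (x \<otimes> y) \<in> H" using g x y by (simp add: N_def)
        then show ?thesis using gc x y by (simp add: inv_mult_group m_assoc)
      qed
      then show ?thesis using gc y by (simp add: N_def)
    qed
  qed
  then show ?thesis using that[of N] openN NH HV V(4) by (auto simp: open_normal_def)
qed

lemma finite_rcosets_open_subgroup:
  assumes U: "subgroup U G" "openin T U"
  shows "finite (rcosets U)"
proof -
  have Uc: "U \<subseteq> carrier G" using U(1) by (rule subgroup.subset)
  have open_cosets: "openin T C" if "C \<in> rcosets U" for C
    using that U(2) by (auto simp: RCOSETS_def intro: openin_r_coset)
  then have A: "\<forall>C\<in>rcosets U. openin T C" by blast
  have B: "topspace T \<subseteq> \<Union>(rcosets U)"
    using rcosets_part_G[OF U(1)] by (simp add: topspace_eq)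
  from compact[unfolded compact_space_alt, THEN spec, THEN mp, OF conjI[OF A B]]
  obtain F where F: "finite F" "F \<subseteq> rcosets U" "topspace T \<subseteq> \<Union>F" by (elim exE conjE)
  have "C \<in> F" if C: "C \<in> rcosets U" for C
  proof -
    obtain x where x: "x \<in> C" using subgroup.rcosets_non_empty[OF U(1) C] by blast
    have "x \<in> topspace T" using openin_subset[OF open_cosets[OF C]] x by blast
    then obtain D where D: "D \<in> F" "x \<in> D" using F(3) by blast
    have "pairwise disjnt (rcosets U)" using U(1) by (rule rcos_disjoint)
    moreover have "D \<in> rcosets U" using D(1) F(2) by blast
    ultimately have "D \<noteq> C \<longrightarrow> disjnt D C" using C unfolding pairwise_def by blast
    then have "D = C" using D(2) x by (auto simp: disjnt_iff)
    then show ?thesis using D(1) by simp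
  qed
  then have "rcosets U \<subseteq> F" by blast
  then show ?thesis using F(1) by (rule finite_subset)
qed

lemma open_normal_Int: "open_normal G T M \<Longrightarrow> open_normal G T N \<Longrightarrow> open_normal G T (M \<inter> N)"
  by (auto simp: open_normal_def intro: normal_subgroup_intersect)

lemma open_normal_carrier: "open_normal G T (carrier G)"
  using normal_invI[OF subgroup_self] openin_topspace[of T] by (auto simp: open_normal_def topspace_eq)

lemma open_normal_Inter:
  "finite \<M> \<Longrightarrow> (\<And>M. M \<in> \<M> \<Longrightarrow> open_normal G T M) \<Longrightarrow> open_normal G T (carrier G \<inter> \<Inter>\<M>)"
proof (induction \<M> rule: finite_induct)
  case empty then show ?case using open_normal_carrier by simp
next
  case (insert M \<M>)
  have "carrier G \<inter> \<Inter>(insert M \<M>) = M \<inter> (carrier G \<inter> \<Inter>\<M>)" by blast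
  then show ?case using insert open_normal_Int by simp
qed

end

context group_hom
begin

lemma conjugate_image:
  assumes "g \<in> carrier G" "A \<subseteq> carrier G"
  shows "h ` conjugate G g A = conjugate H (h g) (h ` A)"
  unfolding conjugate_def image_image using assms by (intro image_cong) auto

lemma subgroup_preimage:
  assumes "subgroup A H"
  shows "subgroup {x \<in> carrier G. h x \<in> A} G"
proof (rule G.subgroupI)
  show "{x \<in> carrier G. h x \<in> A} \<noteq> {}"
    using subgroup.one_closed[OF assms] by (auto intro!: exI[of _ "\<one>"])
qed (use subgroup.m_inv_closed[OF assms] subgroup.m_closed[OF assms] in auto)

end

lemma open_normal_subgroup: "open_normal G T M \<Longrightarrow> subgroup M G"
  by (simp add: open_normal_def normal_def)

lemma open_normal_subset: "open_normal G T M \<Longrightarrow> M \<subseteq> carrier G"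
  by (rule subgroup.subset[OF open_normal_subgroup])

lemma (in group) r_coset_eq_iff:
  assumes "subgroup M G" "x \<in> carrier G" "y \<in> carrier G"
  shows "M #> x = M #> y \<longleftrightarrow> x \<otimes> inv y \<in> M"
proof
  assume "M #> x = M #> y"
  then have "x \<in> M #> y" using rcos_self[OF assms(2,1)] by simp
  then obtain m where "m \<in> M" "x = m \<otimes> y" by (auto simp: r_coset_def)
  then show "x \<otimes> inv y \<in> M"
    using assms subgroup.mem_carrier[OF assms(1)] by (simp add: m_assoc)
next
  assume "x \<otimes> inv y \<in> M"
  then have "(x \<otimes> inv y) \<otimes> y \<in> M #> y" by (auto simp: r_coset_def)
  then have "x \<in> M #> y" using assms by (simp add: m_assoc)
  then show "M #> x = M #> y" using repr_independence[OF _ assms(3,1)] by simp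
qed

locale open_quotient = profinite_group G T for G (structure) and T +
  fixes M assumes open_normal: "open_normal G T M"
begin

sublocale normal M G
  using open_normal by (simp add: open_normal_def)

sublocale proj: group_hom G "G Mod M" "r_coset G M"
  using group_hom_Mod by simp

lemma surj_proj: "r_coset G M ` carrier G = carrier (G Mod M)"
  by (simp add: carrier_FactGroup)

lemma finite_quotient: "finite (carrier (G Mod M))"
  using finite_rcosets_open_subgroup[of M] open_normal is_subgroup
  by (simp add: FactGroup_def open_normal_def)

lemma quotient_cases:
  assumes "c \<in> carrier (G Mod M)"
  obtains g where "g \<in> carrier G" "c = M #> g"
  using assms surj_proj by blast

lemma proj_eq_iff:
  "x \<in> carrier G \<Longrightarrow> y \<in> carrier G \<Longrightarrow> M #> x = M #> y \<longleftrightarrow> x \<otimes> inv y \<in> M"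
  using is_subgroup by (rule r_coset_eq_iff)

lemma proj_eq_one_iff: "x \<in> carrier G \<Longrightarrow> M #> x = M \<longleftrightarrow> x \<in> M"
  using proj_eq_iff[of x \<one>] coset_mult_one[OF subset] by simp

text \<open>The set is a union of cosets of \<open>M\<close>. As \<open>Q\<close> is arbitrary, the
  complement has the same form, so these sets are clopen.\<close>

lemma openin_saturated: "openin T {x \<in> carrier G. Q (M #> x)}"
proof (subst openin_subopen, intro ballI)
  fix x assume x: "x \<in> {x \<in> carrier G. Q (M #> x)}"
  have "openin T (M #> x)" using x open_normal by (auto simp: open_normal_def intro: openin_r_coset)
  moreover have "x \<in> M #> x" using x rcos_self is_subgroup by blast
  moreover have "M #> x \<subseteq> {x \<in> carrier G. Q (M #> x)}"
  proof
    fix y assume y: "y \<in> M #> x"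
    then have "y \<in> carrier G" using x r_coset_subset_G[OF subset] by blast
    moreover have "M #> y = M #> x" using repr_independence[OF y _ is_subgroup] x by simp
    ultimately show "y \<in> {x \<in> carrier G. Q (M #> x)}" using x by simp
  qed
  ultimately show "\<exists>U. openin T U \<and> x \<in> U \<and> U \<subseteq> {x \<in> carrier G. Q (M #> x)}" by blast
qed

lemma closedin_saturated: "closedin T {x \<in> carrier G. Q (M #> x)}"
proof -
  have "topspace T - {x \<in> carrier G. Q (M #> x)} = {x \<in> carrier G. \<not> Q (M #> x)}"
    by (auto simp: topspace_eq)
  then show ?thesis using openin_saturated[of "\<lambda>c. \<not> Q c"] by (auto simp: closedin_def topspace_eq)
qed

end

section \<open>Recovering closed sets and open subgroups from finite quotients\<close>

context profinite_group
begin

lemma open_quotientI: "open_normal G T M \<Longrightarrow> open_quotient G T M"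
  by unfold_locales

text \<open>If \<open>x\<close> lies outside \<open>C\<close>, its coset modulo a small enough open
  normal subgroup misses \<open>C\<close>. The bound \<open>M0\<close> lets applications argue in
  deep quotients only.\<close>

lemma mem_closed_if_mem_quotients:
  assumes C: "closedin T C" and x: "x \<in> carrier G" and M0: "open_normal G T M0"
    and q: "\<And>M. open_normal G T M \<Longrightarrow> M \<subseteq> M0 \<Longrightarrow> M #> x \<in> r_coset G M ` C"
  shows "x \<in> C"
proof (rule ccontr)
  assume "x \<notin> C"
  have Cc: "C \<subseteq> carrier G" using C by (rule closedin_carrier)
  \<comment> \<open>Chosen so that a common coset of \<open>x\<close> and \<open>c\<close> in
    \<open>C\<close> is contradictory: for \<open>y = x \<otimes> inv c\<close> the product
    \<open>inv y \<otimes> x\<close> is \<open>c\<close>.\<close>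
  define U where "U = {y \<in> carrier G. inv y \<otimes> x \<in> topspace T - C}"
  have "continuous_map T T (\<lambda>y. inv y \<otimes> x)" using x by (intro continuous_group_intros)
  then have "openin T U" unfolding U_def using C by (intro openin_preimage) auto
  moreover have "\<one> \<in> U" using x \<open>x \<notin> C\<close> by (simp add: U_def topspace_eq)
  ultimately obtain N where N: "open_normal G T N" "N \<subseteq> U" using ex_open_normal by blast
  let ?M = "N \<inter> M0"
  have M: "open_normal G T ?M" using N(1) M0 by (rule open_normal_Int)
  interpret open_quotient G T ?M using M by (rule open_quotientI)
  obtain c where c: "c \<in> C" "?M #> x = ?M #> c" using q[OF M] by blast
  have cc: "c \<in> carrier G" using c Cc by blast
  then have "x \<otimes> inv c \<in> N" using proj_eq_iff[OF x cc] c(2) by blast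
  then have "inv (x \<otimes> inv c) \<otimes> x \<notin> C" using N(2) by (auto simp: U_def)
  then show False using c cc x by (simp add: inv_mult_group m_assoc)
qed

lemma mem_closed_subset_if_quotients:
  assumes C: "closedin T C" and B: "B \<subseteq> carrier G" and M0: "open_normal G T M0"
    and q: "\<And>M. open_normal G T M \<Longrightarrow> M \<subseteq> M0 \<Longrightarrow> r_coset G M ` B \<subseteq> r_coset G M ` C"
  shows "B \<subseteq> C"
  using mem_closed_if_mem_quotients[OF C _ M0] q B by blast

text \<open>Take the largest of the bounded indices, attained at \<open>M\<close>. For any
  \<open>N\<close> the subgroup for \<open>M \<inter> N\<close> lies in \<open>E M\<close> and its
  index is no larger, so it equals \<open>E M\<close>; hence \<open>E M\<close> lies in
  \<open>E N\<close>. Thus the family has a least member, and this member is open.\<close>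

lemma open_if_bounded_index:
  fixes E :: "'a set \<Rightarrow> 'a set"
  assumes E: "\<And>M. open_normal G T M \<Longrightarrow> subgroup (E M) G"
    and ME: "\<And>M. open_normal G T M \<Longrightarrow> M \<subseteq> E M"
    and mono: "\<And>M N. open_normal G T M \<Longrightarrow> open_normal G T N \<Longrightarrow> N \<subseteq> M \<Longrightarrow> E N \<subseteq> E M"
    and bound: "\<And>M. open_normal G T M \<Longrightarrow> card (rcosets (E M)) \<le> b"
  shows "\<exists>M. open_normal G T M \<and> (\<forall>N. open_normal G T N \<longrightarrow> E M \<subseteq> E N)"
proof -
  let ?i = "\<lambda>M. card (rcosets (E M))"
  \<comment> \<open>\<open>Suc b\<close>, because \<open>ex_has_greatest_nat\<close> takes a strict
    bound.\<close>
  have "\<exists>M. open_normal G T M \<and> (\<forall>N. open_normal G T N \<longrightarrow> ?i N \<le> ?i M)"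
    using bound open_normal_carrier by (intro ex_has_greatest_nat[of "open_normal G T" _ ?i "Suc b"]) (auto simp: less_Suc_eq_le)
  then obtain M where M: "open_normal G T M" "\<And>N. open_normal G T N \<Longrightarrow> ?i N \<le> ?i M" by blast
  have "E M \<subseteq> E N" if N: "open_normal G T N" for N
  proof -
    let ?K = "M \<inter> N"
    have K: "open_normal G T ?K" using M(1) N by (rule open_normal_Int)
    have EE: "E ?K \<subseteq> E M" using mono[OF M(1) K] by simp
    have sub: "subgroup (E ?K) G" "subgroup (E M) G" using E K M(1) by auto
    have "openin T (E ?K)"
      using openin_subgroup_if_contains_open[OF sub(1) _ ME[OF K]] K
        subgroup.one_closed[OF open_normal_subgroup[OF K]]
      by (simp add: open_normal_def)
    then have fin: "finite (rcosets (E ?K))" using sub(1) by (intro finite_rcosets_open_subgroup)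
    \<comment> \<open>Sends a coset of \<open>E ?K\<close> to the coset of \<open>E M\<close> around
      it. It is onto, so by the comparison of indices it is injective.\<close>
    define f where "f C = E M <#> C" for C
    have f: "f (E ?K #> x) = E M #> x" if x: "x \<in> carrier G" for x
    proof
      show "f (E ?K #> x) \<subseteq> E M #> x"
        using EE subgroup.m_closed[OF sub(2)] x subgroup.mem_carrier[OF sub(2)]
        by (auto simp: f_def set_mult_def r_coset_def subset_iff m_assoc[symmetric])
      show "E M #> x \<subseteq> f (E ?K #> x)"
      proof
        fix y assume "y \<in> E M #> x"
        then obtain e where e: "e \<in> E M" "y = e \<otimes> x" by (auto simp: r_coset_def)
        have "x \<in> E ?K #> x" using x sub(1) by (rule rcos_self)
        then show "y \<in> f (E ?K #> x)" using e by (auto simp: f_def set_mult_def)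
      qed
    qed
    have surj: "f ` (rcosets (E ?K)) = rcosets (E M)"
      using f by (force simp: RCOSETS_def)
    have "card (rcosets (E ?K)) \<le> card (f ` (rcosets (E ?K)))"
      using M(2)[OF K] surj by simp
    then have "inj_on f (rcosets (E ?K))"
      using fin card_image_le[OF fin, of f] by (intro eq_card_imp_inj_on) auto
    have "e \<in> E ?K" if e: "e \<in> E M" for e
    proof -
      have ec: "e \<in> carrier G" using e subgroup.mem_carrier[OF sub(2)] by blast
      have "f (E ?K #> e) = f (E ?K #> \<one>)"
        using f ec coset_join2[OF ec sub(2) e] coset_mult_one[OF subgroup.subset[OF sub(2)]] by simp
      moreover have "E ?K #> e \<in> rcosets (E ?K)" "E ?K #> \<one> \<in> rcosets (E ?K)"
        using ec by (auto simp: RCOSETS_def)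
      ultimately have "E ?K #> e = E ?K #> \<one>"
        using \<open>inj_on f _\<close> by (auto dest: inj_onD)
      then show ?thesis using r_coset_eq_iff[OF sub(1) ec one_closed] ec by simp
    qed
    then show ?thesis using mono[OF N K] by blast
  qed
  then show ?thesis using M(1) by blast
qed

end

section \<open>Closed subgroups and their finite quotients\<close>

lemma (in topological_group) topological_group_subgroup:
  assumes H: "subgroup H G"
  shows "topological_group (G\<lparr>carrier := H\<rparr>) (subtopology T H)"
proof -
  have Hc: "H \<subseteq> carrier G" using H by (rule subgroup.subset)
  have top: "topspace (subtopology T H) = H" using Hc by (auto simp: topspace_eq)
  interpret H: group "G\<lparr>carrier := H\<rparr>" using H by (rule subgroup_imp_group)
  show ?thesis
  proof unfold_locales
    show "topspace (subtopology T H) = carrier (G\<lparr>carrier := H\<rparr>)" using top by simp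
    have "continuous_map (subtopology (prod_topology T T) (H \<times> H)) (subtopology T H) (\<lambda>(x, y). x \<otimes> y)"
      using continuous_map_from_subtopology[OF continuous_mult] subgroup.m_closed[OF H] 
      by (auto simp: continuous_map_in_subtopology)
    then show "continuous_map (prod_topology (subtopology T H) (subtopology T H)) (subtopology T H)
        (\<lambda>(x, y). x \<otimes>\<^bsub>G\<lparr>carrier := H\<rparr>\<^esub> y)"
      by (simp add: subtopology_Times)
    have "continuous_map (subtopology T H) (subtopology T H) (\<lambda>x. inv x)"
      using continuous_map_from_subtopology[OF continuous_inv] subgroup.m_inv_closed[OF H] Hc
      by (auto simp: continuous_map_in_subtopology)
    then show "continuous_map (subtopology T H) (subtopology T H) (\<lambda>x. inv\<^bsub>G\<lparr>carrier := H\<rparr>\<^esub> x)"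
      by (rule continuous_map_eq) (use top m_inv_consistent[OF H] in auto)
  qed
qed

context profinite_group
begin

lemma profinite_closed_subgroup:
  assumes H: "closed_subgroup G T H"
  shows "profinite_group (G\<lparr>carrier := H\<rparr>) (subtopology T H)"
proof -
  have sH: "subgroup H G" and cl: "closedin T H" using H by (auto simp: closed_subgroup_def)
  interpret H: topological_group "G\<lparr>carrier := H\<rparr>" "subtopology T H"
    using sH by (rule topological_group_subgroup)
  show ?thesis
  proof unfold_locales
    show "compact_space (subtopology T H)"
      using closedin_compact_space[OF compact cl] by (rule compact_space_subtopology)
    show "Hausdorff_space (subtopology T H)"
      using Hausdorff by (rule Hausdorff_space_subtopology)
    show "\<forall>x\<in>topspace (subtopology T H). connected_component_of_set (subtopology T H) x = {x}"
    proof
      fix x assume x: "x \<in> topspace (subtopology T H)"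
      then have "connected_component_of_set T x = {x}" using totally_disconnected by auto
      moreover have "connected_component_of_set (subtopology T H) x \<subseteq> connected_component_of_set T x"
        by (auto simp: connected_component_of_def connectedin_subtopology)
      moreover have "x \<in> connected_component_of_set (subtopology T H) x"
        using x by (simp add: connected_component_of_refl)
      ultimately show "connected_component_of_set (subtopology T H) x = {x}" by blast
    qed
  qed
qed

lemma subgroup_Int_open_normal:
  assumes H: "subgroup H G" and M: "open_normal G T M"
  shows "open_normal (G\<lparr>carrier := H\<rparr>) (subtopology T H) (H \<inter> M)"
proof -
  have "H \<inter> M \<lhd> G\<lparr>carrier := H\<rparr>"
    using M normal_Int_subgroup[OF H, of M] by (simp add: open_normal_def Int_commute)
  moreover have "openin (subtopology T H) (H \<inter> M)"
    using M by (auto simp: open_normal_def openin_subtopology_Int2)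
  ultimately show ?thesis by (simp add: open_normal_def)
qed

lemma restricted_projection_hom:
  assumes H: "subgroup H G" and M: "open_normal G T M"
  shows "group_hom (G\<lparr>carrier := H\<rparr>) (G Mod M) (r_coset G M)"
proof -
  interpret open_quotient G T M using M by (rule open_quotientI)
  have "r_coset G M \<in> hom (G\<lparr>carrier := H\<rparr>) (G Mod M)"
  proof (rule homI)
    fix x assume "x \<in> carrier (G\<lparr>carrier := H\<rparr>)"
    then have x: "x \<in> carrier G" using subgroup.mem_carrier[OF H] by simp
    then show "M #> x \<in> carrier (G Mod M)" by (rule proj.hom_closed)
    fix y assume "y \<in> carrier (G\<lparr>carrier := H\<rparr>)"
    then have "y \<in> carrier G" using subgroup.mem_carrier[OF H] by simp
    with x show "M #> (x \<otimes>\<^bsub>G\<lparr>carrier := H\<rparr>\<^esub> y) = (M #> x) \<otimes>\<^bsub>G Mod M\<^esub> (M #> y)"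
      using proj.hom_mult by simp
  qed
  then show ?thesis
    using subgroup_imp_group[OF H] factorgroup_is_group
    by (intro group_hom.intro group_hom_axioms.intro)
qed

lemma r_coset_restrict: "r_coset (G\<lparr>carrier := H\<rparr>) N = r_coset G N"
  by (auto simp: r_coset_def fun_eq_iff)

text \<open>Each \<open>H \<inter> M\<close> is open and normal in \<open>H\<close>, and each open
  normal subgroup of \<open>H\<close> contains some \<open>H \<inter> M\<close>. So the quotients of
  \<open>H\<close> and its images in the quotients of \<open>G\<close> dominate each other, and the
  order formula gives the divisibility needed in each direction.\<close>

lemma pro_p_group_iff:
  assumes H: "closed_subgroup G T H" and p: "prime p"
  shows "pro_p_group p (G\<lparr>carrier := H\<rparr>) (subtopology T H)
    \<longleftrightarrow> (\<forall>M. open_normal G T M \<longrightarrow> p_subgroup p (G Mod M) (r_coset G M ` H))"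
proof -
  let ?H = "G\<lparr>carrier := H\<rparr>" and ?TH = "subtopology T H"
  have sH: "subgroup H G" and cl: "closedin T H" using H by (auto simp: closed_subgroup_def)
  interpret H: profinite_group ?H ?TH using H by (rule profinite_closed_subgroup)
  have sHH: "subgroup H ?H" using H.subgroup_self by simp
  have carrier_Mod: "carrier (?H Mod N) = r_coset ?H N ` H" for N
    by (simp add: carrier_FactGroup)
  have kerN: "r_coset ?H N x = N \<longleftrightarrow> x \<in> N" if "open_normal ?H ?TH N" "x \<in> H" for N x
  proof -
    interpret N: open_quotient ?H ?TH N using that(1) by (rule H.open_quotientI)
    show ?thesis using N.proj_eq_one_iff that(2) by simp
  qed
  have homN: "group_hom ?H (?H Mod N) (r_coset ?H N)" if "open_normal ?H ?TH N" for N
  proof -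
    interpret N: open_quotient ?H ?TH N using that(1) by (rule H.open_quotientI)
    show ?thesis by (rule N.proj.group_hom_axioms)
  qed
  have finN: "finite (r_coset ?H N ` H)" if "open_normal ?H ?TH N" for N
  proof -
    interpret N: open_quotient ?H ?TH N using that(1) by (rule H.open_quotientI)
    show ?thesis using N.finite_quotient carrier_Mod by simp
  qed
  have kerM: "M #> x = M \<longleftrightarrow> x \<in> M" if "open_normal G T M" "x \<in> H" for M x
  proof -
    interpret M: open_quotient G T M using that(1) by (rule open_quotientI)
    show ?thesis using M.proj_eq_one_iff that(2) subgroup.mem_carrier[OF sH] by simp
  qed
  show ?thesis
  proof
    assume pro: "pro_p_group p ?H ?TH"
    show "\<forall>M. open_normal G T M \<longrightarrow> p_subgroup p (G Mod M) (r_coset G M ` H)"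
    proof (intro allI impI)
      fix M assume M: "open_normal G T M"
      interpret \<phi>: group_hom ?H "G Mod M" "r_coset G M" using sH M by (rule restricted_projection_hom)
      let ?N = "H \<inter> M"
      have N: "open_normal ?H ?TH ?N" using sH M by (rule subgroup_Int_open_normal)
      then obtain k where k: "card (r_coset ?H ?N ` H) = p ^ k"
        using pro by (auto simp: pro_p_group_def open_normal_def order_def carrier_Mod)
      have "card (r_coset G M ` H) * card (r_coset ?H ?N ` {g \<in> H. M #> g = \<one>\<^bsub>G Mod M\<^esub>})
          = card (r_coset ?H ?N ` H)"
      proof (rule H.card_hom_image_mult[OF sHH \<phi>.group_hom_axioms homN[OF N] _ finN[OF N]])
        fix g assume g: "g \<in> H" "r_coset ?H ?N g = \<one>\<^bsub>?H Mod ?N\<^esub>"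
        from g(2) have "g \<in> ?N" unfolding one_FactGroup kerN[OF N g(1)] .
        then have "g \<in> M" by (rule IntD2)
        then show "M #> g = \<one>\<^bsub>G Mod M\<^esub>" unfolding one_FactGroup kerM[OF M g(1)] .
      qed
      from dvdI[OF this[symmetric]] have "card (r_coset G M ` H) dvd p ^ k" unfolding k .
      then have "\<exists>j. card (r_coset G M ` H) = p ^ j"
        using divides_primepow_nat[OF p] by blast
      then show "p_subgroup p (G Mod M) (r_coset G M ` H)"
        using \<phi>.subgroup_img_is_subgroup[OF sHH] by (simp add: p_subgroup_def)
    qed
  next
    assume R: "\<forall>M. open_normal G T M \<longrightarrow> p_subgroup p (G Mod M) (r_coset G M ` H)"
    show "pro_p_group p ?H ?TH"
      unfolding pro_p_group_def
    proof (intro conjI allI impI)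
      fix N assume "N \<lhd> ?H \<and> openin ?TH N"
      then have N: "open_normal ?H ?TH N" by (simp add: open_normal_def)
      obtain U where U: "openin T U" "N = U \<inter> H"
        using N by (auto simp: open_normal_def openin_subtopology)
      have "\<one> \<in> U" using subgroup.one_closed[OF open_normal_subgroup[OF N]] U(2) by simp
      then obtain M where M: "open_normal G T M" "M \<subseteq> U" using ex_open_normal[OF U(1)] by blast
      interpret \<phi>: group_hom ?H "G Mod M" "r_coset G M" using sH M(1) by (rule restricted_projection_hom)
      obtain k where k: "card (r_coset G M ` H) = p ^ k"
        using R M(1) by (auto simp: p_subgroup_def)
      then have fin: "finite (r_coset G M ` H)" using prime_gt_0_nat[OF p] by (intro card_ge_0_finite) simp
      have "card (r_coset ?H N ` H) * card (r_coset G M ` {g \<in> H. r_coset ?H N g = \<one>\<^bsub>?H Mod N\<^esub>})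
          = card (r_coset G M ` H)"
      proof (rule H.card_hom_image_mult[OF sHH homN[OF N] \<phi>.group_hom_axioms _ fin])
        fix g assume g: "g \<in> H" "M #> g = \<one>\<^bsub>G Mod M\<^esub>"
        from g(2) have "g \<in> M" unfolding one_FactGroup kerM[OF M(1) g(1)] .
        then have "g \<in> N" using g(1) M(2) U(2) by blast
        then show "r_coset ?H N g = \<one>\<^bsub>?H Mod N\<^esub>" unfolding one_FactGroup kerN[OF N g(1)] .
      qed
      from dvdI[OF this[symmetric]] have "card (r_coset ?H N ` H) dvd p ^ k" unfolding k .
      then have "\<exists>j. card (r_coset ?H N ` H) = p ^ j"
        using divides_primepow_nat[OF p] by blast
      then show "\<exists>k. order (?H Mod N) = p ^ k" by (simp add: order_def carrier_Mod)
    qed (rule H.profinite_group_axioms)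
  qed
qed

text \<open>The index of the image of \<open>P\<close> equals the index of its full preimage
  \<open>U\<close>, an open subgroup that contains \<open>P\<close>. So it is prime to
  \<open>p\<close>.\<close>

lemma sylow_subgroup_quotient:
  assumes P: "sylow_subgroup p G T P" and p: "prime p" and M: "open_normal G T M"
  shows "maximal_p_subgroup p (G Mod M) (carrier (G Mod M)) (r_coset G M ` P)"
proof -
  interpret open_quotient G T M using M by (rule open_quotientI)
  let ?P = "r_coset G M ` P"
  have clP: "closed_subgroup G T P" using P by (simp add: sylow_subgroup_def closed_pro_p_subgroup_def)
  then have sP: "subgroup P G" by (simp add: closed_subgroup_def)
  have Pc: "P \<subseteq> carrier G" using sP by (rule subgroup.subset)
  have pP: "p_subgroup p (G Mod M) ?P"
    using P M pro_p_group_iff[OF clP p] by (simp add: sylow_subgroup_def closed_pro_p_subgroup_def)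
  then have sPM: "subgroup ?P (G Mod M)" by (simp add: p_subgroup_def)
  define U where "U = {x \<in> carrier G. M #> x \<in> ?P}"
  have sU: "subgroup U G" unfolding U_def using sPM by (rule proj.subgroup_preimage)
  have Uc: "U \<subseteq> carrier G" by (auto simp: U_def)
  have PU: "P \<subseteq> U" using Pc by (auto simp: U_def)
  have img: "r_coset G M ` U = ?P" using PU by (auto simp: U_def)
  have "openin T U" unfolding U_def by (rule openin_saturated)
  then have cop: "coprime p (card (rcosets U))"
    using P sU PU by (simp add: sylow_subgroup_def)
  have coset: "r_coset G M ` (U #> x) = ?P #>\<^bsub>G Mod M\<^esub> (M #> x)" if x: "x \<in> carrier G" for x
  proof -
    have "U #> x = (\<lambda>u. u \<otimes> x) ` U" by (auto simp: r_coset_def)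
    then have "r_coset G M ` (U #> x) = (\<lambda>u. M #> (u \<otimes> x)) ` U" by (simp add: image_image)
    also have "\<dots> = (\<lambda>u. (M #> u) \<otimes>\<^bsub>G Mod M\<^esub> (M #> x)) ` U"
      using proj.hom_mult[OF _ x] Uc by (intro image_cong) auto
    also have "\<dots> = (\<lambda>d. d \<otimes>\<^bsub>G Mod M\<^esub> (M #> x)) ` ?P"
      unfolding img[symmetric] by (simp add: image_image)
    also have "\<dots> = ?P #>\<^bsub>G Mod M\<^esub> (M #> x)" by (auto simp: r_coset_def[of "G Mod M"])
    finally show ?thesis .
  qed
  have "image (r_coset G M) ` (rcosets U) = rcosets\<^bsub>G Mod M\<^esub> ?P"
  proof
    show "image (r_coset G M) ` (rcosets U) \<subseteq> rcosets\<^bsub>G Mod M\<^esub> ?P"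
    proof (rule image_subsetI)
      fix C assume "C \<in> rcosets U"
      then obtain x where x: "x \<in> carrier G" "C = U #> x" by (auto simp: RCOSETS_def)
      then show "r_coset G M ` C \<in> rcosets\<^bsub>G Mod M\<^esub> ?P"
        using coset[OF x(1)] proj.hom_closed[OF x(1)] unfolding RCOSETS_def[of "G Mod M"] by auto
    qed
    show "rcosets\<^bsub>G Mod M\<^esub> ?P \<subseteq> image (r_coset G M) ` (rcosets U)"
    proof
      fix D assume "D \<in> rcosets\<^bsub>G Mod M\<^esub> ?P"
      then obtain c where c: "c \<in> carrier (G Mod M)" "D = ?P #>\<^bsub>G Mod M\<^esub> c"
        unfolding RCOSETS_def[of "G Mod M"] by auto
      obtain x where x: "x \<in> carrier G" "c = M #> x" using quotient_cases[OF c(1)] by blast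
      have "U #> x \<in> rcosets U" using x(1) by (auto simp: RCOSETS_def)
      moreover have "D = r_coset G M ` (U #> x)" using coset[OF x(1)] c(2) x(2) by simp
      ultimately show "D \<in> image (r_coset G M) ` (rcosets U)" by blast
    qed
  qed
  moreover have "inj_on (image (r_coset G M)) (rcosets U)"
  proof (rule inj_onI)
    fix C D assume "C \<in> rcosets U" "D \<in> rcosets U" and eq: "r_coset G M ` C = r_coset G M ` D"
    then obtain x y where x: "x \<in> carrier G" "C = U #> x" and y: "y \<in> carrier G" "D = U #> y"
      by (auto simp: RCOSETS_def)
    have "?P #>\<^bsub>G Mod M\<^esub> (M #> x) = ?P #>\<^bsub>G Mod M\<^esub> (M #> y)"
      using eq coset x y by simp
    then have "(M #> x) \<otimes>\<^bsub>G Mod M\<^esub> inv\<^bsub>G Mod M\<^esub> (M #> y) \<in> ?P"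
      using proj.H.r_coset_eq_iff[OF sPM] x(1) y(1) proj.hom_closed by blast
    moreover have "(M #> x) \<otimes>\<^bsub>G Mod M\<^esub> inv\<^bsub>G Mod M\<^esub> (M #> y) = M #> (x \<otimes> inv y)"
      using proj.hom_mult[OF x(1) inv_closed[OF y(1)]] proj.hom_inv[OF y(1)] by simp
    ultimately have "x \<otimes> inv y \<in> U" using x(1) y(1) by (simp add: U_def)
    then show "C = D" using r_coset_eq_iff[OF sU x(1) y(1)] x(2) y(2) by simp
  qed
  ultimately have card: "card (rcosets\<^bsub>G Mod M\<^esub> ?P) = card (rcosets U)"
    using card_image by fastforce
  have Psub: "?P \<subseteq> carrier (G Mod M)" using sPM by (rule subgroup.subset)
  \<comment> \<open>\<open>sylow_subgroup\<close> counts right cosets and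
    \<open>maximal_if_index_coprime\<close> left cosets; by Lagrange's theorem the numbers
    agree.\<close>
  have "card ((\<lambda>g. g <#\<^bsub>G Mod M\<^esub> ?P) ` carrier (G Mod M)) * card ?P = card (carrier (G Mod M))"
    using proj.H.card_l_cosets[OF proj.H.subgroup_self sPM Psub finite_quotient] .
  moreover have "card (rcosets\<^bsub>G Mod M\<^esub> ?P) * card ?P = card (carrier (G Mod M))"
    using proj.H.lagrange[OF sPM] by (simp add: order_def)
  moreover have "card ?P \<noteq> 0"
    using finite_subset[OF Psub finite_quotient] subgroup.one_closed[OF sPM] by auto
  ultimately have "card ((\<lambda>g. g <#\<^bsub>G Mod M\<^esub> ?P) ` carrier (G Mod M)) = card (rcosets U)"
    unfolding card[symmetric] by (metis mult_right_cancel)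
  then have "\<not> p dvd card ((\<lambda>g. g <#\<^bsub>G Mod M\<^esub> ?P) ` carrier (G Mod M))"
    using cop p by (auto simp: coprime_absorb_left)
  then show ?thesis
    using proj.H.maximal_if_index_coprime[OF proj.H.subgroup_self finite_quotient p pP Psub] by blast
qed

end

lemma (in profinite_group) closed_subgroup_closed_generate:
  assumes "X \<subseteq> carrier G"
  shows "closed_subgroup G T (closed_generate G T X)" "X \<subseteq> closed_generate G T X"
proof -
  let ?S = "{H. closed_subgroup G T H \<and> X \<subseteq> H}"
  have "carrier G \<in> ?S"
    using assms subgroup_self closedin_topspace[of T] by (auto simp: closed_subgroup_def topspace_eq)
  then have "?S \<noteq> {}" by blast
  then show "closed_subgroup G T (closed_generate G T X)"
    unfolding closed_generate_def closed_subgroup_def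
    by (intro conjI subgroups_Inter closedin_Inter) (auto simp: closed_subgroup_def)
  show "X \<subseteq> closed_generate G T X" by (auto simp: closed_generate_def)
qed

section \<open>Nilpotentizers and Haar measure in a finite quotient\<close>

context open_quotient
begin

text \<open>The image of the pronilpotent group \<open>K\<close> in \<open>G Mod M\<close> is also
  the image of the finite nilpotent group \<open>?Q\<close> under the induced map \<open>f\<close>.
  Both conclusions are proved in \<open>?Q\<close> and carried over by \<open>f\<close>.\<close>

lemma nilpotentizer_quotient:
  fixes p i :: nat
  assumes p: "prime p" and x: "x \<in> carrier G" and xp: "(M #> x) [^]\<^bsub>G Mod M\<^esub> (p ^ i) = \<one>\<^bsub>G Mod M\<^esub>"
    and y: "y \<in> nilpotentizer G T x"
  shows "\<exists>A. p_subgroup p (G Mod M) A \<and> M #> x \<in> A \<and> conjugate (G Mod M) (M #> y) A = A"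
    and "\<exists>u z k. u \<in> carrier (G Mod M) \<and> z \<in> carrier (G Mod M) \<and> M #> y = u \<otimes>\<^bsub>G Mod M\<^esub> z
      \<and> u [^]\<^bsub>G Mod M\<^esub> (p ^ k) = \<one>\<^bsub>G Mod M\<^esub> \<and> z \<otimes>\<^bsub>G Mod M\<^esub> (M #> x) = (M #> x) \<otimes>\<^bsub>G Mod M\<^esub> z"
proof -
  define K where "K = closed_generate G T {x, y}"
  let ?K = "G\<lparr>carrier := K\<rparr>" and ?N = "K \<inter> M"
  have yc: "y \<in> carrier G" using y by (simp add: nilpotentizer_def)
  have K: "closed_subgroup G T K" "x \<in> K" "y \<in> K"
    using closed_subgroup_closed_generate[of "{x, y}"] x yc by (auto simp: K_def)
  then have sK: "subgroup K G" by (simp add: closed_subgroup_def)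
  interpret K: profinite_group ?K "subtopology T K" using K(1) by (rule profinite_closed_subgroup)
  have N: "open_normal ?K (subtopology T K) ?N"
    using sK open_normal by (rule subgroup_Int_open_normal)
  interpret KN: open_quotient ?K "subtopology T K" ?N using N by (rule K.open_quotientI)
  interpret KM: group_hom ?K "G Mod M" "r_coset G M"
    using sK open_normal by (rule restricted_projection_hom)
  let ?Q = "?K Mod ?N" and ?q = "r_coset ?K ?N"
  have nil: "nilpotent_group ?Q"
    using y N by (auto simp: nilpotentizer_def pronilpotent_group_def K_def open_normal_def)
  have xK: "x \<in> carrier ?K" and yK: "y \<in> carrier ?K" using K by auto
  have "?q x [^]\<^bsub>?Q\<^esub> (p ^ i) = \<one>\<^bsub>?Q\<^esub>"
  proof -
    have "M #> (x [^] (p ^ i)) = \<one>\<^bsub>G Mod M\<^esub>" using FactGroup_pow[OF x] xp by simp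
    then have "x [^] (p ^ i) \<in> M" using proj_eq_one_iff[of "x [^] (p ^ i)"] x by simp
    moreover have "x [^] (p ^ i) = x [^]\<^bsub>?K\<^esub> (p ^ i)" by (rule nat_pow_consistent)
    moreover have "x [^]\<^bsub>?K\<^esub> (p ^ i) \<in> carrier ?K" using xK by (rule K.nat_pow_closed)
    ultimately have "?q (x [^]\<^bsub>?K\<^esub> (p ^ i)) = ?N" using KN.proj_eq_one_iff by auto
    then show ?thesis using KN.FactGroup_pow[OF xK] by simp
  qed
  moreover have xQ: "?q x \<in> carrier ?Q" and yQ: "?q y \<in> carrier ?Q"
    using KN.proj.hom_closed xK yK by auto
  ultimately have R: "\<exists>A. p_subgroup p ?Q A \<and> ?q x \<in> A \<and> conjugate ?Q (?q y) A = A"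
    "\<exists>u z k. u \<in> carrier ?Q \<and> z \<in> carrier ?Q \<and> ?q y = u \<otimes>\<^bsub>?Q\<^esub> z \<and> u [^]\<^bsub>?Q\<^esub> (p ^ k) = \<one>\<^bsub>?Q\<^esub>
      \<and> z \<otimes>\<^bsub>?Q\<^esub> ?q x = ?q x \<otimes>\<^bsub>?Q\<^esub> z"
    using nilpotent_p_element[OF nil KN.finite_quotient p] by metis+
  have "M #> a = M #> b" if ab: "a \<in> carrier ?K" "b \<in> carrier ?K" "?q a = ?q b" for a b
  proof -
    have ab': "a \<in> carrier G" "b \<in> carrier G" using ab subgroup.mem_carrier[OF sK] by auto
    have "a \<otimes>\<^bsub>?K\<^esub> inv\<^bsub>?K\<^esub> b \<in> ?N" using KN.proj_eq_iff ab by blast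
    then have "a \<otimes> inv b \<in> M" using m_inv_consistent[OF sK] ab(2) by simp
    then show ?thesis using proj_eq_iff[OF ab'] by simp
  qed
  then obtain f where f: "f \<in> hom ?Q (G Mod M)" "\<And>a. a \<in> carrier ?K \<Longrightarrow> f (?q a) = M #> a"
    using FactGroup_universal[OF KM.homh KN.normal_axioms] by metis
  interpret f: group_hom ?Q "G Mod M" f
    using f(1) KN.factorgroup_is_group factorgroup_is_group by (intro group_hom.intro group_hom_axioms.intro)
  obtain A where A: "p_subgroup p ?Q A" "?q x \<in> A" "conjugate ?Q (?q y) A = A" using R(1) by blast
  have Ac: "A \<subseteq> carrier ?Q" using A(1) by (auto simp: p_subgroup_def dest: subgroup.subset)
  have "p_subgroup p (G Mod M) (f ` A)"
    using A(1) f.group_hom_axioms p finite_subset[OF Ac KN.finite_quotient] by (rule KN.proj.H.p_subgroup_image)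
  moreover have "M #> x \<in> f ` A" using f(2)[OF xK] A(2) by (metis image_eqI)
  moreover have "conjugate (G Mod M) (M #> y) (f ` A) = f ` A"
    using f.conjugate_image[OF yQ Ac] A(3) f(2)[OF yK] by simp
  ultimately show "\<exists>A. p_subgroup p (G Mod M) A \<and> M #> x \<in> A \<and> conjugate (G Mod M) (M #> y) A = A"
    by blast
  obtain u z k where uz: "u \<in> carrier ?Q" "z \<in> carrier ?Q" "?q y = u \<otimes>\<^bsub>?Q\<^esub> z"
    "u [^]\<^bsub>?Q\<^esub> (p ^ k) = \<one>\<^bsub>?Q\<^esub>" "z \<otimes>\<^bsub>?Q\<^esub> ?q x = ?q x \<otimes>\<^bsub>?Q\<^esub> z"
    using R(2) by blast
  have "M #> y = f u \<otimes>\<^bsub>G Mod M\<^esub> f z"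
    using f.hom_mult[OF uz(1,2)] uz(3) f(2)[OF yK] by simp
  moreover have "f u [^]\<^bsub>G Mod M\<^esub> (p ^ k) = \<one>\<^bsub>G Mod M\<^esub>"
    using f.hom_nat_pow[OF uz(1), of "p ^ k"] uz(4) f.hom_one by simp
  moreover have "f z \<otimes>\<^bsub>G Mod M\<^esub> (M #> x) = (M #> x) \<otimes>\<^bsub>G Mod M\<^esub> f z"
    using f.hom_mult[OF uz(2) xQ] f.hom_mult[OF xQ uz(2)] uz(5) f(2)[OF xK] by simp
  ultimately show "\<exists>u z k. u \<in> carrier (G Mod M) \<and> z \<in> carrier (G Mod M) \<and> M #> y = u \<otimes>\<^bsub>G Mod M\<^esub> z
      \<and> u [^]\<^bsub>G Mod M\<^esub> (p ^ k) = \<one>\<^bsub>G Mod M\<^esub> \<and> z \<otimes>\<^bsub>G Mod M\<^esub> (M #> x) = (M #> x) \<otimes>\<^bsub>G Mod M\<^esub> z"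
    using f.hom_closed uz(1,2) by blast
qed

text \<open>By translation invariance the cosets of \<open>M\<close> share the total mass equally,
  and \<open>S\<close> is covered by the cosets that it meets.\<close>

lemma haar_measure_le:
  assumes \<mu>: "normalized_haar_measure G T \<mu>" and S: "S \<subseteq> carrier G"
  shows "measure \<mu> S * card (carrier (G Mod M)) \<le> card (r_coset G M ` S)"
proof (cases "S \<in> sets \<mu>")
  case False \<comment> \<open>then \<open>measure \<mu> S = 0\<close>\<close>
  then show ?thesis by (simp add: measure_notin_sets)
next
  case True
  have space: "space \<mu> = carrier G" using \<mu> by (simp add: normalized_haar_measure_def topspace_eq)
  have "emeasure \<mu> (space \<mu>) = 1" using \<mu> unfolding normalized_haar_measure_def by (elim conjE)
  then interpret finite_measure \<mu> by (intro finite_measureI) simp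
  have sets: "U \<in> sets \<mu>" if "openin T U" for U
    using \<mu> that by (auto simp: normalized_haar_measure_def intro: sigma_sets.Basic)
  have Mopen: "openin T M" using open_normal by (simp add: open_normal_def)
  have cosetM: "M #> g = g <#\<^bsub>G\<^esub> M" if "g \<in> carrier G" for g
    using coset_eq that by simp
  have coset_sets: "C \<in> sets \<mu>" if C: "C \<in> carrier (G Mod M)" for C
  proof -
    obtain g where "g \<in> carrier G" "C = M #> g" using quotient_cases[OF C] by blast
    then show ?thesis using openin_r_coset Mopen sets by blast
  qed
  have meas: "measure \<mu> C = measure \<mu> M" if C: "C \<in> carrier (G Mod M)" for C
  proof -
    obtain g where g: "g \<in> carrier G" "C = g <#\<^bsub>G\<^esub> M" using quotient_cases[OF C] cosetM by metis
    then have "emeasure \<mu> C = emeasure \<mu> M"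
      using \<mu> sets[OF Mopen] by (simp add: normalized_haar_measure_def)
    then show ?thesis by (simp add: measure_def)
  qed
  have union: "\<Union>(carrier (G Mod M)) = carrier G"
    using rcosets_part_G[OF is_subgroup] by (simp add: FactGroup_def)
  have disj: "disjoint_family_on (\<lambda>C. C) (carrier (G Mod M))"
    using rcos_disjoint[OF is_subgroup]
    by (auto simp: FactGroup_def disjoint_family_on_def pairwise_def disjnt_def)
  have "measure \<mu> (\<Union>C\<in>carrier (G Mod M). C) = (\<Sum>C\<in>carrier (G Mod M). measure \<mu> C)"
    using coset_sets disj finite_quotient by (intro finite_measure_finite_Union) auto
  then have "measure \<mu> (space \<mu>) = card (carrier (G Mod M)) * measure \<mu> M"
    using meas union space by simp
  moreover have "measure \<mu> (space \<mu>) = 1"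
    using \<open>emeasure \<mu> (space \<mu>) = 1\<close> by (simp add: measure_def)
  ultimately have one: "card (carrier (G Mod M)) * measure \<mu> M = 1" by simp
  have fin: "finite (r_coset G M ` S)"
    using S surj_proj by (intro finite_subset[OF _ finite_quotient]) blast
  have sub: "r_coset G M ` S \<subseteq> carrier (G Mod M)" using S surj_proj by blast
  have "S \<subseteq> (\<Union>C\<in>r_coset G M ` S. C)" using S rcos_self[OF _ is_subgroup] by blast
  then have "measure \<mu> S \<le> measure \<mu> (\<Union>C\<in>r_coset G M ` S. C)"
    using True sub coset_sets fin by (intro finite_measure_mono) auto
  also have "\<dots> \<le> (\<Sum>C\<in>r_coset G M ` S. measure \<mu> C)"
    using sub coset_sets fin by (intro finite_measure_subadditive_finite) auto
  also have "\<dots> = card (r_coset G M ` S) * measure \<mu> M"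
    using meas sub by (subst sum.cong[OF refl meas]) auto
  finally have "measure \<mu> S * card (carrier (G Mod M))
      \<le> card (r_coset G M ` S) * measure \<mu> M * card (carrier (G Mod M))"
    by (intro mult_right_mono) auto
  also have "\<dots> = card (r_coset G M ` S)" using one by (simp add: ac_simps)
  finally show ?thesis .
qed

end

section \<open>Nilpotentizers of positive measure\<close>

text \<open>Double counting. At least \<open>card X * card F / n\<close> pairs are related. The
  \<open>t\<close> outside the set on the right account for at most half of that number, so the set
  itself carries the other half.\<close>

lemma popular_elements:
  fixes n :: nat
  assumes finF: "finite F" and finX: "finite X" and X: "X \<noteq> {}"
    and many: "\<And>x. x \<in> X \<Longrightarrow> card F \<le> n * card {t \<in> F. R x t}"
  shows "card F \<le> 2 * n * card {t \<in> F. card X \<le> 2 * n * card {x \<in> X. R x t}}"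
proof -
  let ?B = "{t \<in> F. card X \<le> 2 * n * card {x \<in> X. R x t}}"
  have swap: "(\<Sum>x\<in>X. card {t \<in> F. R x t}) = (\<Sum>t\<in>F. card {x \<in> X. R x t})"
  proof -
    have "(\<Sum>x\<in>X. card {t \<in> F. R x t}) = (\<Sum>x\<in>X. \<Sum>t\<in>F. if R x t then 1 else 0)"
      using finF by (intro sum.cong) (auto simp: sum.inter_filter[symmetric])
    also have "\<dots> = (\<Sum>t\<in>F. \<Sum>x\<in>X. if R x t then 1 else 0)" by (rule sum.swap)
    also have "\<dots> = (\<Sum>t\<in>F. card {x \<in> X. R x t})"
      using finX by (intro sum.cong) (auto simp: sum.inter_filter[symmetric])
    finally show ?thesis .
  qed
  \<comment> \<open>All degrees are multiplied by \<open>2 * n\<close>, which keeps the halves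
    within the natural numbers.\<close>
  have bound: "2 * n * card {x \<in> X. R x t} \<le> (if t \<in> ?B then 2 * n * card X else card X)" if "t \<in> F" for t
    using that finX card_mono[OF finX, of "{x \<in> X. R x t}"] by auto
  have "card X * card F * 2 = (\<Sum>x\<in>X. card F) * 2" by simp
  also have "\<dots> \<le> (\<Sum>x\<in>X. n * card {t \<in> F. R x t}) * 2"
    using many by (intro mult_right_mono sum_mono) auto
  also have "\<dots> = 2 * n * (\<Sum>t\<in>F. card {x \<in> X. R x t})"
    by (simp add: sum_distrib_left[symmetric] swap)
  also have "\<dots> = (\<Sum>t\<in>F. 2 * n * card {x \<in> X. R x t})" by (rule sum_distrib_left)
  also have "\<dots> \<le> (\<Sum>t\<in>F. if t \<in> ?B then 2 * n * card X else card X)"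
    using bound by (intro sum_mono)
  also have "\<dots> = (\<Sum>t\<in>F - ?B. if t \<in> ?B then 2 * n * card X else card X)
      + (\<Sum>t\<in>?B. if t \<in> ?B then 2 * n * card X else card X)"
    by (rule sum.subset_diff[OF _ finF]) (rule Collect_restrict)
  also have "(\<Sum>t\<in>F - ?B. if t \<in> ?B then 2 * n * card X else card X) = (\<Sum>t\<in>F - ?B. card X)"
    by (rule sum.cong[OF refl]) (simp only: Diff_iff if_False)
  also have "(\<Sum>t\<in>?B. if t \<in> ?B then 2 * n * card X else card X) = (\<Sum>t\<in>?B. 2 * n * card X)"
    by (rule sum.cong[OF refl]) (simp only: if_True)
  also have "(\<Sum>t\<in>F - ?B. card X) \<le> card F * card X"
    using card_mono[OF finF, of "F - ?B"] by simp
  finally have "card X * card F * 2 \<le> card F * card X + card ?B * (2 * n * card X)"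
    by (simp only: sum_constant of_nat_id)
  then have "card X * card F \<le> card X * (2 * n * card ?B)" by (simp add: ac_simps)
  moreover have "0 < card X" using X finX by (simp add: card_gt_0_iff)
  ultimately show ?thesis by simp
qed

locale positive_nilpotentizers = profinite_group G T for G (structure) and T +
  fixes \<mu> :: "'a measure" and p :: nat and P :: "'a set"
  assumes haar: "normalized_haar_measure G T \<mu>" and p: "prime p"
    and sylow: "sylow_subgroup p G T P"
    and positive: "\<And>g. g \<in> P \<Longrightarrow> measure \<mu> (nilpotentizer G T g) > 0"
begin

lemma P_closed_subgroup: "closed_subgroup G T P" "closedin T P" "subgroup P G" "P \<subseteq> carrier G"
  using sylow subgroup.subset[of P G]
  by (auto simp: sylow_subgroup_def closed_pro_p_subgroup_def closed_subgroup_def)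

abbreviation Q where "Q M \<equiv> G Mod M"
abbreviation PQ where "PQ M \<equiv> r_coset G M ` P"

lemma PQ_maximal: "open_normal G T M \<Longrightarrow> maximal_p_subgroup p (Q M) (carrier (Q M)) (PQ M)"
  using sylow p by (rule sylow_subgroup_quotient)

lemma PQ_p_subgroup:
  assumes "open_normal G T M"
  shows "p_subgroup p (Q M) (PQ M)" "subgroup (PQ M) (Q M)" "PQ M \<subseteq> carrier (Q M)"
  using PQ_maximal[OF assms] by (auto simp: maximal_p_subgroup_def p_subgroup_def)

lemma finite_PQ: "open_normal G T M \<Longrightarrow> finite (PQ M)"
  by (rule finite_subset[OF PQ_p_subgroup(3) open_quotient.finite_quotient[OF open_quotientI]])

text \<open>Counts conjugating elements and not conjugates, in accordance with Casolo's
  formula.\<close>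

definition conj_count where
  "conj_count M c = card {t \<in> carrier (Q M). c \<in> conjugate (Q M) t (PQ M)}"

lemma PQ_p_power:
  assumes M: "open_normal G T M" and x: "x \<in> P"
  shows "\<exists>i. (M #> x) [^]\<^bsub>Q M\<^esub> (p ^ i) = \<one>\<^bsub>Q M\<^esub>"
proof -
  interpret open_quotient G T M using M by (rule open_quotientI)
  interpret S: group "Q M\<lparr>carrier := PQ M\<rparr>"
    using proj.H.subgroup_imp_group PQ_p_subgroup(2)[OF M] by blast
  obtain i where i: "card (PQ M) = p ^ i"
    using PQ_p_subgroup(1)[OF M] by (auto simp: p_subgroup_def)
  have "M #> x \<in> carrier (Q M\<lparr>carrier := PQ M\<rparr>)" using x by simp
  from S.pow_order_eq_1[OF this] have "(M #> x) [^]\<^bsub>Q M\<lparr>carrier := PQ M\<rparr>\<^esub> (p ^ i) = \<one>\<^bsub>Q M\<^esub>"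
    using i by (simp add: order_def)
  moreover have "(M #> x) [^]\<^bsub>Q M\<lparr>carrier := PQ M\<rparr>\<^esub> (p ^ i) = (M #> x) [^]\<^bsub>Q M\<^esub> (p ^ i)"
    by (rule proj.H.nat_pow_consistent[symmetric])
  ultimately have "(M #> x) [^]\<^bsub>Q M\<^esub> (p ^ i) = \<one>\<^bsub>Q M\<^esub>" by (rule subst[rotated])
  then show ?thesis by blast
qed

text \<open>Modulo \<open>M\<close> an element of the nilpotentizer normalizes a
  \<open>p\<close>-subgroup that contains the image of \<open>x\<close>, so it lies in the
  subnormalizer of the cyclic \<open>p\<close>-subgroup \<open>?H\<close>. Casolo's formula gives
  the order of that subnormalizer.\<close>

lemma card_nilpotentizer_le:
  assumes M: "open_normal G T M" and x: "x \<in> P"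
  shows "card (r_coset G M ` nilpotentizer G T x) \<le> conj_count M (M #> x)"
proof -
  interpret open_quotient G T M using M by (rule open_quotientI)
  have xc: "x \<in> carrier G" using x P_closed_subgroup(4) by blast
  have xQ: "M #> x \<in> carrier (Q M)" using xc by (rule proj.hom_closed)
  obtain i where i: "(M #> x) [^]\<^bsub>Q M\<^esub> (p ^ i) = \<one>\<^bsub>Q M\<^esub>" using PQ_p_power[OF M x] by blast
  let ?H = "generate (Q M) {M #> x}"
  have H: "p_subgroup p (Q M) ?H"
    using finite_quotient p xQ i by (rule proj.H.p_subgroup_generate)
  have H_sub: "?H \<subseteq> A \<longleftrightarrow> M #> x \<in> A" if "subgroup A (Q M)" for A
    using proj.H.generate_subgroup_incl[OF _ that, of "{M #> x}"] generate.incl[of "M #> x" "{M #> x}" "Q M"]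
    by auto
  have "r_coset G M ` nilpotentizer G T x \<subseteq> subnormalizer p (Q M) (carrier (Q M)) ?H"
  proof (rule image_subsetI)
    fix y assume y: "y \<in> nilpotentizer G T x"
    then have "M #> y \<in> carrier (Q M)" by (auto simp: nilpotentizer_def)
    moreover obtain A where A: "p_subgroup p (Q M) A" "M #> x \<in> A" "conjugate (Q M) (M #> y) A = A"
      using nilpotentizer_quotient(1)[OF p xc i y] by blast
    moreover have "subgroup A (Q M)" using A(1) by (simp add: p_subgroup_def)
    ultimately show "M #> y \<in> subnormalizer p (Q M) (carrier (Q M)) ?H"
      using H_sub subgroup.subset[of A "Q M"] by (auto simp: subnormalizer_def)
  qed
  then have "card (r_coset G M ` nilpotentizer G T x) \<le> card (subnormalizer p (Q M) (carrier (Q M)) ?H)"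
    using finite_quotient by (intro card_mono) (auto simp: subnormalizer_def)
  also have "\<dots> = card {t \<in> carrier (Q M). ?H \<subseteq> conjugate (Q M) t (PQ M)}"
    using finite_quotient p PQ_maximal[OF M] H by (rule proj.H.card_subnormalizer_eq)
  also have "{t \<in> carrier (Q M). ?H \<subseteq> conjugate (Q M) t (PQ M)}
      = {t \<in> carrier (Q M). M #> x \<in> conjugate (Q M) t (PQ M)}"
    using H_sub proj.H.conjugate_subgroup[OF _ PQ_p_subgroup(2)[OF M]] by blast
  finally show ?thesis by (simp add: conj_count_def)
qed

text \<open>Any \<open>n\<close> above the reciprocal of the measure works. It comes from the
  measure alone and so serves all \<open>M\<close>.\<close>

lemma ex_nilpotentizer_bound:
  assumes x: "x \<in> P"
  shows "\<exists>n. \<forall>M. open_normal G T M \<longrightarrow> card (carrier (Q M)) \<le> n * card (r_coset G M ` nilpotentizer G T x)"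
proof -
  let ?e = "measure \<mu> (nilpotentizer G T x)"
  obtain n where n: "1 / ?e \<le> real n" using real_arch_simple by blast
  have "card (carrier (Q M)) \<le> n * card (r_coset G M ` nilpotentizer G T x)" if M: "open_normal G T M" for M
  proof -
    interpret open_quotient G T M using M by (rule open_quotientI)
    have "?e * card (carrier (Q M)) \<le> card (r_coset G M ` nilpotentizer G T x)"
      by (rule haar_measure_le[OF haar]) (auto simp: nilpotentizer_def)
    then have "card (carrier (Q M)) \<le> 1 / ?e * card (r_coset G M ` nilpotentizer G T x)"
      using positive[OF x] by (simp add: field_simps)
    also have "\<dots> \<le> real n * card (r_coset G M ` nilpotentizer G T x)"
      using n by (intro mult_right_mono) auto
    finally show ?thesis by (simp flip: of_nat_mult)
  qed
  then show ?thesis by blast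
qed

text \<open>The sets \<open>E n\<close> of those \<open>x\<close> in \<open>P\<close> for which
  \<open>n\<close> works modulo every \<open>M\<close> are closed and cover \<open>P\<close>, so by
  Baire's theorem one of them has an interior point \<open>g\<close> in \<open>P\<close>. The bound
  thereby becomes uniform in \<open>x\<close>, as the double counting over a coset requires.\<close>

lemma ex_uniform_coset:
  obtains n g M0 where "g \<in> P" "open_normal G T M0"
    "\<And>x M. x \<in> P \<Longrightarrow> M0 #> x = M0 #> g \<Longrightarrow> open_normal G T M
      \<Longrightarrow> card (carrier (Q M)) \<le> n * conj_count M (M #> x)"
proof -
  define E where "E n = P \<inter> (\<Inter>M\<in>{M. open_normal G T M}.
    {x \<in> carrier G. card (carrier (Q M)) \<le> n * conj_count M (M #> x)})" for n
  let ?X = "subtopology T P"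
  have topX: "topspace ?X = P" using P_closed_subgroup(4) by (auto simp: topspace_eq)
  have closedE: "closedin ?X (E n)" for n
  proof -
    have "closedin T {x \<in> carrier G. card (carrier (Q M)) \<le> n * conj_count M (M #> x)}"
      if "open_normal G T M" for M
    proof -
      interpret open_quotient G T M using that by (rule open_quotientI)
      show ?thesis by (rule closedin_saturated)
    qed
    then have "closedin T (E n)"
      unfolding E_def using P_closed_subgroup(2) open_normal_carrier
      by (intro closedin_Int closedin_INT) auto
    then show ?thesis
      using closedin_closed_subtopology[OF P_closed_subgroup(2)] by (auto simp: E_def)
  qed
  have cover: "P \<subseteq> \<Union>(range E)"
  proof
    fix x assume x: "x \<in> P"
    obtain n where n: "\<forall>M. open_normal G T M \<longrightarrow> card (carrier (Q M)) \<le> n * card (r_coset G M ` nilpotentizer G T x)"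
      using ex_nilpotentizer_bound[OF x] by blast
    have "card (carrier (Q M)) \<le> n * conj_count M (M #> x)" if M: "open_normal G T M" for M
    proof -
      have "card (carrier (Q M)) \<le> n * card (r_coset G M ` nilpotentizer G T x)" using n M by blast
      also have "\<dots> \<le> n * conj_count M (M #> x)"
        using card_nilpotentizer_le[OF M x] by (intro mult_left_mono) auto
      finally show ?thesis .
    qed
    then have "x \<in> E n" using x P_closed_subgroup(4) by (auto simp: E_def)
    then show "x \<in> \<Union>(range E)" by blast
  qed
  have "compact_space ?X"
    using closedin_compact_space[OF compact P_closed_subgroup(2)] by (rule compact_space_subtopology)
  moreover have "Hausdorff_space ?X" using Hausdorff by (rule Hausdorff_space_subtopology)
  ultimately have loc: "locally_compact_space ?X \<and> regular_space ?X"
    using compact_imp_locally_compact_space compact_Hausdorff_imp_regular_space by blast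
  have "\<exists>n. ?X interior_of E n \<noteq> {}"
  proof (rule ccontr)
    assume "\<not> ?thesis"
    then have "?X interior_of \<Union>(range E) = {}"
      using loc closedE by (intro Baire_category_alt) auto
    moreover have "\<Union>(range E) = topspace ?X"
      using cover topX by (auto simp: E_def)
    ultimately have "topspace ?X = {}" using interior_of_topspace[of ?X] by simp
    then have "P = {}" using topX by simp
    then show False using subgroup.one_closed[OF P_closed_subgroup(3)] by simp
  qed
  then obtain n g where g: "g \<in> ?X interior_of E n" by blast
  then obtain W where W: "openin ?X W" "g \<in> W" "W \<subseteq> E n" by (auto simp: interior_of_def)
  obtain U where U: "openin T U" "W = U \<inter> P" using W(1) by (auto simp: openin_subtopology)
  have gP: "g \<in> P" using W U by blast
  then have gc: "g \<in> carrier G" using P_closed_subgroup(4) by blast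
  \<comment> \<open>The neighbourhood of \<open>g\<close> is moved to the identity, where it
    contains an open normal subgroup.\<close>
  have "openin T {y \<in> carrier G. y \<otimes> g \<in> U}"
    using gc U(1) by (intro openin_preimage continuous_group_intros)
  moreover have "\<one> \<in> {y \<in> carrier G. y \<otimes> g \<in> U}" using gc W U by simp
  ultimately obtain M0 where M0: "open_normal G T M0" "M0 \<subseteq> {y \<in> carrier G. y \<otimes> g \<in> U}"
    using ex_open_normal by blast
  interpret M0: open_quotient G T M0 using M0(1) by (rule open_quotientI)
  show ?thesis
  proof (rule that[of g M0 n])
    fix x M assume x: "x \<in> P" "M0 #> x = M0 #> g" and M: "open_normal G T M"
    have xc: "x \<in> carrier G" using x P_closed_subgroup(4) by blast
    have "x \<otimes> inv g \<in> M0" using M0.proj_eq_iff[OF xc gc] x(2) by simp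
    then have "x \<otimes> inv g \<otimes> g \<in> U" using M0(2) by blast
    then have "x \<in> U" using xc gc by (simp add: m_assoc)
    then have "x \<in> E n" using x(1) U(2) W(3) by blast
    then show "card (carrier (Q M)) \<le> n * conj_count M (M #> x)" using M by (auto simp: E_def)
  qed (use gP M0 in auto)
qed

end

text \<open>Elements of \<open>A\<close> in one coset of \<open>B\<close> lie in one coset of
  \<open>A \<inter> B\<close>, so the index of \<open>A \<inter> B\<close> in \<open>A\<close> is at
  most that of \<open>B\<close> in \<open>C\<close>. The inequality is this one, multiplied
  out.\<close>

lemma (in group) card_mult_le_card_Int:
  assumes A: "subgroup A G" and B: "subgroup B G" and C: "subgroup C G" "finite C" "A \<subseteq> C" "B \<subseteq> C"
  shows "card A * card B \<le> card C * card (A \<inter> B)"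
proof -
  have finA: "finite A" using C(3,2) by (rule finite_subset)
  have AB: "subgroup (A \<inter> B) G" using A B by (rule subgroups_Inter_pair)
  let ?a = "(\<lambda>g. g <#\<^bsub>G\<^esub> (A \<inter> B)) ` A" and ?b = "(\<lambda>g. g <#\<^bsub>G\<^esub> B) ` A" and ?c = "(\<lambda>g. g <#\<^bsub>G\<^esub> B) ` C"
  have "card ?a \<le> card ?b"
  proof (rule card_image_le_if)
    show "finite ?b" using finA by simp
    fix x y assume xy: "x \<in> A" "y \<in> A" "x <#\<^bsub>G\<^esub> B = y <#\<^bsub>G\<^esub> B"
    then have "inv y \<otimes> x \<in> B" using l_coset_eq_iff[OF C(1) B C(4,2), of x y] C(3) by blast
    moreover have "inv y \<otimes> x \<in> A"
      by (rule subgroup.m_closed[OF A subgroup.m_inv_closed[OF A xy(2)] xy(1)])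
    ultimately show "x <#\<^bsub>G\<^esub> (A \<inter> B) = y <#\<^bsub>G\<^esub> (A \<inter> B)"
      using l_coset_eq_iff[OF A AB _ finA, of x y] xy by simp
  qed
  also have "card ?b \<le> card ?c" using C by (intro card_mono) auto
  finally have le: "card ?a * card (A \<inter> B) * card B \<le> card ?c * card (A \<inter> B) * card B"
    by (intro mult_right_mono) auto
  have a: "card ?a * card (A \<inter> B) = card A" by (rule card_l_cosets[OF A AB _ finA]) simp
  have c: "card ?c * card B = card C" using C(1) B C(4,2) by (rule card_l_cosets)
  have "card A * card B = card ?a * card (A \<inter> B) * card B" by (simp only: a)
  also have "\<dots> \<le> card ?c * card (A \<inter> B) * card B" by (rule le)
  also have "\<dots> = card ?c * card B * card (A \<inter> B)" by (simp only: ac_simps)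
  also have "\<dots> = card C * card (A \<inter> B)" by (simp only: c)
  finally show ?thesis .
qed

section \<open>Indices of the intersections of \<open>P\<close> with its conjugates\<close>

context positive_nilpotentizers
begin

text \<open>The index of this subgroup in \<open>PQ M\<close> measures how far the conjugate by
  \<open>c\<close> is from \<open>PQ M\<close>. An index of at most \<open>k\<close> is always
  written \<open>card (PQ M) \<le> k * card (overlap M c)\<close>.\<close>

definition overlap where
  "overlap M c = PQ M \<inter> conjugate (Q M) c (PQ M)"

lemma
  assumes M: "open_normal G T M" and c: "c \<in> carrier (Q M)"
  shows subgroup_overlap: "subgroup (overlap M c) (Q M)"
    and card_overlap_inv: "card (overlap M (inv\<^bsub>Q M\<^esub> c)) = card (overlap M c)"
    and card_overlap_pos: "card (overlap M c) > 0"
proof -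
  interpret open_quotient G T M using M by (rule open_quotientI)
  note PQ = PQ_p_subgroup(2,3)[OF M]
  show sub: "subgroup (overlap M c) (Q M)"
    unfolding overlap_def using PQ(1) proj.H.conjugate_subgroup[OF c PQ(1)]
    by (rule proj.H.subgroups_Inter_pair)
  have "conjugate (Q M) c (overlap M (inv\<^bsub>Q M\<^esub> c))
      = conjugate (Q M) c (PQ M) \<inter> conjugate (Q M) c (conjugate (Q M) (inv\<^bsub>Q M\<^esub> c) (PQ M))"
    unfolding overlap_def
    using c PQ(2) proj.H.conjugate_closed[OF proj.H.inv_closed[OF c] PQ(2)] by (rule proj.H.conjugate_Int)
  also have "\<dots> = overlap M c"
    using proj.H.conjugate_inv_cancel(2)[OF c PQ(2)] by (auto simp: overlap_def)
  finally have "conjugate (Q M) c (overlap M (inv\<^bsub>Q M\<^esub> c)) = overlap M c" .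
  moreover have "overlap M (inv\<^bsub>Q M\<^esub> c) \<subseteq> carrier (Q M)" using PQ(2) by (auto simp: overlap_def)
  ultimately show "card (overlap M (inv\<^bsub>Q M\<^esub> c)) = card (overlap M c)"
    using proj.H.card_conjugate[OF c] by metis
  have "finite (overlap M c)" using finite_PQ[OF M] by (simp add: overlap_def)
  then show "card (overlap M c) > 0" using subgroup.one_closed[OF sub] by (auto simp: card_gt_0_iff)
qed

text \<open>Conjugation by \<open>c\<close> turns the overlap for the quotient of \<open>c\<close>
  and \<open>d\<close> into the intersection of the conjugates of \<open>PQ M\<close> by
  \<open>c\<close> and by \<open>d\<close>. This contains the intersection of two subgroups of index
  at most \<open>k\<close> in \<open>PQ M\<close>.\<close>

lemma small_index_mult:
  assumes M: "open_normal G T M" and c: "c \<in> carrier (Q M)" "d \<in> carrier (Q M)"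
    and k: "card (PQ M) \<le> k * card (overlap M c)" "card (PQ M) \<le> k * card (overlap M d)"
  shows "card (PQ M) \<le> k * k * card (overlap M (inv\<^bsub>Q M\<^esub> c \<otimes>\<^bsub>Q M\<^esub> d))"
proof -
  interpret open_quotient G T M using M by (rule open_quotientI)
  note PQ = PQ_p_subgroup(2,3)[OF M]
  let ?e = "inv\<^bsub>Q M\<^esub> c \<otimes>\<^bsub>Q M\<^esub> d"
  have e: "?e \<in> carrier (Q M)" using c by (intro proj.H.m_closed proj.H.inv_closed)
  have "c \<otimes>\<^bsub>Q M\<^esub> ?e = d" using c by (intro proj.H.inv_mult_cancel)
  then have "conjugate (Q M) c (overlap M ?e) = conjugate (Q M) c (PQ M) \<inter> conjugate (Q M) d (PQ M)"
    unfolding overlap_def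
    using proj.H.conjugate_Int[OF c(1) PQ(2) proj.H.conjugate_closed[OF e PQ(2)]]
      proj.H.conjugate_conjugate[OF c(1) e PQ(2)] by simp
  moreover have "overlap M ?e \<subseteq> carrier (Q M)" using PQ(2) by (auto simp: overlap_def)
  ultimately have "card (overlap M ?e) = card (conjugate (Q M) c (PQ M) \<inter> conjugate (Q M) d (PQ M))"
    using proj.H.card_conjugate[OF c(1)] by metis
  moreover have "finite (conjugate (Q M) c (PQ M))" using finite_PQ[OF M] by (simp add: conjugate_def)
  ultimately have le: "card (overlap M c \<inter> overlap M d) \<le> card (overlap M ?e)"
    by (auto simp: overlap_def intro!: card_mono)
  have "card (overlap M c) * card (overlap M d) \<le> card (PQ M) * card (overlap M c \<inter> overlap M d)"
    using subgroup_overlap[OF M c(1)] subgroup_overlap[OF M c(2)] PQ(1) finite_PQ[OF M]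
    by (rule proj.H.card_mult_le_card_Int) (auto simp: overlap_def)
  also have "\<dots> \<le> card (PQ M) * card (overlap M ?e)" using le by (rule mult_left_mono) simp
  finally have *: "card (overlap M c) * card (overlap M d) \<le> card (PQ M) * card (overlap M ?e)" .
  have "card (PQ M) * card (PQ M) \<le> (k * card (overlap M c)) * (k * card (overlap M d))"
    using k by (intro mult_mono) auto
  also have "\<dots> = k * k * (card (overlap M c) * card (overlap M d))" by (simp add: ac_simps)
  also have "\<dots> \<le> k * k * (card (PQ M) * card (overlap M ?e))" using * by (rule mult_left_mono) simp
  finally have "card (PQ M) * card (PQ M) \<le> card (PQ M) * (k * k * card (overlap M ?e))" by (simp add: ac_simps)
  moreover have "0 < card (PQ M)"
    using finite_PQ[OF M] subgroup.one_closed[OF PQ(1)] by (auto simp: card_gt_0_iff)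
  ultimately show ?thesis by simp
qed

text \<open>The overlap pulled back to \<open>P\<close>. Being a subgroup of \<open>G\<close>
  itself, it allows different \<open>M\<close> to be compared.\<close>

definition overlap_pre where
  "overlap_pre M t = {x \<in> P. M #> x \<in> conjugate (Q M) (M #> t) (PQ M)}"

lemma image_overlap_pre: "r_coset G M ` overlap_pre M t = overlap M (M #> t)"
  by (auto simp: overlap_pre_def overlap_def)

lemma proj_mono:
  assumes M: "open_normal G T M" and N: "open_normal G T N" and MN: "M \<subseteq> N"
    and x: "x \<in> carrier G" "y \<in> carrier G" "M #> x = M #> y"
  shows "N #> x = N #> y"
  using r_coset_eq_iff[OF open_normal_subgroup[OF M] x(1,2)] r_coset_eq_iff[OF open_normal_subgroup[OF N] x(1,2)]
    x(3) MN by blast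

lemma mem_overlap_pre_iff:
  assumes M: "open_normal G T M" and t: "t \<in> carrier G"
  shows "x \<in> overlap_pre M t \<longleftrightarrow> x \<in> P \<and> (\<exists>q\<in>P. M #> x = M #> (t \<otimes> q \<otimes> inv t))"
proof -
  interpret open_quotient G T M using M by (rule open_quotientI)
  have "conjugate (Q M) (M #> t) (PQ M) = r_coset G M ` conjugate G t P"
    using proj.conjugate_image[OF t P_closed_subgroup(4)] by simp
  then show ?thesis by (auto simp: overlap_pre_def conjugate_def)
qed

lemma overlap_pre_mono:
  assumes M: "open_normal G T M" and N: "open_normal G T N" and MN: "M \<subseteq> N" and t: "t \<in> carrier G"
  shows "overlap_pre M t \<subseteq> overlap_pre N t"
proof
  fix x assume "x \<in> overlap_pre M t"
  then obtain q where q: "x \<in> P" "q \<in> P" "M #> x = M #> (t \<otimes> q \<otimes> inv t)"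
    using mem_overlap_pre_iff[OF M t] by blast
  moreover have "x \<in> carrier G" "t \<otimes> q \<otimes> inv t \<in> carrier G" using q t P_closed_subgroup(4) by auto
  ultimately have "N #> x = N #> (t \<otimes> q \<otimes> inv t)" using proj_mono[OF M N MN] by blast
  then show "x \<in> overlap_pre N t" using mem_overlap_pre_iff[OF N t] q by blast
qed

lemma subgroup_overlap_pre:
  assumes M: "open_normal G T M" and t: "t \<in> carrier G"
  shows "subgroup (overlap_pre M t) G"
proof -
  interpret open_quotient G T M using M by (rule open_quotientI)
  have "subgroup (conjugate (Q M) (M #> t) (PQ M)) (Q M)"
    using proj.H.conjugate_subgroup[OF proj.hom_closed[OF t] PQ_p_subgroup(2)[OF M]] .
  then have "subgroup (P \<inter> {x \<in> carrier G. M #> x \<in> conjugate (Q M) (M #> t) (PQ M)}) G"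
    using P_closed_subgroup(3) proj.subgroup_preimage by (intro subgroups_Inter_pair)
  moreover have "P \<inter> {x \<in> carrier G. M #> x \<in> conjugate (Q M) (M #> t) (PQ M)} = overlap_pre M t"
    using P_closed_subgroup(4) by (auto simp: overlap_pre_def)
  ultimately show ?thesis by simp
qed

text \<open>The order formula for the map from the image of \<open>S\<close> modulo \<open>M\<close>
  onto its image modulo \<open>N\<close>; the kernel is the image of
  \<open>S \<inter> N\<close>.\<close>

lemma card_image_mult:
  assumes M: "open_normal G T M" and N: "open_normal G T N" and MN: "M \<subseteq> N"
    and S: "subgroup S G"
  shows "card (r_coset G N ` S) * card (r_coset G M ` (S \<inter> N)) = card (r_coset G M ` S)"
proof -
  interpret M: open_quotient G T M using M by (rule open_quotientI)
  interpret N: open_quotient G T N using N by (rule open_quotientI)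
  have Sc: "S \<subseteq> carrier G" using S by (rule subgroup.subset)
  have one: "N #> g = \<one>\<^bsub>Q N\<^esub> \<longleftrightarrow> g \<in> N" "M #> g = \<one>\<^bsub>Q M\<^esub> \<longleftrightarrow> g \<in> M" if "g \<in> S" for g
    using N.proj_eq_one_iff M.proj_eq_one_iff Sc that by (auto simp: subset_iff)
  have "finite (r_coset G M ` S)"
    using M.surj_proj Sc by (intro finite_subset[OF _ M.finite_quotient]) blast
  then have "card (r_coset G N ` S) * card (r_coset G M ` {g \<in> S. N #> g = \<one>\<^bsub>Q N\<^esub>}) = card (r_coset G M ` S)"
    using one MN by (intro card_hom_image_mult[OF S N.proj.group_hom_axioms M.proj.group_hom_axioms]) blast+
  moreover have "{g \<in> S. N #> g = \<one>\<^bsub>Q N\<^esub>} = S \<inter> N" using one by blast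
  ultimately show ?thesis by simp
qed

text \<open>Reduction modulo the larger \<open>N\<close> maps \<open>PQ M\<close> onto
  \<open>PQ N\<close> and overlap into overlap, and its kernel on the overlap is contained in its
  kernel on \<open>PQ M\<close>. So the index can only drop.\<close>

lemma small_index_coarser:
  assumes M: "open_normal G T M" and N: "open_normal G T N" and MN: "M \<subseteq> N" and t: "t \<in> carrier G"
    and k: "card (PQ M) \<le> k * card (overlap M (M #> t))"
  shows "card (PQ N) \<le> k * card (overlap N (N #> t))"
proof -
  interpret M: open_quotient G T M using M by (rule open_quotientI)
  let ?c = "card (r_coset G M ` (P \<inter> N))"
  have fin: "finite (r_coset G M ` (P \<inter> N))"
    using finite_PQ[OF M] by (rule finite_subset[rotated]) blast
  have "card (PQ N) * ?c = card (PQ M)"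
    using M N MN P_closed_subgroup(3) by (rule card_image_mult)
  also have "\<dots> \<le> k * card (r_coset G M ` overlap_pre M t)" using k by (simp add: image_overlap_pre)
  also have "card (r_coset G M ` overlap_pre M t)
      = card (r_coset G N ` overlap_pre M t) * card (r_coset G M ` (overlap_pre M t \<inter> N))"
    using card_image_mult[OF M N MN subgroup_overlap_pre[OF M t]] by simp
  also have "k * \<dots> \<le> k * (card (overlap N (N #> t)) * ?c)"
  proof (intro mult_left_mono mult_mono card_mono fin)
    show "r_coset G N ` overlap_pre M t \<subseteq> overlap N (N #> t)"
      using overlap_pre_mono[OF M N MN t] by (auto simp: image_overlap_pre[symmetric])
    show "r_coset G M ` (overlap_pre M t \<inter> N) \<subseteq> r_coset G M ` (P \<inter> N)" by (auto simp: overlap_pre_def)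
    show "finite (overlap N (N #> t))" using finite_PQ[OF N] by (simp add: overlap_def)
  qed auto
  finally have "card (PQ N) * ?c \<le> (k * card (overlap N (N #> t))) * ?c" by (simp add: ac_simps)
  moreover have "0 < ?c"
    using fin subgroup.one_closed[OF P_closed_subgroup(3)] subgroup.one_closed[OF open_normal_subgroup[OF N]]
    by (auto simp: card_gt_0_iff)
  ultimately show ?thesis by simp
qed

text \<open>Let \<open>X\<close> be the image of the coset of \<open>P \<inter> M0\<close> on which
  the bound \<open>n\<close> is uniform. As \<open>k = card (PQ M0)\<close> is the index of
  \<open>P \<inter> M0\<close> in \<open>P\<close>, the group \<open>PQ M\<close> has at most
  \<open>k * card X\<close> elements. By double counting, for a proportion of at least
  \<open>1 / (2 * n)\<close> of all \<open>t\<close> the conjugate of \<open>PQ M\<close> contains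
  that proportion of \<open>X\<close>. Hence \<open>b = 2 * n\<close> and
  \<open>m = k * (2 * n)\<close>.\<close>

lemma ex_many_small:
  obtains b m M0 where "open_normal G T M0"
    "\<And>M. open_normal G T M \<Longrightarrow> M \<subseteq> M0 \<Longrightarrow>
      card (carrier (Q M)) \<le> b * card {c \<in> carrier (Q M). card (PQ M) \<le> m * card (overlap M c)}"
proof -
  obtain n g M0 where g: "g \<in> P" and M0: "open_normal G T M0"
    and uniform: "\<And>x M. x \<in> P \<Longrightarrow> M0 #> x = M0 #> g \<Longrightarrow> open_normal G T M
      \<Longrightarrow> card (carrier (Q M)) \<le> n * conj_count M (M #> x)"
    by (rule ex_uniform_coset) (rule that)
  have gc: "g \<in> carrier G" using g P_closed_subgroup(4) by blast
  interpret M0: open_quotient G T M0 using M0 by (rule open_quotientI)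
  define k where "k = card (PQ M0)"
  have "card (carrier (Q M)) \<le> 2 * n * card {c \<in> carrier (Q M). card (PQ M) \<le> k * (2 * n) * card (overlap M c)}"
    if M: "open_normal G T M" and MM0: "M \<subseteq> M0" for M
  proof -
    interpret M: open_quotient G T M using M by (rule open_quotientI)
    let ?X = "r_coset G M ` {x \<in> P. M0 #> x = M0 #> g}"
    have finX: "finite ?X" using finite_PQ[OF M] by (rule finite_subset[rotated]) blast
    have XP: "?X \<subseteq> PQ M" by blast
    have "card (PQ M) = k * card (r_coset G M ` (P \<inter> M0))"
      using card_image_mult[OF M M0 MM0 P_closed_subgroup(3)] by (simp add: k_def)
    also have "card (r_coset G M ` (P \<inter> M0)) \<le> card ?X"
    proof (rule card_inj_on_le[OF _ _ finX])
      show "inj_on (\<lambda>c. c \<otimes>\<^bsub>Q M\<^esub> (M #> g)) (r_coset G M ` (P \<inter> M0))"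
      proof (rule inj_onI)
        fix c d assume "c \<in> r_coset G M ` (P \<inter> M0)" "d \<in> r_coset G M ` (P \<inter> M0)"
          and eq: "c \<otimes>\<^bsub>Q M\<^esub> (M #> g) = d \<otimes>\<^bsub>Q M\<^esub> (M #> g)"
        then have "c \<in> carrier (Q M)" "d \<in> carrier (Q M)" using PQ_p_subgroup(3)[OF M] by blast+
        then show "c = d" using eq M.proj.H.right_cancel[OF M.proj.hom_closed[OF gc]] by blast
      qed
      show "(\<lambda>c. c \<otimes>\<^bsub>Q M\<^esub> (M #> g)) ` r_coset G M ` (P \<inter> M0) \<subseteq> ?X"
      proof clarify
        fix v assume v: "v \<in> P" "v \<in> M0"
        have vc: "v \<in> carrier G" using v P_closed_subgroup(4) by blast
        have "v \<otimes> g \<otimes> inv g \<in> M0" using v vc gc by (simp add: m_assoc)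
        then have "M0 #> (v \<otimes> g) = M0 #> g" using M0.proj_eq_iff[of "v \<otimes> g" g] vc gc by simp
        moreover have "v \<otimes> g \<in> P" using subgroup.m_closed[OF P_closed_subgroup(3) v(1) g] .
        moreover have "(M #> v) \<otimes>\<^bsub>Q M\<^esub> (M #> g) = M #> (v \<otimes> g)" using M.proj.hom_mult[OF vc gc] by simp
        ultimately show "(M #> v) \<otimes>\<^bsub>Q M\<^esub> (M #> g) \<in> ?X" by blast
      qed
    qed
    finally have card_P: "card (PQ M) \<le> k * card ?X" by simp
    have "card (carrier (Q M)) \<le> 2 * n * card {t \<in> carrier (Q M).
        card ?X \<le> 2 * n * card {c \<in> ?X. c \<in> conjugate (Q M) t (PQ M)}}"
    proof (rule popular_elements[OF M.finite_quotient finX])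
      show "?X \<noteq> {}" using g by blast
      show "card (carrier (Q M)) \<le> n * card {t \<in> carrier (Q M). c \<in> conjugate (Q M) t (PQ M)}"
        if "c \<in> ?X" for c
        using that uniform M unfolding conj_count_def by blast
    qed
    also have "\<dots> \<le> 2 * n * card {c \<in> carrier (Q M). card (PQ M) \<le> k * (2 * n) * card (overlap M c)}"
    proof (intro mult_left_mono card_mono subsetI)
      fix t assume t: "t \<in> {t \<in> carrier (Q M). card ?X \<le> 2 * n * card {c \<in> ?X. c \<in> conjugate (Q M) t (PQ M)}}"
      have "card {c \<in> ?X. c \<in> conjugate (Q M) t (PQ M)} \<le> card (overlap M t)"
        using XP finite_PQ[OF M] by (intro card_mono) (auto simp: overlap_def)
      then have "card ?X \<le> 2 * n * card (overlap M t)"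
        using t by (auto intro: order_trans mult_left_mono)
      then have "k * card ?X \<le> k * (2 * n * card (overlap M t))" by (rule mult_left_mono) simp
      with card_P have "card (PQ M) \<le> k * (2 * n) * card (overlap M t)" unfolding mult.assoc by (rule order_trans)
      then show "t \<in> {c \<in> carrier (Q M). card (PQ M) \<le> k * (2 * n) * card (overlap M c)}"
        using t by simp
    qed (use M.finite_quotient in auto)
    finally show ?thesis .
  qed
  then show ?thesis using that M0 by blast
qed

text \<open>Modulo \<open>M\<close> the elements of index at most \<open>m\<close> form a set
  \<open>B\<close> of proportion at least \<open>1 / b\<close>. Quotients of two of them have index
  at most \<open>m * m\<close>, so translates of \<open>B\<close> by elements whose quotients
  violate this bound are disjoint, and there are at most \<open>b\<close> of them. Hence finitely
  many translates of the closed set \<open>A\<close>, which satisfies the bound for all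
  \<open>M\<close> below \<open>M0\<close>, cover \<open>G\<close>, and by Baire's theorem one of
  them has an interior point.\<close>

lemma ex_open_coset_small:
  obtains k t0 M1 where "open_normal G T M1" "t0 \<in> carrier G"
    "\<And>t M. t \<in> carrier G \<Longrightarrow> M1 #> t = M1 #> t0 \<Longrightarrow> open_normal G T M \<Longrightarrow> M \<subseteq> M1
      \<Longrightarrow> card (PQ M) \<le> k * card (overlap M (M #> t))"
proof -
  obtain b m M0 where M0: "open_normal G T M0"
    and many: "\<And>M. open_normal G T M \<Longrightarrow> M \<subseteq> M0 \<Longrightarrow>
      card (carrier (Q M)) \<le> b * card {c \<in> carrier (Q M). card (PQ M) \<le> m * card (overlap M c)}"
    by (rule ex_many_small) (rule that)
  define k where "k = m * m"
  define A where "A = carrier G \<inter> (\<Inter>M\<in>{M. open_normal G T M \<and> M \<subseteq> M0}.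
    {t \<in> carrier G. card (PQ M) \<le> k * card (overlap M (M #> t))})"
  have A_iff: "t \<in> A \<longleftrightarrow> t \<in> carrier G \<and>
      (\<forall>M. open_normal G T M \<longrightarrow> M \<subseteq> M0 \<longrightarrow> card (PQ M) \<le> k * card (overlap M (M #> t)))" for t
    by (auto simp: A_def)
  have closedA: "closedin T A"
  proof -
    have "closedin T {t \<in> carrier G. card (PQ M) \<le> k * card (overlap M (M #> t))}" if "open_normal G T M" for M
    proof -
      interpret open_quotient G T M using that by (rule open_quotientI)
      show ?thesis by (rule closedin_saturated)
    qed
    then show ?thesis
      unfolding A_def using M0 closedin_topspace[of T]
      by (intro closedin_Int closedin_INT) (auto simp: topspace_eq)
  qed
  have A_inv: "inv t \<in> A" if t: "t \<in> A" for t
  proof -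
    have tc: "t \<in> carrier G" using t A_iff by blast
    have "card (overlap M (M #> inv t)) = card (overlap M (M #> t))" if M: "open_normal G T M" for M
    proof -
      interpret open_quotient G T M using M by (rule open_quotientI)
      show ?thesis using card_overlap_inv[OF M proj.hom_closed[OF tc]] proj.hom_inv[OF tc] by simp
    qed
    then show ?thesis using t tc by (auto simp: A_iff)
  qed
  define sep where "sep S \<longleftrightarrow> finite S \<and> S \<subseteq> carrier G \<and> (\<forall>g\<in>S. \<forall>h\<in>S. g \<noteq> h \<longrightarrow> g \<otimes> inv h \<notin> A)" for S
  have sep_card: "card S \<le> b" if S: "sep S" for S
  proof -
    have Sc: "finite S" "S \<subseteq> carrier G" using S by (auto simp: sep_def)
    have "\<exists>N. open_normal G T N \<and> N \<subseteq> M0 \<and> \<not> card (PQ N) \<le> k * card (overlap N (N #> (g \<otimes> inv h)))"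
      if gh: "g \<in> S" "h \<in> S" "g \<noteq> h" for g h
    proof -
      have "g \<otimes> inv h \<in> carrier G" using gh Sc(2) by auto
      moreover have "g \<otimes> inv h \<notin> A" using S gh by (simp add: sep_def)
      ultimately show ?thesis using A_iff[of "g \<otimes> inv h"] by blast
    qed
    then obtain N where N: "\<And>g h. g \<in> S \<Longrightarrow> h \<in> S \<Longrightarrow> g \<noteq> h \<Longrightarrow>
        open_normal G T (N g h) \<and> N g h \<subseteq> M0 \<and> \<not> card (PQ (N g h)) \<le> k * card (overlap (N g h) (N g h #> (g \<otimes> inv h)))"
      by metis
    \<comment> \<open>Each pair has its own witness \<open>N g h\<close> that the quotient is not in
      \<open>A\<close>. Since a bound on the index passes to larger subgroups, a single
      \<open>M\<close> below all of them is a witness for every pair.\<close>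
    define M where "M = M0 \<inter> (carrier G \<inter> \<Inter>((\<lambda>(g, h). N g h) ` {(g, h) \<in> S \<times> S. g \<noteq> h}))"
    have "finite {(g, h) \<in> S \<times> S. g \<noteq> h}"
      by (rule finite_subset[of _ "S \<times> S"]) (use Sc(1) in auto)
    then have M: "open_normal G T M"
      unfolding M_def using M0 N by (intro open_normal_Int open_normal_Inter) auto
    have MM0: "M \<subseteq> M0" by (auto simp: M_def)
    interpret M: open_quotient G T M using M by (rule open_quotientI)
    have large: "\<not> card (PQ M) \<le> k * card (overlap M (M #> (g \<otimes> inv h)))"
      if gh: "g \<in> S" "h \<in> S" "g \<noteq> h" for g h
    proof
      assume le: "card (PQ M) \<le> k * card (overlap M (M #> (g \<otimes> inv h)))"
      have "M \<subseteq> N g h" using gh by (auto simp: M_def)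
      moreover have "g \<otimes> inv h \<in> carrier G" using gh Sc(2) by auto
      ultimately have "card (PQ (N g h)) \<le> k * card (overlap (N g h) (N g h #> (g \<otimes> inv h)))"
        using small_index_coarser[OF M _ _ _ le] N[OF gh] by blast
      then show False using N[OF gh] by blast
    qed
    define B where "B = {c \<in> carrier (Q M). card (PQ M) \<le> m * card (overlap M c)}"
    have finB: "finite B" using M.finite_quotient by (simp add: B_def)
    let ?f = "\<lambda>h. (\<lambda>c. c \<otimes>\<^bsub>Q M\<^esub> (M #> h)) ` B"
    have card_f: "card (?f h) = card B" if h: "h \<in> S" for h
    proof (rule card_image, rule inj_onI)
      fix c d assume "c \<in> B" "d \<in> B" "c \<otimes>\<^bsub>Q M\<^esub> (M #> h) = d \<otimes>\<^bsub>Q M\<^esub> (M #> h)"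
      moreover have "M #> h \<in> carrier (Q M)" using M.proj.hom_closed h Sc(2) by blast
      ultimately show "c = d" using M.proj.H.right_cancel by (auto simp: B_def simp del: mult_FactGroup)
    qed
    have disj: "?f g \<inter> ?f h = {}" if gh: "g \<in> S" "h \<in> S" "g \<noteq> h" for g h
    proof (rule equals0I)
      fix x assume "x \<in> ?f g \<inter> ?f h"
      then obtain c d where c: "c \<in> B" "x = c \<otimes>\<^bsub>Q M\<^esub> (M #> g)" and d: "d \<in> B" "x = d \<otimes>\<^bsub>Q M\<^esub> (M #> h)"
        by auto
      have cd: "c \<in> carrier (Q M)" "d \<in> carrier (Q M)" "card (PQ M) \<le> m * card (overlap M c)"
        "card (PQ M) \<le> m * card (overlap M d)"
        using c(1) d(1) by (auto simp: B_def)
      have ghc: "g \<in> carrier G" "h \<in> carrier G" using gh Sc(2) by auto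
      then have q: "M #> g \<in> carrier (Q M)" "M #> h \<in> carrier (Q M)" by (auto intro: M.proj.hom_closed)
      have "(M #> g) \<otimes>\<^bsub>Q M\<^esub> inv\<^bsub>Q M\<^esub> (M #> h)
          = inv\<^bsub>Q M\<^esub> c \<otimes>\<^bsub>Q M\<^esub> (c \<otimes>\<^bsub>Q M\<^esub> (M #> g)) \<otimes>\<^bsub>Q M\<^esub> inv\<^bsub>Q M\<^esub> (M #> h)"
        using M.proj.H.inv_mult_cancel(1)[OF cd(1) q(1)] by simp
      also have "\<dots> = inv\<^bsub>Q M\<^esub> c \<otimes>\<^bsub>Q M\<^esub> (d \<otimes>\<^bsub>Q M\<^esub> (M #> h)) \<otimes>\<^bsub>Q M\<^esub> inv\<^bsub>Q M\<^esub> (M #> h)"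
        using c(2) d(2) by simp
      also have "\<dots> = inv\<^bsub>Q M\<^esub> c \<otimes>\<^bsub>Q M\<^esub> d"
        using cd(1,2) q by (simp add: M.proj.H.m_assoc del: mult_FactGroup one_FactGroup)
      finally have "M #> (g \<otimes> inv h) = inv\<^bsub>Q M\<^esub> c \<otimes>\<^bsub>Q M\<^esub> d"
        using ghc M.proj.hom_mult[of g "inv h"] M.proj.hom_inv[of h] by simp
      then have "card (PQ M) \<le> k * card (overlap M (M #> (g \<otimes> inv h)))"
        using small_index_mult[OF M cd] by (simp add: k_def)
      then show False using large[OF gh] by blast
    qed
    have "card S * card B = (\<Sum>h\<in>S. card (?f h))" using card_f by simp
    also have "\<dots> = card (\<Union>h\<in>S. ?f h)"
      using Sc(1) finB disj by (subst card_UN_disjoint) auto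
    also have "\<dots> \<le> card (carrier (Q M))"
    proof (rule card_mono[OF M.finite_quotient], rule UN_least, rule image_subsetI)
      fix h c assume "h \<in> S" "c \<in> B"
      then show "c \<otimes>\<^bsub>Q M\<^esub> (M #> h) \<in> carrier (Q M)"
        using M.proj.hom_closed Sc(2) by (intro M.proj.H.m_closed) (auto simp: B_def)
    qed
    also have "\<dots> \<le> b * card B" using many[OF M MM0] by (simp add: B_def)
    finally have le: "card S * card B \<le> b * card B" .
    have "carrier (Q M) \<noteq> {}" using M.proj.H.one_closed by blast
    then have "0 < card (carrier (Q M))" using M.finite_quotient by (simp add: card_gt_0_iff)
    then have "0 < card B" using \<open>card (carrier (Q M)) \<le> b * card B\<close> by (cases "card B") auto
    then show ?thesis using le by simp
  qed
  have "\<exists>S. sep S \<and> (\<forall>S'. sep S' \<longrightarrow> card S' \<le> card S)"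
    using sep_card by (intro ex_has_greatest_nat[of sep "{}" card "Suc b"]) (auto simp: sep_def less_Suc_eq_le)
  then obtain S where S: "sep S" "\<And>S'. sep S' \<Longrightarrow> card S' \<le> card S" by blast
  have Sc: "finite S" "S \<subseteq> carrier G" using S(1) by (auto simp: sep_def)
  have cover: "carrier G \<subseteq> (\<Union>h\<in>S. A #> h)"
  proof
    fix g assume g: "g \<in> carrier G"
    have one: "\<one> \<in> A"
    proof -
      have "card (PQ M) \<le> k * card (overlap M (M #> \<one>))" if M: "open_normal G T M" "M \<subseteq> M0" for M
      proof -
        interpret M: open_quotient G T M using M(1) by (rule open_quotientI)
        have "overlap M (M #> \<one>) = PQ M"
          using M.proj.H.conjugate_one[OF PQ_p_subgroup(3)[OF M(1)]] M.proj.hom_one by (simp add: overlap_def)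
        \<comment> \<open>If \<open>m\<close> were 0, no element would have small index, against
          \<open>many\<close>.\<close>
        moreover have "m \<noteq> 0"
        proof
          assume "m = 0"
          then have B0: "{c \<in> carrier (Q M). card (PQ M) \<le> m * card (overlap M c)} = {}"
            using finite_PQ[OF M(1)] subgroup.one_closed[OF PQ_p_subgroup(2)[OF M(1)]] by auto
          have "card (carrier (Q M)) = 0" using many[OF M] unfolding B0 by simp
          then show False using M.finite_quotient M.proj.H.one_closed by auto
        qed
        ultimately show ?thesis by (simp add: k_def)
      qed
      then show ?thesis by (simp add: A_iff)
    qed
    show "g \<in> (\<Union>h\<in>S. A #> h)"
    proof (cases "g \<in> S")
      case True
      then have "\<one> \<otimes> g \<in> A #> g" using one by (auto simp: r_coset_def)
      then show ?thesis using True g by auto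
    next
      case False
      then have "card (insert g S) > card S" using Sc by simp
      then have "\<not> sep (insert g S)" using S(2)[of "insert g S"] by linarith
      then obtain x y where xy: "x \<in> insert g S" "y \<in> insert g S" "x \<noteq> y" "x \<otimes> inv y \<in> A"
        using Sc g by (auto simp: sep_def)
      moreover have "\<not> (x \<in> S \<and> y \<in> S)" using S(1) xy by (auto simp: sep_def)
      ultimately obtain h where h: "h \<in> S" "g \<otimes> inv h \<in> A \<or> h \<otimes> inv g \<in> A" by auto
      have hc: "h \<in> carrier G" using h Sc by blast
      have "g \<otimes> inv h \<in> A"
        using h(2) A_inv[of "h \<otimes> inv g"] g hc by (auto simp: inv_mult_group)
      then have "g \<otimes> inv h \<otimes> h \<in> A #> h" by (auto simp: r_coset_def)
      then show ?thesis using h(1) g hc by (auto simp: m_assoc)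
    qed
  qed
  have Ac: "A \<subseteq> carrier G" by (auto simp: A_def)
  have "\<exists>h\<in>S. T interior_of (A #> h) \<noteq> {}"
  proof (rule ccontr)
    assume none: "\<not> ?thesis"
    have "locally_compact_space T \<and> regular_space T"
      using compact_imp_locally_compact_space[OF compact] compact_Hausdorff_imp_regular_space[OF compact Hausdorff]
      by blast
    then have "T interior_of \<Union>((\<lambda>h. A #> h) ` S) = {}"
      using none Sc closedA closedin_r_coset
      by (intro Baire_category_alt) (auto simp: countable_finite)
    moreover have "\<Union>((\<lambda>h. A #> h) ` S) = topspace T"
      using cover Sc r_coset_subset_G[OF Ac] by (auto simp: topspace_eq)
    ultimately have "topspace T = {}" using interior_of_topspace[of T] by simp
    then show False using one_closed by (simp add: topspace_eq)
  qed
  then obtain h x where h: "h \<in> S" and x: "x \<in> T interior_of (A #> h)" by blast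
  then obtain W where W: "openin T W" "x \<in> W" "W \<subseteq> A #> h" by (auto simp: interior_of_def)
  have hc: "h \<in> carrier G" and xc: "x \<in> carrier G" using h Sc W openin_carrier by blast+
  \<comment> \<open>\<open>W\<close> is a neighbourhood of \<open>x\<close> inside
    \<open>A #> h\<close>. Translation by \<open>inv h\<close> makes it a neighbourhood of
    \<open>t0\<close> inside \<open>A\<close>.\<close>
  define t0 where "t0 = x \<otimes> inv h"
  have t0: "t0 \<in> carrier G" using xc hc by (simp add: t0_def)
  have "openin T {y \<in> carrier G. y \<otimes> x \<in> W}"
    using xc W(1) by (intro openin_preimage continuous_group_intros)
  moreover have "\<one> \<in> {y \<in> carrier G. y \<otimes> x \<in> W}" using xc W by simp
  ultimately obtain N where N: "open_normal G T N" "N \<subseteq> {y \<in> carrier G. y \<otimes> x \<in> W}"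
    using ex_open_normal by blast
  define M1 where "M1 = N \<inter> M0"
  have M1: "open_normal G T M1" unfolding M1_def using N(1) M0 by (rule open_normal_Int)
  interpret M1: open_quotient G T M1 using M1 by (rule open_quotientI)
  show ?thesis
  proof (rule that[OF M1 t0, of k])
    fix t M assume t: "t \<in> carrier G" "M1 #> t = M1 #> t0" and M: "open_normal G T M" "M \<subseteq> M1"
    have "t \<otimes> inv t0 \<in> N" using M1.proj_eq_iff[OF t(1) t0] t(2) by (auto simp: M1_def)
    then have "t \<otimes> inv t0 \<otimes> x \<in> A #> h" using N(2) W(3) by blast
    moreover have "t \<otimes> inv t0 \<otimes> x = t \<otimes> h"
      using t(1) hc xc by (simp add: t0_def inv_mult_group m_assoc)
    ultimately obtain a where a: "a \<in> A" "t \<otimes> h = a \<otimes> h" by (auto simp: r_coset_def)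
    then have "t = a" using t(1) hc Ac by auto
    then show "card (PQ M) \<le> k * card (overlap M (M #> t))"
      using a(1) A_iff M by (auto simp: M1_def)
  qed
qed

end

section \<open>A normal open subgroup of the Sylow subgroup\<close>

context positive_nilpotentizers
begin

lemma card_overlap_dvd:
  assumes M: "open_normal G T M" and c: "c \<in> carrier (Q M)"
  shows "card (PQ M) = card (PQ M) div card (overlap M c) * card (overlap M c)"
proof -
  interpret open_quotient G T M using M by (rule open_quotientI)
  have eq: "card ((\<lambda>g. g <#\<^bsub>Q M\<^esub> overlap M c) ` PQ M) * card (overlap M c) = card (PQ M)"
    using PQ_p_subgroup(2)[OF M] subgroup_overlap[OF M c] _ finite_PQ[OF M]
    by (rule proj.H.card_l_cosets) (auto simp: overlap_def)
  have "card (overlap M c) dvd card (PQ M)" unfolding eq[symmetric] by (rule dvd_triv_right)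
  then show ?thesis by (rule dvd_div_mult_self[symmetric])
qed

text \<open>The index is bounded on the pairs \<open>(M, t)\<close> with \<open>M\<close> below
  \<open>M1\<close> and \<open>t\<close> in the coset of \<open>t0\<close>, so it has a maximum, at
  \<open>(N, t1)\<close>. Maximizing over \<open>M\<close> and \<open>t\<close> at once makes the
  conclusion hold for every \<open>t\<close> in the coset of \<open>N\<close>: modulo
  \<open>N\<close> such a \<open>t\<close> has the same index as \<open>t1\<close>.\<close>

lemma ex_stable_coset:
  obtains t1 N where "open_normal G T N" "t1 \<in> carrier G"
    "\<And>t M. t \<in> carrier G \<Longrightarrow> N #> t = N #> t1 \<Longrightarrow> open_normal G T M \<Longrightarrow> M \<subseteq> N
      \<Longrightarrow> r_coset G M ` (P \<inter> N) \<subseteq> conjugate (Q M) (M #> t) (PQ M)"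
proof -
  obtain k t0 M1 where M1: "open_normal G T M1" and t0: "t0 \<in> carrier G"
    and small: "\<And>t M. t \<in> carrier G \<Longrightarrow> M1 #> t = M1 #> t0 \<Longrightarrow> open_normal G T M \<Longrightarrow> M \<subseteq> M1
      \<Longrightarrow> card (PQ M) \<le> k * card (overlap M (M #> t))"
    by (rule ex_open_coset_small) (rule that)
  define index where "index M t = card (PQ M) div card (overlap M (M #> t))" for M t
  have card_PQ: "card (PQ M) = index M t * card (overlap M (M #> t))"
    if M: "open_normal G T M" and t: "t \<in> carrier G" for M t
  proof -
    interpret open_quotient G T M using M by (rule open_quotientI)
    show ?thesis unfolding index_def using M proj.hom_closed[OF t] by (rule card_overlap_dvd)
  qed
  define dom where "dom z \<longleftrightarrow> open_normal G T (fst z) \<and> fst z \<subseteq> M1 \<and> snd z \<in> carrier G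
    \<and> M1 #> snd z = M1 #> t0" for z
  have overlap_pos: "0 < card (overlap M (M #> t))" if M: "open_normal G T M" and t: "t \<in> carrier G" for M t
  proof -
    interpret open_quotient G T M using M by (rule open_quotientI)
    show ?thesis using M proj.hom_closed[OF t] by (rule card_overlap_pos)
  qed
  have "index (fst z) (snd z) \<le> k" if z: "dom z" for z
  proof -
    have *: "open_normal G T (fst z)" "snd z \<in> carrier G" using z by (auto simp: dom_def)
    have "card (PQ (fst z)) \<le> k * card (overlap (fst z) (fst z #> snd z))"
      using small z by (auto simp: dom_def)
    then show ?thesis using card_PQ[OF *] overlap_pos[OF *] by simp
  qed
  moreover have "dom (M1, t0)" using M1 t0 by (simp add: dom_def)
  ultimately have "\<exists>z. dom z \<and> (\<forall>z'. dom z' \<longrightarrow> index (fst z') (snd z') \<le> index (fst z) (snd z))"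
    by (intro ex_has_greatest_nat[of dom _ _ "Suc k"]) (auto simp: less_Suc_eq_le)
  then obtain N t1 where d: "dom (N, t1)" and max: "\<And>M t. dom (M, t) \<Longrightarrow> index M t \<le> index N t1"
    by auto
  have N: "open_normal G T N" "N \<subseteq> M1" and t1: "t1 \<in> carrier G" "M1 #> t1 = M1 #> t0"
    using d by (auto simp: dom_def)
  show ?thesis
  \<comment> \<open>By maximality the index cannot grow from \<open>N\<close> to \<open>M\<close>, so the preimage of the overlap modulo
    \<open>M\<close> already contains \<open>P \<inter> N\<close>.\<close>
  proof (rule that[OF N(1) t1(1)])
    fix t M assume t: "t \<in> carrier G" "N #> t = N #> t1" and M: "open_normal G T M" "M \<subseteq> N"
    have "M1 #> t = M1 #> t1" using proj_mono[OF N(1) M1 N(2) t(1) t1(1) t(2)] .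
    then have "dom (M, t)" using M N(2) t(1) t1(2) by (auto simp: dom_def)
    then have le: "index M t \<le> index N t1" by (rule max)
    let ?c = "card (r_coset G M ` (P \<inter> N))" and ?d = "card (r_coset G M ` (overlap_pre M t \<inter> N))"
      and ?m = "card (overlap N (N #> t))"
    have fin: "finite (r_coset G M ` (P \<inter> N))"
      using finite_PQ[OF M(1)] by (rule finite_subset[rotated]) blast
    \<comment> \<open>\<open>PQ M\<close> is counted through its image modulo \<open>N\<close> and a
      kernel of order \<open>?c\<close>, the overlap likewise with a kernel of order
      \<open>?d\<close>. As the index does not grow, \<open>?c \<le> ?d\<close>.\<close>
    have "index N t1 * ?m * ?c = card (PQ N) * ?c"
      using card_PQ[OF N(1) t1(1)] t(2) by simp
    also have "\<dots> = card (PQ M)" using M(1) N(1) M(2) P_closed_subgroup(3) by (rule card_image_mult)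
    also have "\<dots> = index M t * card (overlap M (M #> t))" using M(1) t(1) by (rule card_PQ)
    also have "\<dots> \<le> index N t1 * card (overlap M (M #> t))" using le by (rule mult_right_mono) simp
    also have "card (overlap M (M #> t)) = card (r_coset G N ` overlap_pre M t) * ?d"
      using card_image_mult[OF M(1) N(1) M(2) subgroup_overlap_pre[OF M(1) t(1)]] by (simp add: image_overlap_pre)
    also have "card (r_coset G N ` overlap_pre M t) \<le> ?m"
    proof (rule card_mono)
      show "finite (overlap N (N #> t))" using finite_PQ[OF N(1)] by (simp add: overlap_def)
      show "r_coset G N ` overlap_pre M t \<subseteq> overlap N (N #> t)"
        using overlap_pre_mono[OF M(1) N(1) M(2) t(1)] by (auto simp: image_overlap_pre[symmetric])
    qed
    finally have "index N t1 * ?m * ?c \<le> index N t1 * ?m * ?d" by (simp add: mult.assoc)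
    moreover have "0 < index N t1 * ?m"
    proof -
      have "0 < card (PQ N)"
        using finite_PQ[OF N(1)] subgroup.one_closed[OF PQ_p_subgroup(2)[OF N(1)]] by (auto simp: card_gt_0_iff)
      then show ?thesis using card_PQ[OF N(1) t1(1)] t(2) by simp
    qed
    ultimately have "?c \<le> ?d" by simp
    moreover have "r_coset G M ` (overlap_pre M t \<inter> N) \<subseteq> r_coset G M ` (P \<inter> N)"
      by (auto simp: overlap_pre_def)
    ultimately have "r_coset G M ` (overlap_pre M t \<inter> N) = r_coset G M ` (P \<inter> N)"
      using fin by (intro card_seteq)
    then have "r_coset G M ` (P \<inter> N) \<subseteq> r_coset G M ` overlap_pre M t" by blast
    then show "r_coset G M ` (P \<inter> N) \<subseteq> conjugate (Q M) (M #> t) (PQ M)"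
      unfolding image_overlap_pre overlap_def by blast
  qed
qed

text \<open>Modulo each \<open>M\<close>, the image \<open>?W\<close> of \<open>P \<inter> N\<close>
  is fixed by the coset of \<open>t1\<close>, hence by the quotients of its elements, which fill
  \<open>N\<close>. As a normal Sylow subgroup of the image of \<open>N\<close> it contains every
  \<open>p\<close>-subgroup there, in particular its own conjugates under \<open>G\<close>.
  Closedness of \<open>P \<inter> N\<close> lifts this to \<open>G\<close>.\<close>

lemma ex_normal_open_in_P:
  obtains N where "open_normal G T N" "P \<inter> N \<lhd> G"
proof -
  obtain t1 N where N: "open_normal G T N" and t1: "t1 \<in> carrier G"
    and stable: "\<And>t M. t \<in> carrier G \<Longrightarrow> N #> t = N #> t1 \<Longrightarrow> open_normal G T M \<Longrightarrow> M \<subseteq> N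
      \<Longrightarrow> r_coset G M ` (P \<inter> N) \<subseteq> conjugate (Q M) (M #> t) (PQ M)"
    by (rule ex_stable_coset) (rule that)
  interpret N: open_quotient G T N using N by (rule open_quotientI)
  let ?V = "P \<inter> N"
  have sV: "subgroup ?V G" using P_closed_subgroup(3) N.is_subgroup by (rule subgroups_Inter_pair)
  have Vc: "?V \<subseteq> carrier G" using P_closed_subgroup(4) by blast
  have main: "conjugate (Q M) (M #> s) (r_coset G M ` ?V) \<subseteq> r_coset G M ` ?V"
    if M: "open_normal G T M" "M \<subseteq> N" and s: "s \<in> carrier G" for M s
  proof -
    interpret open_quotient G T M using M(1) by (rule open_quotientI)
    note PQ = PQ_p_subgroup[OF M(1)]
    let ?W = "r_coset G M ` ?V" and ?K = "r_coset G M ` N"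
    have WP: "?W \<subseteq> PQ M" by blast
    have finW: "finite ?W" using WP finite_PQ[OF M(1)] by (rule finite_subset)
    have sW: "subgroup ?W (Q M)" using proj.subgroup_img_is_subgroup[OF sV] .
    have Wc: "?W \<subseteq> carrier (Q M)" using sW by (rule subgroup.subset)
    have pW: "p_subgroup p (Q M) ?W"
      using PQ(1) sW WP p finite_PQ[OF M(1)] by (rule proj.H.p_subgroup_subset)
    have sK: "subgroup ?K (Q M)" using proj.subgroup_img_is_subgroup[OF N.is_subgroup] .
    have Kc: "?K \<subseteq> carrier (Q M)" using sK by (rule subgroup.subset)
    have finK: "finite ?K" using Kc finite_quotient by (rule finite_subset)
    have W_eq: "PQ M \<inter> ?K = ?W"
    proof
      show "PQ M \<inter> ?K \<subseteq> ?W"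
      proof
        fix c assume "c \<in> PQ M \<inter> ?K"
        then obtain x y where x: "x \<in> P" "c = M #> x" and y: "y \<in> N" "c = M #> y" by blast
        have xc: "x \<in> carrier G" and yc: "y \<in> carrier G"
          using x y P_closed_subgroup(4) N.subset by blast+
        have "N #> x = N #> y" using proj_mono[OF M(1) N M(2) xc yc] x(2) y(2) by simp
        then have "x \<in> N" using N.proj_eq_one_iff[OF xc] N.proj_eq_one_iff[OF yc] y(1) by simp
        then show "c \<in> ?W" using x by blast
      qed
    qed blast
    have K_conj: "conjugate (Q M) f ?K = ?K" if f: "f \<in> carrier (Q M)" for f
    proof -
      obtain g where g: "g \<in> carrier G" "f = M #> g" using quotient_cases[OF f] by blast
      have "conjugate G g N = N"
        using g(1) by (rule normal_conjugate_eq[OF N.normal_axioms])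
      then show ?thesis using proj.conjugate_image[OF g(1) N.subset] g(2) by simp
    qed
    have conj_int: "conjugate (Q M) f (PQ M) \<inter> ?K = conjugate (Q M) f ?W" if f: "f \<in> carrier (Q M)" for f
      using proj.H.conjugate_Int[OF f PQ(3) Kc] K_conj[OF f] W_eq by simp
    have fixed: "conjugate (Q M) (M #> t) ?W = ?W" if t: "t \<in> carrier G" "N #> t = N #> t1" for t
    proof -
      have q: "M #> t \<in> carrier (Q M)" using t(1) by (rule proj.hom_closed)
      have "?W \<subseteq> conjugate (Q M) (M #> t) (PQ M) \<inter> ?K" using stable[OF t M] by blast
      then have "?W \<subseteq> conjugate (Q M) (M #> t) ?W" using conj_int[OF q] by simp
      moreover have "finite (conjugate (Q M) (M #> t) ?W)" using finW by (simp add: conjugate_def)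
      ultimately have "?W = conjugate (Q M) (M #> t) ?W"
        using proj.H.card_conjugate[OF q Wc] by (intro card_seteq) simp_all
      then show ?thesis by (rule sym)
    qed
    have K_fixed: "conjugate (Q M) f ?W = ?W" if f: "f \<in> ?K" for f
    proof -
      obtain m where m: "m \<in> N" "f = M #> m" using f by blast
      have mc: "m \<in> carrier G" using m N.subset by blast
      have tm: "t1 \<otimes> m \<in> carrier G" using t1 mc by simp
      have q: "M #> t1 \<in> carrier (Q M)" "M #> m \<in> carrier (Q M)"
        using t1 mc by (auto intro: proj.hom_closed)
      have "t1 \<otimes> m \<otimes> inv t1 \<in> N" using N.inv_op_closed2[OF t1 m(1)] .
      then have "N #> (t1 \<otimes> m) = N #> t1" using N.proj_eq_iff[OF tm t1] by simp
      from fixed[OF tm this] have "conjugate (Q M) (M #> t1) (conjugate (Q M) (M #> m) ?W) = ?W"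
        using proj.hom_mult[OF t1 mc] proj.H.conjugate_conjugate[OF q Wc] by simp
      then have "conjugate (Q M) (M #> t1) (conjugate (Q M) (M #> m) ?W) = conjugate (Q M) (M #> t1) ?W"
        using fixed[OF t1 refl] by simp
      then have "conjugate (Q M) (inv\<^bsub>Q M\<^esub> (M #> t1)) (conjugate (Q M) (M #> t1) (conjugate (Q M) (M #> m) ?W))
          = conjugate (Q M) (inv\<^bsub>Q M\<^esub> (M #> t1)) (conjugate (Q M) (M #> t1) ?W)"
        by (rule arg_cong)
      then show ?thesis
        unfolding m(2)
        using proj.H.conjugate_inv_cancel(1)[OF q(1) Wc]
          proj.H.conjugate_inv_cancel(1)[OF q(1) proj.H.conjugate_closed[OF q(2) Wc]] by simp
    qed
    have maxW: "maximal_p_subgroup p (Q M) ?K ?W"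
      unfolding maximal_p_subgroup_def
    proof (intro conjI allI impI)
      fix A assume A: "p_subgroup p (Q M) A" "A \<subseteq> ?K" "?W \<subseteq> A"
      obtain f where f: "f \<in> carrier (Q M)" "A \<subseteq> conjugate (Q M) f (PQ M)"
        using proj.H.p_subgroup_subset_conjugate_maximal[OF proj.H.subgroup_self finite_quotient p
            PQ_maximal[OF M(1)] A(1)] A(2) Kc by blast
      \<comment> \<open>Inside the image of \<open>N\<close> the conjugate of \<open>PQ M\<close>
        shrinks to the conjugate of \<open>?W\<close>, so the order of \<open>A\<close> is at most
        that of \<open>?W\<close>.\<close>
      then have "A \<subseteq> conjugate (Q M) f ?W" using conj_int[OF f(1)] A(2) by blast
      moreover have "finite (conjugate (Q M) f ?W)" using finW by (simp add: conjugate_def)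
      ultimately have "card A \<le> card (conjugate (Q M) f ?W)" by (intro card_mono)
      then have "card A \<le> card ?W" unfolding proj.H.card_conjugate[OF f(1) Wc] .
      moreover have "finite A" using A(2) finK by (rule finite_subset)
      ultimately have "?W = A" using A(3) by (intro card_seteq)
      then show "A = ?W" by (rule sym)
    qed (use pW in auto)
    have q: "M #> s \<in> carrier (Q M)" using s by (rule proj.hom_closed)
    have "conjugate (Q M) (M #> s) ?W \<subseteq> conjugate (Q M) (M #> s) ?K"
      by (rule proj.H.conjugate_mono) blast
    then have sub: "conjugate (Q M) (M #> s) ?W \<subseteq> ?K" using K_conj[OF q] by simp
    obtain f where "f \<in> ?K" "conjugate (Q M) (M #> s) ?W \<subseteq> conjugate (Q M) f ?W"
      using proj.H.p_subgroup_subset_conjugate_maximal[OF sK finK p maxW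
          proj.H.p_subgroup_conjugate[OF pW q] sub] by blast
    then show ?thesis using K_fixed by simp
  qed
  have "closedin T ?V"
    using P_closed_subgroup(2) closedin_open_subgroup[OF N.is_subgroup] N
    by (auto simp: open_normal_def)
  then have conj: "conjugate G s ?V \<subseteq> ?V" if s: "s \<in> carrier G" for s
  proof (rule mem_closed_subset_if_quotients[OF _ conjugate_closed[OF s Vc] N])
    fix M assume M: "open_normal G T M" "M \<subseteq> N"
    interpret open_quotient G T M using M(1) by (rule open_quotientI)
    show "r_coset G M ` conjugate G s ?V \<subseteq> r_coset G M ` ?V"
      using main[OF M s] proj.conjugate_image[OF s Vc] by simp
  qed
  have "?V \<lhd> G"
    using sV conj by (intro normal_invI) (auto simp: conjugate_def)
  then show ?thesis using that N by blast
qed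

end

section \<open>The largest normal pro-\<open>p\<close> subgroup and the conclusion\<close>

text \<open>This is the preimage of the centralizer of the image of \<open>x\<close> in
  \<open>G Mod S\<close>.\<close>

lemma (in group) subgroup_commute_mod_normal:
  assumes S: "S \<lhd> G" and x: "x \<in> carrier G"
  shows "subgroup {t \<in> carrier G. t \<otimes> x \<otimes> inv t \<otimes> inv x \<in> S} G"
proof -
  interpret S: normal S G by (rule S)
  show ?thesis
  proof (rule subgroupI)
    show "{t \<in> carrier G. t \<otimes> x \<otimes> inv t \<otimes> inv x \<in> S} \<noteq> {}"
      using x S.one_closed by (auto intro!: exI[of _ \<one>])
    fix t assume t: "t \<in> {t \<in> carrier G. t \<otimes> x \<otimes> inv t \<otimes> inv x \<in> S}"
    then have tc: "t \<in> carrier G" and "inv (t \<otimes> x \<otimes> inv t \<otimes> inv x) \<in> S" by auto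
    then have "inv t \<otimes> inv (t \<otimes> x \<otimes> inv t \<otimes> inv x) \<otimes> t \<in> S"
      using S.inv_op_closed1 by blast
    then show "inv t \<in> {t \<in> carrier G. t \<otimes> x \<otimes> inv t \<otimes> inv x \<in> S}"
      using tc x by (simp add: inv_mult_group m_assoc inv_mult_cancel)
    fix s assume s: "s \<in> {t \<in> carrier G. t \<otimes> x \<otimes> inv t \<otimes> inv x \<in> S}"
    then have sc: "s \<in> carrier G" and 1: "t \<otimes> (s \<otimes> x \<otimes> inv s \<otimes> inv x) \<otimes> inv t \<in> S"
      using S.inv_op_closed2[OF tc] by auto
    have "t \<otimes> x \<otimes> inv t \<otimes> inv x \<in> S" using t by simp
    from S.m_closed[OF 1 this]
    show "t \<otimes> s \<in> {t \<in> carrier G. t \<otimes> x \<otimes> inv t \<otimes> inv x \<in> S}"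
      using tc sc x by (simp add: inv_mult_group m_assoc inv_mult_cancel)
  qed auto
qed

lemma (in group) commutator_eq_one_iff:
  assumes "t \<in> carrier G" "x \<in> carrier G"
  shows "t \<otimes> x \<otimes> inv t \<otimes> inv x = \<one> \<longleftrightarrow> t \<otimes> x = x \<otimes> t"
proof -
  have "t \<otimes> x = (t \<otimes> x \<otimes> inv t \<otimes> inv x) \<otimes> (x \<otimes> t)"
    using assms by (simp add: m_assoc inv_mult_cancel)
  then show ?thesis using assms by (metis m_closed inv_closed r_cancel_one')
qed

lemma (in group) subgroup_centralizer:
  assumes X: "X \<subseteq> carrier G"
  shows "subgroup (centralizer G X) G"
proof -
  let ?S = "insert (carrier G) ((\<lambda>x. {t \<in> carrier G. t \<otimes> x \<otimes> inv t \<otimes> inv x \<in> {\<one>}}) ` X)"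
  have "subgroup {t \<in> carrier G. t \<otimes> x \<otimes> inv t \<otimes> inv x \<in> {\<one>}} G" if "x \<in> X" for x
    using one_is_normal subsetD[OF X that] by (rule subgroup_commute_mod_normal)
  then have "subgroup (\<Inter>?S) G"
    using subgroup_self by (intro subgroups_Inter) blast+
  moreover have "\<Inter>?S = centralizer G X"
    using X commutator_eq_one_iff by (auto simp: centralizer_def)
  ultimately show ?thesis by simp
qed

lemma (in group) conjugate_eq_l_r_coset:
  "conjugate G g A = g <#\<^bsub>G\<^esub> A #> inv g"
  by (auto simp: conjugate_def l_coset_def r_coset_def)

lemma (in group) normalizer_eq:
  assumes "A \<subseteq> carrier G"
  shows "normalizer G A = normalizer_in G (carrier G) A"
  using assms by (simp add: normalizer_def stabilizer_def normalizer_in_def conjugate_eq_l_r_coset)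

text \<open>Since \<open>E\<close> contains \<open>M\<close>, its index is that of its image in
  \<open>G Mod M\<close>. In this form counts in finite quotients become the uniform bound for
  \<open>open_if_bounded_index\<close>.\<close>

lemma (in open_quotient) index_le_if_card_le:
  assumes E: "subgroup E G" "M \<subseteq> E" and b: "card (carrier (G Mod M)) \<le> b * card (r_coset G M ` E)"
  shows "card (rcosets E) \<le> b"
proof -
  let ?E = "r_coset G M ` E"
  have Ec: "E \<subseteq> carrier G" using E(1) by (rule subgroup.subset)
  have sE: "subgroup ?E (G Mod M)" using proj.subgroup_img_is_subgroup[OF E(1)] .
  have finE: "finite ?E" using finite_subset[OF subgroup.subset[OF sE] finite_quotient] .
  have fin: "finite (rcosets\<^bsub>G Mod M\<^esub> ?E)"
    using finite_quotient by (simp add: RCOSETS_def)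
  have "rcosets E = (\<lambda>x. E #> x) ` carrier G" by (auto simp: RCOSETS_def)
  moreover have sub: "(\<lambda>x. ?E #>\<^bsub>G Mod M\<^esub> (M #> x)) ` carrier G \<subseteq> rcosets\<^bsub>G Mod M\<^esub> ?E"
  proof (rule image_subsetI)
    fix x assume "x \<in> carrier G"
    from proj.hom_closed[OF this]
    show "?E #>\<^bsub>G Mod M\<^esub> (M #> x) \<in> rcosets\<^bsub>G Mod M\<^esub> ?E" unfolding RCOSETS_def[of "G Mod M"] by blast
  qed
  moreover have "card ((\<lambda>x. E #> x) ` carrier G) \<le> card ((\<lambda>x. ?E #>\<^bsub>G Mod M\<^esub> (M #> x)) ` carrier G)"
  proof (rule card_image_le_if[OF finite_subset[OF sub fin]])
    fix x y assume xy: "x \<in> carrier G" "y \<in> carrier G"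
      and eq: "?E #>\<^bsub>G Mod M\<^esub> (M #> x) = ?E #>\<^bsub>G Mod M\<^esub> (M #> y)"
    have "(M #> x) \<otimes>\<^bsub>G Mod M\<^esub> inv\<^bsub>G Mod M\<^esub> (M #> y) \<in> ?E"
      using proj.H.r_coset_eq_iff[OF sE proj.hom_closed[OF xy(1)] proj.hom_closed[OF xy(2)]] eq by blast
    moreover have "(M #> x) \<otimes>\<^bsub>G Mod M\<^esub> inv\<^bsub>G Mod M\<^esub> (M #> y) = M #> (x \<otimes> inv y)"
      using proj.hom_mult[OF xy(1) inv_closed[OF xy(2)]] proj.hom_inv[OF xy(2)] by simp
    ultimately obtain e where e: "e \<in> E" "M #> (x \<otimes> inv y) = M #> e" by auto
    have ec: "e \<in> carrier G" using e(1) Ec by blast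
    have "x \<otimes> inv y \<otimes> inv e \<in> E"
      using proj_eq_iff[of "x \<otimes> inv y" e] e(2) ec xy E(2) by auto
    then have "x \<otimes> inv y \<otimes> inv e \<otimes> e \<in> E" using e(1) by (rule subgroup.m_closed[OF E(1)])
    then have "x \<otimes> inv y \<in> E" using xy ec by (simp add: m_assoc)
    then show "E #> x = E #> y" using r_coset_eq_iff[OF E(1) xy] by simp
  qed
  moreover have "card ((\<lambda>x. ?E #>\<^bsub>G Mod M\<^esub> (M #> x)) ` carrier G) \<le> card (rcosets\<^bsub>G Mod M\<^esub> ?E)"
    using fin sub by (rule card_mono)
  ultimately have le: "card (rcosets E) \<le> card (rcosets\<^bsub>G Mod M\<^esub> ?E)" by simp
  have "card (rcosets\<^bsub>G Mod M\<^esub> ?E) * card ?E \<le> b * card ?E"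
    using proj.H.lagrange[OF sE] b by (simp add: order_def)
  moreover have "0 < card ?E" using finE subgroup.one_closed[OF sE] by (auto simp: card_gt_0_iff)
  ultimately show ?thesis using le by simp
qed

section \<open>The core of \<open>P\<close> and its finite index\<close>

context positive_nilpotentizers
begin

text \<open>Turns out to be \<open>O_p(G)\<close>; as an explicit intersection of conjugates it is
  visibly normal and closed.\<close>

definition core where
  "core = (\<Inter>s\<in>carrier G. conjugate G s P)"

lemma core_subset: "core \<subseteq> P"
  using conjugate_one[OF P_closed_subgroup(4)] by (auto simp: core_def)

lemma core_normal: "core \<lhd> G"
proof (rule normal_invI)
  have "subgroup (\<Inter>((\<lambda>s. conjugate G s P) ` carrier G)) G"
    by (rule subgroups_Inter) (use conjugate_subgroup P_closed_subgroup(3) in auto)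
  then show sub: "subgroup core G" by (simp add: core_def)
  fix g x assume g: "g \<in> carrier G" and x: "x \<in> core"
  have xc: "x \<in> carrier G" using subgroup.mem_carrier[OF sub x] .
  have "g \<otimes> x \<otimes> inv g \<in> conjugate G s P" if s: "s \<in> carrier G" for s
  proof -
    have gs: "inv g \<otimes> s \<in> carrier G" using g s by simp
    then have "x \<in> conjugate G (inv g \<otimes> s) P" using x by (simp add: core_def)
    then have "g \<otimes> x \<otimes> inv g \<in> conjugate G g (conjugate G (inv g \<otimes> s) P)"
      by (auto simp: conjugate_def[of G g])
    also have "\<dots> = conjugate G s P"
      using conjugate_conjugate[OF g gs P_closed_subgroup(4)] g s by (simp add: inv_mult_cancel)
    finally show ?thesis .
  qed
  then show "g \<otimes> x \<otimes> inv g \<in> core" by (simp add: core_def)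
qed

lemma closedin_core: "closedin T core"
  unfolding core_def using one_closed closedin_conjugate P_closed_subgroup(2)
  by (intro closedin_INT) auto

lemma normal_subset_core:
  assumes N: "N \<lhd> G" and NP: "N \<subseteq> P"
  shows "N \<subseteq> core"
proof -
  have "N \<subseteq> conjugate G s P" if s: "s \<in> carrier G" for s
    using conjugate_mono[OF NP, of s] normal_conjugate_eq[OF N s] by simp
  then show ?thesis by (auto simp: core_def)
qed

lemma core_pro_p: "closed_pro_p_subgroup p G T core"
proof -
  have sub: "subgroup core G" using core_normal by (simp add: normal_def)
  then have cl: "closed_subgroup G T core" using closedin_core by (simp add: closed_subgroup_def)
  have "p_subgroup p (Q M) (r_coset G M ` core)" if M: "open_normal G T M" for M
  proof -
    interpret open_quotient G T M using M by (rule open_quotientI)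
    show ?thesis
      using PQ_p_subgroup(1)[OF M] proj.subgroup_img_is_subgroup[OF sub] image_mono[OF core_subset] p
        finite_PQ[OF M]
      by (rule proj.H.p_subgroup_subset)
  qed
  then show ?thesis using cl pro_p_group_iff[OF cl p] by (simp add: closed_pro_p_subgroup_def)
qed

text \<open>Modulo \<open>M\<close> the image of \<open>N\<close> is a normal
  \<open>p\<close>-subgroup. It lies in a conjugate of the Sylow subgroup \<open>PQ M\<close>, hence
  by normality in \<open>PQ M\<close> itself; and \<open>P\<close> is closed.\<close>

lemma normal_pro_p_subset_core:
  assumes N: "N \<lhd> G" and pN: "closed_pro_p_subgroup p G T N"
  shows "N \<subseteq> core"
proof (rule normal_subset_core[OF N])
  have cl: "closed_subgroup G T N" using pN by (simp add: closed_pro_p_subgroup_def)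
  have sN: "subgroup N G" using cl by (simp add: closed_subgroup_def)
  have Nc: "N \<subseteq> carrier G" using sN by (rule subgroup.subset)
  show "N \<subseteq> P"
  proof (rule mem_closed_subset_if_quotients[OF P_closed_subgroup(2) Nc open_normal_carrier])
    fix M assume M: "open_normal G T M"
    interpret open_quotient G T M using M by (rule open_quotientI)
    let ?N = "r_coset G M ` N"
    have pNM: "p_subgroup p (Q M) ?N"
      using pN pro_p_group_iff[OF cl p] M by (simp add: closed_pro_p_subgroup_def)
    have NQ: "?N \<subseteq> carrier (Q M)" using proj.subgroup_img_is_subgroup[OF sN] by (rule subgroup.subset)
    obtain c where c: "c \<in> carrier (Q M)" "?N \<subseteq> conjugate (Q M) c (PQ M)"
      using proj.H.p_subgroup_subset_conjugate_maximal[OF proj.H.subgroup_self finite_quotient p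
          PQ_maximal[OF M] pNM NQ] by blast
    obtain g where g: "g \<in> carrier G" "c = M #> g" using quotient_cases[OF c(1)] by blast
    have "?N = conjugate (Q M) (M #> inv g) ?N"
      using proj.conjugate_image[OF inv_closed[OF g(1)] Nc] normal_conjugate_eq[OF N inv_closed[OF g(1)]] by simp
    also have "\<dots> = conjugate (Q M) (inv\<^bsub>Q M\<^esub> c) ?N" using proj.hom_inv[OF g(1)] g(2) by simp
    also have "\<dots> \<subseteq> conjugate (Q M) (inv\<^bsub>Q M\<^esub> c) (conjugate (Q M) c (PQ M))"
      using c(2) by (rule proj.H.conjugate_mono)
    also have "\<dots> = PQ M" using c(1) PQ_p_subgroup(3)[OF M] by (rule proj.H.conjugate_inv_cancel)
    finally show "?N \<subseteq> PQ M" .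
  qed
qed

lemma p_core_eq: "p_core p G T = core"
  unfolding p_core_def
  using core_normal core_pro_p normal_pro_p_subset_core by (intro Greatest_equality) auto

text \<open>\<open>P \<inter> N\<close> is normal in \<open>G\<close>, hence inside the core, and
  \<open>P\<close> meets only finitely many cosets of \<open>N\<close>.\<close>

lemma ex_finite_representatives:
  obtains W where "finite W" "W \<subseteq> P" "P = (\<Union>w\<in>W. core #> w)"
proof -
  obtain N where N: "open_normal G T N" "P \<inter> N \<lhd> G" by (rule ex_normal_open_in_P) (rule that)
  have VD: "P \<inter> N \<subseteq> core" using normal_subset_core[OF N(2)] by simp
  interpret open_quotient G T N using N(1) by (rule open_quotientI)
  define r where "r C = (SOME w. w \<in> P \<and> N #> w = C)" for C
  have r: "r C \<in> P \<and> N #> r C = C" if C: "C \<in> PQ N" for C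
    unfolding r_def by (rule someI_ex) (use C in blast)
  let ?W = "r ` PQ N"
  have W: "?W \<subseteq> P" using r by blast
  have P: "P \<subseteq> carrier G" by (rule P_closed_subgroup)
  have "x \<in> (\<Union>w\<in>?W. core #> w)" if x: "x \<in> P" for x
  proof -
    let ?w = "r (N #> x)"
    have w: "?w \<in> P" "N #> ?w = N #> x" using r x by blast+
    have c: "x \<in> carrier G" "?w \<in> carrier G" using x w P by auto
    have "x \<otimes> inv ?w \<in> N" using proj_eq_iff[OF c] w(2) by simp
    moreover have "x \<otimes> inv ?w \<in> P"
      by (rule subgroup.m_closed[OF P_closed_subgroup(3) x subgroup.m_inv_closed[OF P_closed_subgroup(3) w(1)]])
    ultimately have "x \<otimes> inv ?w \<in> core" using VD by blast
    then have "x \<otimes> inv ?w \<otimes> ?w \<in> core #> ?w" by (auto simp: r_coset_def)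
    then have "x \<in> core #> ?w" using c by (simp add: m_assoc)
    then show ?thesis using x by blast
  qed
  moreover have "core #> w \<subseteq> P" if "w \<in> P" for w
    using that core_subset subgroup.m_closed[OF P_closed_subgroup(3)] by (auto simp: r_coset_def)
  ultimately have "P = (\<Union>w\<in>?W. core #> w)" using W by blast
  moreover have "finite ?W" using finite_PQ[OF N(1)] by (rule finite_imageI)
  ultimately show ?thesis using that W by blast
qed

lemma finite_quotient_core: "finite (carrier ((G\<lparr>carrier := P\<rparr>) Mod core))"
proof -
  obtain W where W: "finite W" "W \<subseteq> P" "P = (\<Union>w\<in>W. core #> w)"
    by (rule ex_finite_representatives) (rule that)
  have sub: "subgroup core G" using core_normal by (simp add: normal_def)
  have "r_coset G core ` P \<subseteq> r_coset G core ` W"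
  proof (rule image_subsetI)
    fix x assume "x \<in> P"
    then obtain w where w: "w \<in> W" "x \<in> core #> w" using W(3) by blast
    have "w \<in> carrier G" using w W(2) P_closed_subgroup(4) by blast
    then have "core #> x = core #> w" using repr_independence[OF w(2) _ sub] by simp
    then show "core #> x \<in> r_coset G core ` W" using w(1) by blast
  qed
  then have "finite (r_coset G core ` P)" using W(1) finite_surj by blast
  then show ?thesis by (simp add: carrier_FactGroup r_coset_restrict)
qed

section \<open>Open subgroups from indices bounded modulo every \<open>M\<close>\<close>

lemma ex_bound:
  assumes x: "x \<in> P"
  obtains n where "\<And>M. open_normal G T M \<Longrightarrow> card (carrier (Q M)) \<le> n * card (r_coset G M ` nilpotentizer G T x)"
    "\<And>M. open_normal G T M \<Longrightarrow> card (carrier (Q M)) \<le> n * conj_count M (M #> x)"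
proof -
  obtain n where n: "\<forall>M. open_normal G T M \<longrightarrow> card (carrier (Q M)) \<le> n * card (r_coset G M ` nilpotentizer G T x)"
    using ex_nilpotentizer_bound[OF x] by blast
  show ?thesis
  proof (rule that[of n])
    fix M assume M: "open_normal G T M"
    then show le: "card (carrier (Q M)) \<le> n * card (r_coset G M ` nilpotentizer G T x)" using n by blast
    also have "\<dots> \<le> n * conj_count M (M #> x)"
      using card_nilpotentizer_le[OF M x] by (rule mult_left_mono) simp
    finally show "card (carrier (Q M)) \<le> n * conj_count M (M #> x)" .
  qed
qed

text \<open>\<open>E M\<close> is the preimage of the centralizer of \<open>x\<close> modulo
  \<open>D\<close> and \<open>M\<close>. If the conjugate of \<open>PQ M\<close> by \<open>t\<close>
  contains the image of \<open>x\<close>, then \<open>inv t \<otimes> x \<otimes> t\<close> is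
  congruent to an element of some \<open>D #> w\<close>, and two such \<open>t\<close> with the same
  \<open>w\<close> differ by an element of \<open>E M\<close>. So the index of \<open>E M\<close> is
  at most \<open>n * card W\<close> for all \<open>M\<close>, and some open \<open>M\<close> lies in
  every \<open>E N\<close>. \<open>D\<close> is kept general to cover both the core and the trivial
  subgroup.\<close>

lemma ex_open_commutators_in:
  assumes D: "D \<lhd> G" "closedin T D" and W: "finite W" "W \<subseteq> P" "P \<subseteq> (\<Union>w\<in>W. D #> w)" and x: "x \<in> P"
  shows "\<exists>M. open_normal G T M \<and> (\<forall>t\<in>M. t \<otimes> x \<otimes> inv t \<otimes> inv x \<in> D)"
proof -
  interpret D: normal D G by (rule D(1))
  have xc: "x \<in> carrier G" using x P_closed_subgroup(4) by blast
  \<comment> \<open>\<open>S M\<close> is the product of \<open>D\<close> and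
    \<open>M\<close>.\<close>
  define S where "S M = {y \<in> carrier G. M #> y \<in> r_coset G M ` D}" for M
  define E where "E M = {t \<in> carrier G. t \<otimes> x \<otimes> inv t \<otimes> inv x \<in> S M}" for M
  obtain n where n: "\<And>M. open_normal G T M \<Longrightarrow> card (carrier (Q M)) \<le> n * conj_count M (M #> x)"
    by (rule ex_bound[OF x]) (rule that)
  have S_normal: "S M \<lhd> G" if M: "open_normal G T M" for M
  proof -
    interpret open_quotient G T M using M by (rule open_quotientI)
    have sD: "subgroup (r_coset G M ` D) (Q M)" using proj.subgroup_img_is_subgroup[OF D.is_subgroup] .
    show ?thesis
    proof (rule normal_invI)
      show "subgroup (S M) G" unfolding S_def using sD by (rule proj.subgroup_preimage)
      fix g a assume g: "g \<in> carrier G" and a: "a \<in> S M"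
      then obtain d where d: "d \<in> D" "M #> a = M #> d" and ac: "a \<in> carrier G" by (auto simp: S_def)
      have dc: "d \<in> carrier G" using d(1) D.subset by blast
      have "M #> (g \<otimes> a \<otimes> inv g) = M #> (g \<otimes> d \<otimes> inv g)"
        using proj.hom_mult[of "g \<otimes> a" "inv g"] proj.hom_mult[of g a] proj.hom_mult[of "g \<otimes> d" "inv g"]
          proj.hom_mult[of g d] g ac dc d(2) by simp
      moreover have "g \<otimes> d \<otimes> inv g \<in> D" using D.inv_op_closed2[OF g d(1)] .
      ultimately show "g \<otimes> a \<otimes> inv g \<in> S M" using g ac by (auto simp: S_def)
    qed
  qed
  have E_sub: "subgroup (E M) G" if M: "open_normal G T M" for M
    unfolding E_def using S_normal[OF M] xc by (rule subgroup_commute_mod_normal)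
  have ME: "M \<subseteq> E M" if M: "open_normal G T M" for M
  proof
    interpret open_quotient G T M using M by (rule open_quotientI)
    fix t assume t: "t \<in> M"
    have tc: "t \<in> carrier G" using t subset by blast
    have "t \<otimes> (x \<otimes> inv t \<otimes> inv x) \<in> M"
      using m_closed[OF t inv_op_closed2[OF xc m_inv_closed[OF t]]] .
    then have "t \<otimes> x \<otimes> inv t \<otimes> inv x \<in> M" using tc xc by (simp add: m_assoc)
    moreover have c: "t \<otimes> x \<otimes> inv t \<otimes> inv x \<in> carrier G" using tc xc by simp
    ultimately have "M #> (t \<otimes> x \<otimes> inv t \<otimes> inv x) = M #> \<one>"
      using proj_eq_one_iff coset_mult_one[OF subset] by (simp only:)
    then have "M #> (t \<otimes> x \<otimes> inv t \<otimes> inv x) \<in> r_coset G M ` D"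
      using imageI[OF D.one_closed, of "r_coset G M"] by (simp only:)
    then show "t \<in> E M" unfolding E_def S_def using tc c by blast
  qed
  have mono: "E N \<subseteq> E M" if M: "open_normal G T M" and N: "open_normal G T N" and NM: "N \<subseteq> M" for M N
  proof
    fix t assume t: "t \<in> E N"
    let ?y = "t \<otimes> x \<otimes> inv t \<otimes> inv x"
    obtain d where d: "t \<in> carrier G" "?y \<in> carrier G" "d \<in> D" "N #> ?y = N #> d"
      using t by (auto simp: E_def S_def)
    have "d \<in> carrier G" using d(3) D.subset by blast
    then have "M #> ?y = M #> d" using proj_mono[OF N M NM d(2) _ d(4)] by blast
    then show "t \<in> E M" using d by (auto simp: E_def S_def)
  qed
  have bound: "card (rcosets (E M)) \<le> n * card W" if M: "open_normal G T M" for M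
  proof -
    interpret open_quotient G T M using M by (rule open_quotientI)
    let ?E = "r_coset G M ` E M"
    let ?A = "\<lambda>w. {c \<in> carrier (Q M). \<exists>t\<in>carrier G. \<exists>d\<in>D. c = M #> t \<and> M #> (inv t \<otimes> x \<otimes> t) = M #> (d \<otimes> w)}"
    have finE: "finite ?E"
      using finite_subset[OF subgroup.subset[OF proj.subgroup_img_is_subgroup[OF E_sub[OF M]]] finite_quotient] .
    have cardA: "card (?A w) \<le> card ?E" if w: "w \<in> W" for w
    proof (cases "?A w = {}")
      case False
      have wc: "w \<in> carrier G" using w W(2) P_closed_subgroup(4) by blast
      obtain s d' where s: "s \<in> carrier G" "d' \<in> D" "M #> (inv s \<otimes> x \<otimes> s) = M #> (d' \<otimes> w)"
        using False by blast
      show ?thesis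
      proof (rule card_inj_on_le[OF _ _ finE])
        show "inj_on (\<lambda>c. c \<otimes>\<^bsub>Q M\<^esub> inv\<^bsub>Q M\<^esub> (M #> s)) (?A w)"
        proof (rule inj_onI)
          fix a b assume "a \<in> ?A w" "b \<in> ?A w"
            and eq: "a \<otimes>\<^bsub>Q M\<^esub> inv\<^bsub>Q M\<^esub> (M #> s) = b \<otimes>\<^bsub>Q M\<^esub> inv\<^bsub>Q M\<^esub> (M #> s)"
          then have "a \<in> carrier (Q M)" "b \<in> carrier (Q M)" by blast+
          then show "a = b"
            using eq proj.H.right_cancel[OF proj.H.inv_closed[OF proj.hom_closed[OF s(1)]]] by blast
        qed
        show "(\<lambda>c. c \<otimes>\<^bsub>Q M\<^esub> inv\<^bsub>Q M\<^esub> (M #> s)) ` ?A w \<subseteq> ?E"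
        proof (rule image_subsetI)
          fix c assume "c \<in> ?A w"
          then obtain t d where t: "t \<in> carrier G" "d \<in> D" "c = M #> t" "M #> (inv t \<otimes> x \<otimes> t) = M #> (d \<otimes> w)"
            by blast
          let ?r = "t \<otimes> inv s"
          have dc: "d \<in> carrier G" "d' \<in> carrier G" using t(2) s(2) D.subset by blast+
          have rc: "?r \<in> carrier G" using t s by simp
          have S1: "inv s \<otimes> x \<otimes> s \<otimes> inv (d' \<otimes> w) \<in> M"
            using proj_eq_iff[of "inv s \<otimes> x \<otimes> s" "d' \<otimes> w"] s wc dc xc by simp
          have S2: "inv t \<otimes> x \<otimes> t \<otimes> inv (d \<otimes> w) \<in> M"
            using proj_eq_iff[of "inv t \<otimes> x \<otimes> t" "d \<otimes> w"] t wc dc xc by simp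
          \<comment> \<open>The discrepancies of the two congruences. Both lie in \<open>M\<close>,
            so modulo \<open>M\<close> the commutator of \<open>?r\<close> and \<open>x\<close>
            becomes a conjugate of \<open>d' \<otimes> inv d\<close>.\<close>
          define a b where "a = inv s \<otimes> x \<otimes> s \<otimes> inv (d' \<otimes> w)" and "b = inv t \<otimes> x \<otimes> t \<otimes> inv (d \<otimes> w)"
          have ab: "a \<in> M" "b \<in> M" using S1 S2 by (simp_all add: a_def b_def)
          have abc: "a \<in> carrier G" "b \<in> carrier G" using ab subset by blast+
          have e1: "inv s \<otimes> x \<otimes> s = a \<otimes> (d' \<otimes> w)"
            using s wc dc xc by (simp add: a_def m_assoc)
          have e2: "inv t \<otimes> x \<otimes> t = b \<otimes> (d \<otimes> w)"
            using t wc dc xc by (simp add: b_def m_assoc)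
          have "t \<otimes> inv s \<otimes> x \<otimes> s \<otimes> inv t \<otimes> inv x = t \<otimes> (inv s \<otimes> x \<otimes> s) \<otimes> inv (inv t \<otimes> x \<otimes> t) \<otimes> inv t"
            using t(1) s(1) xc by (simp add: m_assoc inv_mult_group inv_mult_cancel)
          also have "\<dots> = t \<otimes> (a \<otimes> (d' \<otimes> inv d) \<otimes> inv b) \<otimes> inv t"
            unfolding e1 e2 using t(1) abc dc wc by (simp add: m_assoc inv_mult_group inv_mult_cancel)
          finally have r_eq: "?r \<otimes> x \<otimes> inv ?r \<otimes> inv x = t \<otimes> (a \<otimes> (d' \<otimes> inv d) \<otimes> inv b) \<otimes> inv t"
            using t(1) s(1) xc by (simp add: m_assoc inv_mult_group)
          have "d' \<otimes> inv d \<in> D" using s(2) t(2) by (intro D.m_closed D.m_inv_closed)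
          moreover have "M #> (a \<otimes> (d' \<otimes> inv d) \<otimes> inv b) = M #> (d' \<otimes> inv d)"
          proof -
            have 1: "M #> a = \<one>\<^bsub>Q M\<^esub>" "M #> inv b = \<one>\<^bsub>Q M\<^esub>"
              unfolding one_FactGroup
              using proj_eq_one_iff[OF abc(1)] proj_eq_one_iff[OF inv_closed[OF abc(2)]] ab(1) m_inv_closed[OF ab(2)]
              by blast+
            have "M #> (a \<otimes> (d' \<otimes> inv d) \<otimes> inv b) = (M #> a) \<otimes>\<^bsub>Q M\<^esub> (M #> (d' \<otimes> inv d)) \<otimes>\<^bsub>Q M\<^esub> (M #> inv b)"
              using proj.hom_mult[of "a \<otimes> (d' \<otimes> inv d)" "inv b"] proj.hom_mult[of a "d' \<otimes> inv d"] abc dc by simp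
            also have "\<dots> = M #> (d' \<otimes> inv d)"
              unfolding 1 using proj.hom_closed[of "d' \<otimes> inv d"] dc
                proj.H.l_one[of "M #> (d' \<otimes> inv d)"] proj.H.r_one[of "M #> (d' \<otimes> inv d)"] by simp
            finally show ?thesis .
          qed
          moreover have "a \<otimes> (d' \<otimes> inv d) \<otimes> inv b \<in> carrier G" using abc dc by simp
          ultimately have "a \<otimes> (d' \<otimes> inv d) \<otimes> inv b \<in> S M" unfolding S_def by blast
          then have "t \<otimes> (a \<otimes> (d' \<otimes> inv d) \<otimes> inv b) \<otimes> inv t \<in> S M"
            using normal.inv_op_closed2[OF S_normal[OF M] t(1)] by blast
          then have "?r \<in> E M" unfolding E_def using rc r_eq by simp
          moreover have "c \<otimes>\<^bsub>Q M\<^esub> inv\<^bsub>Q M\<^esub> (M #> s) = M #> ?r"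
            using proj.hom_mult[OF t(1) inv_closed[OF s(1)]] proj.hom_inv[OF s(1)] t(3) by simp
          ultimately show "c \<otimes>\<^bsub>Q M\<^esub> inv\<^bsub>Q M\<^esub> (M #> s) \<in> ?E" by blast
        qed
      qed
    next
      case True
      then show ?thesis by (simp only: card.empty)
    qed
    have "{t \<in> carrier (Q M). M #> x \<in> conjugate (Q M) t (PQ M)} \<subseteq> (\<Union>w\<in>W. ?A w)"
    proof
      fix c assume "c \<in> {t \<in> carrier (Q M). M #> x \<in> conjugate (Q M) t (PQ M)}"
      then have c: "c \<in> carrier (Q M)" "M #> x \<in> conjugate (Q M) c (PQ M)" by auto
      obtain t where t: "t \<in> carrier G" "c = M #> t" using quotient_cases[OF c(1)] by blast
      have "inv\<^bsub>Q M\<^esub> c \<otimes>\<^bsub>Q M\<^esub> (M #> x) \<otimes>\<^bsub>Q M\<^esub> c \<in> PQ M"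
        using proj.H.mem_conjugate_iff[OF c(1) proj.hom_closed[OF xc] PQ_p_subgroup(3)[OF M]] c(2) by blast
      moreover have "inv\<^bsub>Q M\<^esub> c \<otimes>\<^bsub>Q M\<^esub> (M #> x) \<otimes>\<^bsub>Q M\<^esub> c = M #> (inv t \<otimes> x \<otimes> t)"
        using proj.hom_mult[of "inv t \<otimes> x" t] proj.hom_mult[of "inv t" x] proj.hom_inv[of t] t xc by simp
      ultimately obtain q where q: "q \<in> P" "M #> (inv t \<otimes> x \<otimes> t) = M #> q" by auto
      then obtain w where w: "w \<in> W" "q \<in> D #> w" using W(3) by blast
      then obtain d where "d \<in> D" "q = d \<otimes> w" by (auto simp: r_coset_def)
      then have "c \<in> ?A w" using c(1) t q(2) by blast
      then show "c \<in> (\<Union>w\<in>W. ?A w)" using w(1) by blast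
    qed
    then have "conj_count M (M #> x) \<le> card (\<Union>w\<in>W. ?A w)"
      unfolding conj_count_def using W(1) finite_quotient by (intro card_mono) auto
    also have "\<dots> \<le> (\<Sum>w\<in>W. card (?A w))" using W(1) by (rule card_UN_le)
    also have "\<dots> \<le> card W * card ?E" using sum_bounded_above[of W "\<lambda>w. card (?A w)", OF cardA] by simp
    finally have "n * conj_count M (M #> x) \<le> n * (card W * card ?E)" by (rule mult_left_mono) simp
    with n[OF M] have "card (carrier (Q M)) \<le> n * card W * card ?E" unfolding mult.assoc by (rule order_trans)
    then show ?thesis using E_sub[OF M] ME[OF M] by (intro index_le_if_card_le)
  qed
  have "\<exists>M. open_normal G T M \<and> (\<forall>N. open_normal G T N \<longrightarrow> E M \<subseteq> E N)"
    using E_sub ME mono bound by (rule open_if_bounded_index)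
  then obtain M where M: "open_normal G T M" "\<And>N. open_normal G T N \<Longrightarrow> E M \<subseteq> E N" by blast
  have "t \<otimes> x \<otimes> inv t \<otimes> inv x \<in> D" if t: "t \<in> M" for t
  proof (rule mem_closed_if_mem_quotients[OF D(2) _ open_normal_carrier])
    show "t \<otimes> x \<otimes> inv t \<otimes> inv x \<in> carrier G" using t xc open_normal_subset[OF M(1)] by auto
    show "N #> (t \<otimes> x \<otimes> inv t \<otimes> inv x) \<in> r_coset G N ` D" if N: "open_normal G T N" for N
      using t ME[OF M(1)] M(2)[OF N] by (auto simp: E_def S_def)
  qed
  then show ?thesis using M(1) by blast
qed

lemma ex_open_commutators_in_core:
  "x \<in> P \<Longrightarrow> \<exists>M. open_normal G T M \<and> (\<forall>t\<in>M. t \<otimes> x \<otimes> inv t \<otimes> inv x \<in> core)"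
proof -
  assume x: "x \<in> P"
  obtain W where W: "finite W" "W \<subseteq> P" "P = (\<Union>w\<in>W. core #> w)"
    by (rule ex_finite_representatives) (rule that)
  show ?thesis
    using core_normal closedin_core W(1,2) equalityD1[OF W(3)] x by (rule ex_open_commutators_in)
qed

text \<open>For \<open>x = d \<otimes> w\<close> with \<open>d\<close> in the core, conjugation by
  \<open>t\<close> moves \<open>d\<close> within the core and multiplies \<open>w\<close> by a
  commutator in the core. Only the finitely many \<open>w\<close> in \<open>W\<close> impose a
  condition on \<open>t\<close>, so finitely many open subgroups are intersected.\<close>

lemma ex_open_subset_normalizer:
  obtains M where "open_normal G T M" "\<And>t. t \<in> M \<Longrightarrow> conjugate G t P = P"
proof -
  obtain W where W: "finite W" "W \<subseteq> P" "P = (\<Union>w\<in>W. core #> w)"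
    by (rule ex_finite_representatives) (rule that)
  have "\<forall>w\<in>W. \<exists>M. open_normal G T M \<and> (\<forall>t\<in>M. t \<otimes> w \<otimes> inv t \<otimes> inv w \<in> core)"
    using ex_open_commutators_in_core W(2) by blast
  then obtain f where f: "\<And>w. w \<in> W \<Longrightarrow> open_normal G T (f w)"
    "\<And>w t. w \<in> W \<Longrightarrow> t \<in> f w \<Longrightarrow> t \<otimes> w \<otimes> inv t \<otimes> inv w \<in> core"
    by metis
  define M where "M = carrier G \<inter> \<Inter>(f ` W)"
  have M: "open_normal G T M" unfolding M_def using W(1) f(1) by (intro open_normal_Inter) auto
  interpret core: normal core G by (rule core_normal)
  note P = P_closed_subgroup(3,4)
  have sub: "conjugate G t P \<subseteq> P" if t: "t \<in> M" for t
  proof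
    fix y assume "y \<in> conjugate G t P"
    then obtain x where x: "x \<in> P" "y = t \<otimes> x \<otimes> inv t" by (auto simp: conjugate_def)
    then obtain w where w: "w \<in> W" "x \<in> core #> w" using W(3) by blast
    then obtain d where d: "d \<in> core" "x = d \<otimes> w" unfolding r_coset_def by blast
    have c: "t \<in> carrier G" "w \<in> carrier G" "d \<in> carrier G"
      using t w W(2) P(2) d(1) core.subset by (auto simp: M_def)
    have "t \<otimes> w \<otimes> inv t \<otimes> inv w \<in> P" using f(2)[OF w(1), of t] t w core_subset by (auto simp: M_def)
    then have 1: "t \<otimes> w \<otimes> inv t \<otimes> inv w \<otimes> w \<in> P"
      using subsetD[OF W(2) w(1)] by (rule subgroup.m_closed[OF P(1)])
    have "t \<otimes> d \<otimes> inv t \<in> P" using core.inv_op_closed2[OF c(1) d(1)] core_subset by blast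
    from subgroup.m_closed[OF P(1) this 1] show "y \<in> P"
      using c x(2) d(2) by (simp add: m_assoc inv_mult_cancel)
  qed
  have "conjugate G t P = P" if t: "t \<in> M" for t
  proof -
    have tc: "t \<in> carrier G" using t by (simp add: M_def)
    have "inv t \<in> M" using subgroup.m_inv_closed[OF open_normal_subgroup[OF M] t] .
    from conjugate_mono[OF sub[OF this], of t] have "P \<subseteq> conjugate G t P"
      using conjugate_inv_cancel(2)[OF tc P(2)] by simp
    then show ?thesis using sub[OF t] by blast
  qed
  then show ?thesis using that M by blast
qed

lemma normalizer_open:
  shows "subgroup (normalizer G P) G" "openin T (normalizer G P)"
proof -
  note eq = normalizer_eq[OF P_closed_subgroup(4)]
  show sub: "subgroup (normalizer G P) G"
    unfolding eq using subgroup_self P_closed_subgroup(4) by (rule subgroup_normalizer_in)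
  obtain M where M: "open_normal G T M" "\<And>t. t \<in> M \<Longrightarrow> conjugate G t P = P"
    by (rule ex_open_subset_normalizer) (rule that)
  show "openin T (normalizer G P)"
  proof (rule openin_subgroup_if_contains_open[OF sub])
    show "openin T M" using M(1) by (simp add: open_normal_def)
    show "M \<subseteq> normalizer G P" using M(2) open_normal_subset[OF M(1)] by (auto simp: eq normalizer_in_def)
    show "\<one> \<in> M" using subgroup.one_closed[OF open_normal_subgroup[OF M(1)]] .
  qed
qed

lemma closedin_one: "closedin T {\<one>}"
  using Hausdorff one_closed by (simp add: closedin_Hausdorff_singleton topspace_eq)

text \<open>For finite \<open>P\<close> the trivial subgroup can serve as \<open>D\<close>, with
  \<open>W = P\<close>; the commutators with an open subgroup are then trivial.\<close>

lemma centralizer_open_if_finite: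
  assumes fin: "finite P"
  shows "openin T (centralizer G P)"
proof -
  note P = P_closed_subgroup(4)
  have one: "{\<one>} \<lhd> G" by (rule one_is_normal)
  have "P \<subseteq> (\<Union>w\<in>P. {\<one>} #> w)" using P by (force simp: r_coset_def)
  then have "\<forall>x\<in>P. \<exists>M. open_normal G T M \<and> (\<forall>t\<in>M. t \<otimes> x \<otimes> inv t \<otimes> inv x \<in> {\<one>})"
    using ex_open_commutators_in[OF one closedin_one fin subset_refl] by blast
  then obtain f where f: "\<And>x. x \<in> P \<Longrightarrow> open_normal G T (f x)"
    "\<And>x t. x \<in> P \<Longrightarrow> t \<in> f x \<Longrightarrow> t \<otimes> x \<otimes> inv t \<otimes> inv x \<in> {\<one>}"
    by metis
  define M where "M = carrier G \<inter> \<Inter>(f ` P)"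
  have M: "open_normal G T M" unfolding M_def using fin f(1) by (intro open_normal_Inter) auto
  have "M \<subseteq> centralizer G P"
  proof
    fix t assume t: "t \<in> M"
    then have tc: "t \<in> carrier G" by (simp add: M_def)
    have "t \<otimes> x = x \<otimes> t" if x: "x \<in> P" for x
    proof -
      have xc: "x \<in> carrier G" using x P by blast
      have "t \<otimes> x \<otimes> inv t \<otimes> inv x = \<one>" using f(2)[OF x, of t] t x by (auto simp: M_def)
      then show ?thesis using commutator_eq_one_iff[OF tc xc] by blast
    qed
    then show "t \<in> centralizer G P" using tc by (simp add: centralizer_def)
  qed
  then show ?thesis
    using openin_subgroup_if_contains_open[OF subgroup_centralizer[OF P], of M] M
      subgroup.one_closed[OF open_normal_subgroup[OF M]] by (simp add: open_normal_def)
qed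

text \<open>Modulo \<open>M\<close> an element of the nilpotentizer is a product of a
  \<open>p\<close>-element \<open>u\<close> and some \<open>z\<close> commuting with
  \<open>x\<close>. \<open>P\<close> has finitely many conjugates, because an open subgroup
  normalizes it, and the core has finite index in it. So \<open>u\<close> lies in the image of
  \<open>v\<close> times the core for one of finitely many \<open>v\<close>, independent of
  \<open>M\<close>. The nilpotentizer is thus covered by \<open>card V\<close> translates of
  \<open>L M\<close>, which bounds the index of \<open>L M\<close> uniformly.\<close>

lemma core_mult_centralizer_open:
  assumes x: "x \<in> P"
  shows "openin T (core <#> centralizer G {x})"
proof -
  note P = P_closed_subgroup(3,4)
  interpret core: normal core G by (rule core_normal)
  have xc: "x \<in> carrier G" using x P(2) by blast
  \<comment> \<open>\<open>C M\<close> is the centralizer of \<open>x\<close> modulo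
    \<open>M\<close>, and \<open>L M\<close> is what the subgroup in question becomes when commuting
    is only demanded modulo \<open>M\<close>.\<close>
  define C where "C M = {t \<in> carrier G. t \<otimes> x \<otimes> inv t \<otimes> inv x \<in> M}" for M
  define L where "L M = core <#> C M" for M
  have sC: "subgroup (C M) G" if M: "open_normal G T M" for M
    unfolding C_def using M xc by (intro subgroup_commute_mod_normal) (simp add: open_normal_def)
  have sL: "subgroup (L M) G" if M: "open_normal G T M" for M
    unfolding L_def using core_normal sC[OF M] by (rule mult_norm_subgroup)
  have MC: "M \<subseteq> C M" if M: "open_normal G T M" for M
  proof
    interpret open_quotient G T M using M by (rule open_quotientI)
    fix t assume t: "t \<in> M"
    have tc: "t \<in> carrier G" using t subset by blast
    have "t \<otimes> (x \<otimes> inv t \<otimes> inv x) \<in> M"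
      using m_closed[OF t inv_op_closed2[OF xc m_inv_closed[OF t]]] .
    then show "t \<in> C M" using tc xc by (simp add: C_def m_assoc)
  qed
  have CL: "C M \<subseteq> L M" if M: "open_normal G T M" for M
  proof
    fix t assume t: "t \<in> C M"
    then have "\<one> \<otimes> t \<in> L M" using core.one_closed unfolding L_def set_mult_def by blast
    then show "t \<in> L M" using t by (simp add: C_def)
  qed
  have M_sub_L: "M \<subseteq> L M" if M: "open_normal G T M" for M
    using MC[OF M] CL[OF M] by (rule subset_trans)
  have mono: "L N \<subseteq> L M" if "open_normal G T M" "open_normal G T N" "N \<subseteq> M" for M N
  proof -
    have "C N \<subseteq> C M" using that(3) by (auto simp: C_def)
    then show ?thesis unfolding L_def set_mult_def by blast
  qed
  obtain W where W: "finite W" "W \<subseteq> P" "P = (\<Union>w\<in>W. core #> w)"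
    by (rule ex_finite_representatives) (rule that)
  obtain N0 where N0: "open_normal G T N0" "\<And>t. t \<in> N0 \<Longrightarrow> conjugate G t P = P"
    by (rule ex_open_subset_normalizer) (rule that)
  interpret N0: open_quotient G T N0 using N0(1) by (rule open_quotientI)
  \<comment> \<open>Representatives of all cosets of \<open>N0\<close>. As \<open>N0\<close>
    normalizes \<open>P\<close>, they produce every conjugate of \<open>P\<close>.\<close>
  obtain S where S: "finite S" "S \<subseteq> carrier G" "r_coset G N0 ` S = carrier (Q N0)"
    using finite_subset_image[of "carrier (Q N0)" "r_coset G N0" "carrier G"] N0.finite_quotient N0.surj_proj
    by (metis order_refl)
  have conj_S: "\<exists>s\<in>S. conjugate G g P = conjugate G s P" if g: "g \<in> carrier G" for g
  proof -
    obtain s where s: "s \<in> S" "N0 #> g = N0 #> s" using S(3) N0.proj.hom_closed[OF g] by (metis imageE)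
    have sc: "s \<in> carrier G" using s S(2) by blast
    have "g \<otimes> inv s \<in> N0" using N0.proj_eq_iff[OF g sc] s(2) by simp
    then have "inv s \<otimes> (g \<otimes> inv s) \<otimes> s \<in> N0" using N0.inv_op_closed1[OF sc] by blast
    then have n: "inv s \<otimes> g \<in> N0" using g sc by (simp add: m_assoc)
    have "conjugate G s (conjugate G (inv s \<otimes> g) P) = conjugate G g P"
      using conjugate_conjugate[OF sc _ P(2), of "inv s \<otimes> g"] g sc by (simp add: inv_mult_cancel)
    then show ?thesis using N0(2)[OF n] s(1) by auto
  qed
  define V where "V = (\<lambda>(s, w). s \<otimes> w \<otimes> inv s) ` (S \<times> W)"
  have finV: "finite V" using S(1) W(1) by (simp add: V_def)
  have Vc: "V \<subseteq> carrier G" using S(2) W(2) P(2) by (auto simp: V_def subset_iff)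
  obtain n where n: "\<And>M. open_normal G T M \<Longrightarrow> card (carrier (Q M)) \<le> n * card (r_coset G M ` nilpotentizer G T x)"
    by (rule ex_bound[OF x]) (rule that)
  have bound: "card (rcosets (L M)) \<le> n * card V" if M: "open_normal G T M" for M
  proof -
    interpret open_quotient G T M using M by (rule open_quotientI)
    let ?L = "r_coset G M ` L M"
    have sLM: "subgroup ?L (Q M)" using proj.subgroup_img_is_subgroup[OF sL[OF M]] .
    have finL: "finite ?L" using subgroup.subset[OF sLM] finite_quotient by (rule finite_subset)
    obtain i where i: "(M #> x) [^]\<^bsub>Q M\<^esub> (p ^ i) = \<one>\<^bsub>Q M\<^esub>" using PQ_p_power[OF M x] by blast
    have "r_coset G M ` nilpotentizer G T x \<subseteq> (\<Union>v\<in>V. (\<lambda>l. (M #> v) \<otimes>\<^bsub>Q M\<^esub> l) ` ?L)"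
    proof (rule image_subsetI)
      fix y assume y: "y \<in> nilpotentizer G T x"
      obtain u z k where uz: "u \<in> carrier (Q M)" "z \<in> carrier (Q M)" "M #> y = u \<otimes>\<^bsub>Q M\<^esub> z"
        "u [^]\<^bsub>Q M\<^esub> (p ^ k) = \<one>\<^bsub>Q M\<^esub>" "z \<otimes>\<^bsub>Q M\<^esub> (M #> x) = (M #> x) \<otimes>\<^bsub>Q M\<^esub> z"
        using nilpotentizer_quotient(2)[OF p xc i y] by blast
      obtain t where t: "t \<in> carrier G" "z = M #> t" using quotient_cases[OF uz(2)] by blast
      have tx: "t \<otimes> x \<in> carrier G" "x \<otimes> t \<in> carrier G" using t(1) xc by auto
      have "M #> (t \<otimes> x) = M #> (x \<otimes> t)"
        using proj.hom_mult[OF t(1) xc] proj.hom_mult[OF xc t(1)] uz(5) t(2) by metis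
      then have "t \<otimes> x \<otimes> inv (x \<otimes> t) \<in> M" using proj_eq_iff[OF tx] by blast
      then have tC: "t \<in> C M" using t(1) xc by (simp add: C_def inv_mult_group m_assoc)
      let ?U = "generate (Q M) {u}"
      have pU: "p_subgroup p (Q M) ?U"
        using finite_quotient p uz(1,4) by (rule proj.H.p_subgroup_generate)
      have "?U \<subseteq> carrier (Q M)" using uz(1) by (intro proj.H.generate_incl) simp
      then obtain c where c: "c \<in> carrier (Q M)" "?U \<subseteq> conjugate (Q M) c (PQ M)"
        using proj.H.p_subgroup_subset_conjugate_maximal[OF proj.H.subgroup_self finite_quotient p
            PQ_maximal[OF M] pU] by blast
      obtain g where g: "g \<in> carrier G" "c = M #> g" using quotient_cases[OF c(1)] by blast
      have "u \<in> ?U" by (rule generate.incl) simp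
      then have "u \<in> r_coset G M ` conjugate G g P"
        using c(2) proj.conjugate_image[OF g(1) P(2)] g(2) by blast
      moreover obtain s where s: "s \<in> S" "conjugate G g P = conjugate G s P" using conj_S[OF g(1)] by blast
      ultimately obtain q where q: "q \<in> P" "u = M #> (s \<otimes> q \<otimes> inv s)" by (auto simp: conjugate_def)
      obtain w where w: "w \<in> W" "q \<in> core #> w" using q(1) W(3) by blast
      then obtain d where d: "d \<in> core" "q = d \<otimes> w" unfolding r_coset_def by blast
      let ?v = "s \<otimes> w \<otimes> inv s"
      have v: "?v \<in> V" using s(1) w(1) by (force simp: V_def)
      have c': "s \<in> carrier G" "w \<in> carrier G" "d \<in> carrier G" "?v \<in> carrier G"
        using s(1) S(2) w(1) W(2) P(2) d(1) core.subset v Vc by auto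
      \<comment> \<open>Normality of the core moves the core factor of \<open>u\<close> to the right
        of \<open>?v\<close>, where it joins \<open>t\<close> in \<open>L M\<close>.\<close>
      define e where "e = inv ?v \<otimes> (s \<otimes> d \<otimes> inv s) \<otimes> ?v"
      have e: "e \<in> core"
        unfolding e_def using core.inv_op_closed1[OF c'(4) core.inv_op_closed2[OF c'(1) d(1)]] .
      have ec: "e \<in> carrier G" using e core.subset by blast
      have "s \<otimes> q \<otimes> inv s = ?v \<otimes> e"
        unfolding e_def d(2) using c' by (simp add: m_assoc inv_mult_cancel inv_mult_group)
      then have "M #> y = (M #> (?v \<otimes> e)) \<otimes>\<^bsub>Q M\<^esub> (M #> t)" using uz(3) q(2) t(2) by simp
      also have "\<dots> = (M #> ?v) \<otimes>\<^bsub>Q M\<^esub> (M #> (e \<otimes> t))"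
        using proj.hom_mult[OF c'(4) ec] proj.hom_mult[OF ec t(1)]
          proj.H.m_assoc[OF proj.hom_closed[OF c'(4)] proj.hom_closed[OF ec] proj.hom_closed[OF t(1)]]
        by metis
      finally have "M #> y = (M #> ?v) \<otimes>\<^bsub>Q M\<^esub> (M #> (e \<otimes> t))" .
      moreover have "e \<otimes> t \<in> L M" using e tC unfolding L_def set_mult_def by blast
      ultimately show "M #> y \<in> (\<Union>v\<in>V. (\<lambda>l. (M #> v) \<otimes>\<^bsub>Q M\<^esub> l) ` ?L)" using v by blast
    qed
    then have "card (r_coset G M ` nilpotentizer G T x) \<le> card (\<Union>v\<in>V. (\<lambda>l. (M #> v) \<otimes>\<^bsub>Q M\<^esub> l) ` ?L)"
      using finV finL by (intro card_mono) auto
    also have "\<dots> \<le> (\<Sum>v\<in>V. card ((\<lambda>l. (M #> v) \<otimes>\<^bsub>Q M\<^esub> l) ` ?L))" using finV by (rule card_UN_le)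
    also have "\<dots> \<le> (\<Sum>v\<in>V. card ?L)" using finL by (intro sum_mono card_image_le)
    also have "\<dots> = card V * card ?L" by simp
    finally have "n * card (r_coset G M ` nilpotentizer G T x) \<le> n * (card V * card ?L)"
      by (rule mult_left_mono) simp
    with n[OF M] have "card (carrier (Q M)) \<le> n * card V * card ?L" unfolding mult.assoc by (rule order_trans)
    then show ?thesis using sL[OF M] M_sub_L[OF M] by (intro index_le_if_card_le)
  qed
  have "\<exists>M. open_normal G T M \<and> (\<forall>N. open_normal G T N \<longrightarrow> L M \<subseteq> L N)"
    using sL M_sub_L mono bound by (rule open_if_bounded_index)
  then obtain M where M: "open_normal G T M" "\<And>N. open_normal G T N \<Longrightarrow> L M \<subseteq> L N" by blast
  have "L M \<subseteq> core <#> centralizer G {x}"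
  proof
    fix y assume y: "y \<in> L M"
    have yc: "y \<in> carrier G" using subgroup.mem_carrier[OF sL[OF M(1)] y] .
    \<comment> \<open>The possible core parts \<open>d\<close> of \<open>y\<close> modulo
      \<open>N\<close>. These sets are closed, nonempty and decrease with \<open>N\<close>, so by
      compactness one \<open>d\<close> serves all \<open>N\<close>, and then
      \<open>inv d \<otimes> y\<close> commutes with \<open>x\<close> exactly.\<close>
    define K where "K N = core \<inter> {d \<in> carrier G. inv d \<otimes> y \<in> C N}" for N
    have K_closed: "closedin T (K N)" if N: "open_normal G T N" for N
    proof -
      have "openin T (C N)"
        using openin_subgroup_if_contains_open[OF sC[OF N], of N] N MC[OF N]
          subgroup.one_closed[OF open_normal_subgroup[OF N]] by (simp add: open_normal_def)
      then have "closedin T (C N)" using sC[OF N] by (intro closedin_open_subgroup)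
      moreover have "continuous_map T T (\<lambda>d. inv d \<otimes> y)" using yc by (intro continuous_group_intros)
      ultimately show ?thesis unfolding K_def using closedin_core by (intro closedin_Int closedin_preimage)
    qed
    have K_nonempty: "K N \<noteq> {}" if N: "open_normal G T N" for N
    proof -
      have "y \<in> core <#> C N" using M(2)[OF N] y by (auto simp: L_def)
      then obtain d t where d: "d \<in> core" "t \<in> C N" "y = d \<otimes> t" by (auto simp: set_mult_def)
      have "d \<in> carrier G" "t \<in> carrier G" using d core.subset by (auto simp: C_def)
      then have "d \<in> K N" using d by (simp add: K_def inv_mult_cancel)
      then show ?thesis by blast
    qed
    let ?\<U> = "K ` {N. open_normal G T N}"
    have "\<Inter>\<F> \<noteq> {}" if \<F>: "finite \<F> \<and> \<F> \<subseteq> ?\<U>" for \<F>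
    proof -
      obtain \<N> where \<N>: "finite \<N>" "\<N> \<subseteq> {N. open_normal G T N}" "\<F> = K ` \<N>"
        using finite_subset_image \<F> by metis
      let ?N = "carrier G \<inter> \<Inter>\<N>"
      have "open_normal G T ?N" using \<N>(1,2) by (intro open_normal_Inter) auto
      moreover have "K ?N \<subseteq> \<Inter>\<F>" unfolding \<N>(3) by (auto simp: K_def C_def)
      ultimately show ?thesis using K_nonempty by blast
    qed
    then have "\<Inter>?\<U> \<noteq> {}"
      using compact[unfolded compact_space_fip, THEN spec, of ?\<U>] K_closed by blast
    then obtain d where d: "\<And>N. open_normal G T N \<Longrightarrow> d \<in> K N" by blast
    have dc: "d \<in> core" "d \<in> carrier G" using d[OF open_normal_carrier] by (auto simp: K_def)
    let ?t = "inv d \<otimes> y"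
    have tc: "?t \<in> carrier G" using dc yc by simp
    have "?t \<otimes> x \<otimes> inv ?t \<otimes> inv x \<in> {\<one>}"
    proof (rule mem_closed_if_mem_quotients[OF closedin_one _ open_normal_carrier])
      show "?t \<otimes> x \<otimes> inv ?t \<otimes> inv x \<in> carrier G" using tc xc by simp
      fix N assume N: "open_normal G T N"
      interpret N: open_quotient G T N using N by (rule open_quotientI)
      have "?t \<otimes> x \<otimes> inv ?t \<otimes> inv x \<in> N" using d[OF N] by (auto simp: K_def C_def)
      then have "N #> (?t \<otimes> x \<otimes> inv ?t \<otimes> inv x) = N" by (rule N.rcos_const[OF is_group])
      then have "N #> (?t \<otimes> x \<otimes> inv ?t \<otimes> inv x) = N #> \<one>" unfolding coset_mult_one[OF N.subset] .
      then show "N #> (?t \<otimes> x \<otimes> inv ?t \<otimes> inv x) \<in> r_coset G N ` {\<one>}" by blast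
    qed
    then have "?t \<otimes> x = x \<otimes> ?t" using commutator_eq_one_iff[OF tc xc] by blast
    then have "?t \<in> centralizer G {x}" using tc by (simp add: centralizer_def)
    moreover have "y = d \<otimes> ?t" using dc yc by (simp add: inv_mult_cancel)
    ultimately show "y \<in> core <#> centralizer G {x}" using dc(1) unfolding set_mult_def by blast
  qed
  then have "M \<subseteq> core <#> centralizer G {x}" using M_sub_L[OF M(1)] by blast
  moreover have "subgroup (core <#> centralizer G {x}) G"
    using core_normal subgroup_centralizer[of "{x}"] xc by (intro mult_norm_subgroup) auto
  ultimately show ?thesis
    using openin_subgroup_if_contains_open[of "core <#> centralizer G {x}" M] M(1)
      subgroup.one_closed[OF open_normal_subgroup[OF M(1)]] by (simp add: open_normal_def)
qed

end

theorem theorem9: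
  fixes G :: "('a, 'b) monoid_scheme" and T :: "'a topology" and \<mu> :: "'a measure"
    and p :: nat and P :: "'a set"
  assumes "profinite_group G T"
    and "normalized_haar_measure G T \<mu>"
    and "prime p"
    and "sylow_subgroup p G T P"
    and "\<And>g. g \<in> P \<Longrightarrow> measure \<mu> (nilpotentizer G T g) > 0"
  shows "(subgroup (normalizer G P) G \<and> openin T (normalizer G P)) \<and>
    finite (carrier ((G\<lparr>carrier := P\<rparr>) Mod (p_core p G T))) \<and>
    (\<forall>g\<in>P. openin T (p_core p G T <#>\<^bsub>G\<^esub> centralizer G {g})) \<and>
    (finite P \<longrightarrow> openin T (centralizer G P))"
proof -
  interpret profinite_group G T by (rule assms(1))
  interpret positive_nilpotentizers G T \<mu> p P
    using assms by unfold_locales auto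
  show ?thesis
    using normalizer_open finite_quotient_core core_mult_centralizer_open centralizer_open_if_finite
    by (simp add: p_core_eq)
qed

end
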